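(* Let $d\ge 2$ and let $D\subset\mathbb{R}^d$ be a bounded connected open set with $C^2$-smooth boundary. Let $\{X^x\}_{x\in\overline D}$ be the synchronous coupling of reflected Brownian motions in $\overline D$, i.e. the family of solutions of the Skorokhod equation driven by a single standard $d$-dimensional Brownian motion $B$ (see context). Then for every $y\in\overline D$, $$\mathbb{P}\bigl(\exists\, t>0,\ r>0\ \text{ such that }\ \forall x\in \mathcal{B}(y,r)\cap\overline D:\ X^x_t\in\partial D\bigr)=1 .$$
   Context: $\mathcal{B}(y,r)$ denotes the open ball in $\mathbb{R}^d$ with center $y$ and radius $r$. For $x\in\partial D$, $\mathbf{n}(x)$ is the unit inward normal vector to $\partial D$ at $x$. Synchronous coupling: let $B$ be a standard $d$-dimensional Brownian motion (with $B_0=0$). For $x\in\overline D$ consider the Skorokhod equation $$X^x_t = x + B_t+\int_0^t \mathbf{n}(X^x_s)\,dL^x_s,\qquad t\ge 0,$$ where $X^x$ is continuous with $X^x_t\in\overline D$ for all $t\ge0$, and $L^x$ (the local time of $X^x$ on $\partial D$) is a non-decreasing continuous process with $L^x_0=0$ which does not increase when $X^x$ is in $D$, i.e. $\int_0^\infty \mathbf{1}_{D}(X^x_t)\,dL^x_t=0$ a.s. This equation has a unique pathwise solution $(X^x,L^x)$, simultaneously for all $x\in\overline D$ (with the same $B$), and $(x,t)\mapsto X^x_t$ is jointly continuous a.s. The family $\{X^x\}_{x\in\overline D}$ is called the synchronous coupling. *)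

theory Defs
  imports "HOL-Probability.Probability"
begin

definition C2_fun :: "('a::real_normed_vector \<Rightarrow> real) \<Rightarrow> bool" where
  "C2_fun f \<longleftrightarrow>
     (\<exists>(f' :: 'a \<Rightarrow> 'a \<Rightarrow>\<^sub>L real) (f'' :: 'a \<Rightarrow> 'a \<Rightarrow>\<^sub>L ('a \<Rightarrow>\<^sub>L real)).
        (\<forall>x. (f has_derivative blinfun_apply (f' x)) (at x)) \<and>
        (\<forall>x. (f' has_derivative blinfun_apply (f'' x)) (at x)) \<and>
        continuous_on UNIV f'')"

text \<open>
  The boundary is \<open>C\<^sup>2\<close> if near each of its points the set is the strict epigraph of a
  \<open>C\<^sup>2\<close> function, in orthonormal coordinates whose last axis is the unit vector \<open>e\<close>.  Only the
  values of \<open>\<gamma>\<close> on the hyperplane orthogonal to \<open>e\<close> are used.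
\<close>

definition C2_boundary :: "'a::euclidean_space set \<Rightarrow> bool" where
  "C2_boundary D \<longleftrightarrow>
     (\<forall>x\<in>frontier D. \<exists>r>0. \<exists>e. \<exists>\<gamma>. norm e = 1 \<and> C2_fun \<gamma> \<and>
        D \<inter> ball x r = {z \<in> ball x r. \<gamma> (z - (z \<bullet> e) *\<^sub>R e) < z \<bullet> e})"

definition tangent_vector :: "'a::euclidean_space set \<Rightarrow> 'a \<Rightarrow> 'a \<Rightarrow> bool" where
  "tangent_vector S x v \<longleftrightarrow>
     (\<exists>c \<epsilon>. \<epsilon> > 0 \<and> c 0 = x \<and> (\<forall>t. \<bar>t\<bar> < \<epsilon> \<longrightarrow> c t \<in> S) \<and>
        (c has_vector_derivative v) (at (0::real)))"

definition is_inward_unit_normal :: "'a::euclidean_space set \<Rightarrow> 'a \<Rightarrow> 'a \<Rightarrow> bool" where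
  "is_inward_unit_normal D x n \<longleftrightarrow>
     norm n = 1 \<and>
     (\<forall>v. tangent_vector (frontier D) x v \<longrightarrow> n \<bullet> v = 0) \<and>
     (\<exists>\<epsilon>>0. \<forall>s. 0 < s \<and> s < \<epsilon> \<longrightarrow> x + s *\<^sub>R n \<in> D)"

text \<open>
  For a \<open>C\<^sup>2\<close> boundary the inward unit normal at a boundary point is unique.  Off the boundary
  the value is set to \<open>0\<close>; this does not affect the Skorokhod equation, since there the local time
  puts no mass on times at which the path is off the boundary.
\<close>

definition inward_normal :: "'a::euclidean_space set \<Rightarrow> 'a \<Rightarrow> 'a" where
  "inward_normal D x = (if x \<in> frontier D then (THE n. is_inward_unit_normal D x n) else 0)"

text \<open>
  The Lebesgue--Stieltjes measure of a function on \<open>[0,\<infinity>)\<close>, which is extended to the left by its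
  value at \<open>0\<close>.
\<close>

definition stieltjes_measure :: "(real \<Rightarrow> real) \<Rightarrow> real measure" where
  "stieltjes_measure L = interval_measure (\<lambda>t. L (max 0 t))"

text \<open>
  Paths are functions on \<open>real\<close> of which only the restriction to \<open>[0,\<infinity>)\<close> matters.
\<close>

definition skorokhod_solution ::
  "'a::euclidean_space set \<Rightarrow> (real \<Rightarrow> 'a) \<Rightarrow> 'a \<Rightarrow> (real \<Rightarrow> 'a) \<Rightarrow> (real \<Rightarrow> real) \<Rightarrow> bool" where
  "skorokhod_solution D b x X L \<longleftrightarrow>
     continuous_on {0..} X \<and> (\<forall>t\<ge>0. X t \<in> closure D) \<and>
     continuous_on {0..} L \<and> mono_on {0..} L \<and> L 0 = 0 \<and>
     (\<integral>\<^sup>+t\<in>{0..}. indicator D (X t) \<partial>stieltjes_measure L) = 0 \<and>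
     (\<forall>t\<ge>0. X t = x + b t + (LINT s:{0..t}|stieltjes_measure L. inward_normal D (X s)))"

locale standard_brownian_motion = prob_space M
  for M :: "'w measure" and B :: "real \<Rightarrow> 'w \<Rightarrow> 'a::euclidean_space" +
  assumes random_variable_B: "t \<ge> 0 \<Longrightarrow> random_variable borel (B t)"
    and start: "AE \<omega> in M. B 0 \<omega> = 0"
    and continuous_paths: "AE \<omega> in M. continuous_on {0..} (\<lambda>t. B t \<omega>)"
    and independent_increments:
      "\<And>t :: nat \<Rightarrow> real. t 0 \<ge> 0 \<Longrightarrow> mono t \<Longrightarrow>
         indep_vars (\<lambda>_. borel) (\<lambda>i \<omega>. B (t (Suc i)) \<omega> - B (t i) \<omega>) UNIV"
    and independent_coordinates:
      "0 \<le> s \<Longrightarrow> s < t \<Longrightarrow> indep_vars (\<lambda>_. borel) (\<lambda>i \<omega>. (B t \<omega> - B s \<omega>) \<bullet> i) Basis"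
    and gaussian_increments:
      "0 \<le> s \<Longrightarrow> s < t \<Longrightarrow> i \<in> Basis \<Longrightarrow>
         distributed M lborel (\<lambda>\<omega>. (B t \<omega> - B s \<omega>) \<bullet> i) (normal_density 0 (sqrt (t - s)))"

text \<open>
  \<open>X x t \<omega>\<close> is the position at time \<open>t\<close> of the reflected path started from \<open>x\<close>, and \<open>L x t \<omega>\<close> its
  local time on the boundary.  One exceptional null set serves all starting points.
\<close>

locale synchronous_coupling = standard_brownian_motion M B
  for M :: "'w measure" and B :: "real \<Rightarrow> 'w \<Rightarrow> 'a::euclidean_space" +
  fixes D :: "'a set"
    and X :: "'a \<Rightarrow> real \<Rightarrow> 'w \<Rightarrow> 'a"
    and L :: "'a \<Rightarrow> real \<Rightarrow> 'w \<Rightarrow> real"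
  assumes random_variable_X: "x \<in> closure D \<Longrightarrow> t \<ge> 0 \<Longrightarrow> random_variable borel (X x t)"
    and random_variable_L: "x \<in> closure D \<Longrightarrow> t \<ge> 0 \<Longrightarrow> random_variable borel (L x t)"
    and skorokhod:
      "AE \<omega> in M. \<forall>x\<in>closure D.
         skorokhod_solution D (\<lambda>t. B t \<omega>) x (\<lambda>t. X x t \<omega>) (\<lambda>t. L x t \<omega>)"
    and jointly_continuous:
      "AE \<omega> in M. continuous_on (closure D \<times> {0..}) (\<lambda>(x, t). X x t \<omega>)"

end

theory Submission
  imports Defs
begin

text \<open>
  Fix \<open>n\<close> and a small \<open>\<eta>\<close>, and call \<open>t\<close> a cone time if, for all \<open>s\<close> in some \<open>[\<sigma>, t]\<close>, the increment
  \<open>B\<^sub>s - B\<^sub>t\<close> lies in the wide cone \<open>{v. \<eta> |v\<^sub>t\<^sub>a\<^sub>n| \<le> v \<bullet> n}\<close>.  Near a boundary point whose inward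
  normal is close to \<open>n\<close>, every reflected path is on the boundary at a cone time, provided that \<open>B\<close>
  has moved down by enough since \<open>\<sigma>\<close> to force a visit: otherwise, from its last visit at time \<open>u\<close> on,
  the path would move by \<open>B\<^sub>t - B\<^sub>u\<close>, which points out of the domain.  Hence one cone time shortly after
  the first time \<open>\<sigma>\<close> at which \<open>X\<^sup>y = y + B\<close> comes close to the boundary serves all starting points near \<open>y\<close>.

  To find cone times, follow \<open>B\<close> relative to a moving vertex: whenever \<open>B\<close> leaves a narrower cone at
  the vertex, the vertex is shifted by a vector of minus the wide cone, so that the past stays in the
  wide cone at the new vertex.  For a suitable quadratic form, its fourth root at the relative position
  is a supermartingale with strictly negative drift, so a walk started close to the vertex reaches it
  quickly with probability close to 1.  No stochastic calculus is needed: all this is done for the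
  restriction of \<open>B\<close> to grids of mesh \<open>1/m\<close>, and compactness gives cone times as \<open>m\<close> tends to infinity.
\<close>

section \<open>Flatness of the boundary\<close>

text \<open>The difficulty is that one time has to serve an open set of starting points. A cone time
  is defined by \<open>B\<close> alone, so it knows nothing of the starting point. Flatness of order
  \<open>\<eta> / 4\<close> at small scales makes any fixed cone short of a half-space sufficient,
  so \<eta> may be as small as the drift requires. The fourth root comes from the limit \<eta> = 0.
  There the cone is a half-space, the height over the vertex is a one-dimensional Brownian motion
  until it reaches 0, and its power p has drift proportional to -p(1 - p), which is most negative at
  p = 1/2; this is the fourth root of a quadratic form. For \<eta> > 0 the tangential directions add
  a positive drift of order \<eta>^2 d, which \<open>48 * \<eta>^2 * d <= 1\<close> keeps below the
  gain. The boundary point approached, and with it the normal, is known only at time \<sigma>. Hence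
  cone times are sought for finitely many directions at once. A walk started at height
  \<open>y0\<close> has initial potential \<open>sqrt y0\<close>, which bounds its failure
  probability up to a factor that does not depend on the mesh; a small \<open>y0\<close> makes the
  sum over all directions small.\<close>

lemma chart_gradient:
  fixes e :: "'a::euclidean_space"
  assumes e: "norm e = 1" and \<gamma>: "C2_fun \<gamma>"
  defines "g \<equiv> \<lambda>z. z \<bullet> e - \<gamma> (z - (z \<bullet> e) *\<^sub>R e)"
  obtains G where "continuous_on UNIV G" "\<And>z. (g has_derivative (\<lambda>v. G z \<bullet> v)) (at z)"
    "\<And>z. G z \<bullet> e = 1"
proof -
  obtain f' :: "'a \<Rightarrow> 'a \<Rightarrow>\<^sub>L real" and f'' where
    f': "\<And>x. (\<gamma> has_derivative blinfun_apply (f' x)) (at x)" and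
    f'': "\<And>x. (f' has_derivative blinfun_apply (f'' x)) (at x)"
    using \<gamma> unfolding C2_fun_def by blast
  have cf': "continuous_on UNIV f'"
    using f'' by (meson continuous_at_imp_continuous_on has_derivative_continuous)
  have ee: "e \<bullet> e = 1" using e by (simp add: dot_square_norm)
  define P where "P = (\<lambda>z. z - (z \<bullet> e) *\<^sub>R e)"
  have P: "bounded_linear P"
    unfolding P_def by (intro bounded_linear_intros)
  \<comment> \<open>The Riesz vector of the derivative of \<open>g\<close>. Its product with
    \<open>e\<close> is 1 because \<open>P e = 0\<close>.\<close>
  define G where "G = (\<lambda>z. e + (\<Sum>i\<in>Basis. (- blinfun_apply (f' (P z)) (P i)) *\<^sub>R i))"
  have Gv: "G z \<bullet> v = e \<bullet> v - blinfun_apply (f' (P z)) (P v)" for z v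
  proof -
    have "blinfun_apply (f' (P z)) (P v) = blinfun_apply (f' (P z)) (P (\<Sum>i\<in>Basis. (v \<bullet> i) *\<^sub>R i))"
      by (simp add: euclidean_representation)
    also have "\<dots> = (\<Sum>i\<in>Basis. (v \<bullet> i) * blinfun_apply (f' (P z)) (P i))"
      by (simp add: linear_sum[OF bounded_linear.linear[OF P]] blinfun.sum_right
          linear_cmul[OF bounded_linear.linear[OF P]] blinfun.scaleR_right)
    finally show ?thesis
      unfolding G_def inner_add_left inner_sum_left
      by (simp add: inner_commute[of _ v] sum_negf mult.commute)
  qed
  have "continuous_on UNIV G"
  proof -
    have "continuous_on UNIV (\<lambda>z. f' (P z))"
      by (rule continuous_on_compose2[OF cf' linear_continuous_on[OF P]]) auto
    then show ?thesis unfolding G_def by (intro continuous_intros)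
  qed
  moreover have "(g has_derivative (\<lambda>v. G z \<bullet> v)) (at z)" for z
  proof -
    have "(P has_derivative P) (at z)" by (rule bounded_linear_imp_has_derivative[OF P])
    from has_derivative_compose[OF this f'[of "P z"]]
    have "((\<lambda>z. \<gamma> (P z)) has_derivative (\<lambda>v. blinfun_apply (f' (P z)) (P v))) (at z)" .
    then have "((\<lambda>z. z \<bullet> e - \<gamma> (P z)) has_derivative
        (\<lambda>v. v \<bullet> e - blinfun_apply (f' (P z)) (P v))) (at z)"
      by (intro derivative_intros)
    then show ?thesis unfolding g_def Gv by (simp add: P_def inner_commute)
  qed
  moreover have "G z \<bullet> e = 1" for z
    unfolding Gv by (simp add: P_def ee blinfun.zero_right)
  ultimately show ?thesis using that by blast
qed

text \<open>The chart describes \<open>D\<close> only; closure and frontier follow because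
  \<open>g\<close> rises at unit rate along \<open>e\<close>. A zero of \<open>g\<close> is
  therefore a limit of points of \<open>D\<close>, whereas \<open>g < 0\<close> is an open condition
  that keeps \<open>D\<close> away. The lower bound on \<open>norm (G z)\<close> makes the
  normalised gradient continuous.\<close>

lemma chart_at_boundary_point:
  fixes D :: "'a::euclidean_space set"
  assumes D: "open D" "C2_boundary D" and x0: "x0 \<in> frontier D"
  obtains r e G g where "r > 0" "norm e = 1" "continuous_on UNIV G"
    "\<And>z. (g has_derivative (\<lambda>v. G z \<bullet> v)) (at z)" "\<And>z. 1 \<le> norm (G z)"
    "\<And>z s. g (z + s *\<^sub>R e) = g z + (s::real)"
    "\<And>z. z \<in> ball x0 r \<Longrightarrow> z \<in> D \<longleftrightarrow> g z > 0"
    "\<And>z. z \<in> ball x0 r \<Longrightarrow> z \<in> frontier D \<longleftrightarrow> g z = 0"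
    "\<And>z. z \<in> ball x0 r \<Longrightarrow> z \<in> closure D \<Longrightarrow> g z \<ge> 0"
proof -
  obtain r e \<gamma> where r: "r > 0" and e: "norm e = 1" and \<gamma>: "C2_fun \<gamma>" and
    Dr: "D \<inter> ball x0 r = {z \<in> ball x0 r. \<gamma> (z - (z \<bullet> e) *\<^sub>R e) < z \<bullet> e}"
    using D(2)[unfolded C2_boundary_def, rule_format, OF x0] by (elim exE conjE) (rule that)
  define g where "g = (\<lambda>z. z \<bullet> e - \<gamma> (z - (z \<bullet> e) *\<^sub>R e))"
  obtain G where G: "continuous_on UNIV G" "\<And>z. (g has_derivative (\<lambda>v. G z \<bullet> v)) (at z)"
    "\<And>z. G z \<bullet> e = 1"
    using chart_gradient[OF e \<gamma>] unfolding g_def by metis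
  have ee: "e \<bullet> e = 1" using e by (simp add: dot_square_norm)
  have gs: "g (z + s *\<^sub>R e) = g z + s" for z and s :: real
  proof -
    have i: "(z + s *\<^sub>R e) \<bullet> e = z \<bullet> e + s" by (simp add: inner_add_left ee)
    show ?thesis unfolding g_def i scaleR_add_left by simp
  qed
  have gD: "z \<in> D \<longleftrightarrow> g z > 0" if "z \<in> ball x0 r" for z
    using arg_cong[OF Dr, of "\<lambda>A. z \<in> A"] that unfolding g_def by (simp del: mem_ball)
  have cg: "continuous_on UNIV g"
    using has_derivative_continuous[OF G(2)] by (simp add: continuous_on_eq_continuous_at)
  have gcl: "g z \<ge> 0" if z: "z \<in> ball x0 r" "z \<in> closure D" for z
  proof (rule ccontr)
    assume "\<not> g z \<ge> 0"
    then have zU: "z \<in> ball x0 r \<inter> {z. g z < 0}" using z by auto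
    define U where "U = ball x0 r \<inter> {z. g z < 0}"
    have "open U"
      unfolding U_def using open_Collect_less[OF cg continuous_on_const, of 0] by (simp add: open_Int)
    moreover have "z \<in> U \<inter> closure D" using zU z(2) by (simp add: U_def)
    ultimately have "U \<inter> D \<noteq> {}" using open_Int_closure_eq_empty[of U D] by auto
    then obtain z' where "z' \<in> D" "z' \<in> ball x0 r" "g z' < 0" unfolding U_def by blast
    then show False using gD by fastforce
  qed
  have gfr: "z \<in> frontier D \<longleftrightarrow> g z = 0" if z: "z \<in> ball x0 r" for z
  proof
    assume "z \<in> frontier D"
    then have "z \<in> closure D" "z \<notin> D" using D(1) by (auto simp: frontier_def interior_open)
    then show "g z = 0" using gcl[OF z] gD[OF z] by force
  next
    assume g0: "g z = 0"
    have "z \<in> closure D"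
    proof (rule closure_approachable[THEN iffD2], intro allI impI)
      fix \<epsilon> :: real assume "\<epsilon> > 0"
      define s where "s = min (\<epsilon>/2) ((r - dist x0 z)/2)"
      have s: "s > 0" "s < \<epsilon>" "s < r - dist x0 z" using \<open>\<epsilon> > 0\<close> z unfolding s_def by (auto simp: min_def)
      have dz: "dist (z + s *\<^sub>R e) z = s" using s e by (simp add: dist_norm)
      have "dist x0 (z + s *\<^sub>R e) \<le> dist x0 z + s"
        using dist_triangle[of x0 "z + s *\<^sub>R e" z] dz by (simp add: dist_commute)
      then have "z + s *\<^sub>R e \<in> D" using gD s gs g0 by simp
      then show "\<exists>y\<in>D. dist y z < \<epsilon>" using dz s by metis
    qed
    moreover have "z \<notin> D" using gD[OF z] g0 by simp
    ultimately show "z \<in> frontier D" using D(1) by (simp add: frontier_def interior_open)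
  qed
  have "1 \<le> norm (G z)" for z
    using Cauchy_Schwarz_ineq2[of "G z" e] G(3) e by simp
  then show ?thesis using that[OF r e G(1,2) _ gs gD gfr gcl] by blast
qed

text \<open>\<open>inward_normal\<close> is a definite description, so uniqueness is needed as well
  as existence. Every vector orthogonal to the gradient is the velocity of some curve in the
  frontier; a normal is thus a multiple of the gradient, and the side of \<open>D\<close> determines
  its sign.\<close>

lemma inward_normal_chart:
  fixes D :: "'a::euclidean_space set"
  assumes e: "norm e = 1"
    and g': "\<And>z. (g has_derivative (\<lambda>v. G z \<bullet> v)) (at z)" and G1: "\<And>z. 1 \<le> norm (G z)"
    and gs: "\<And>z s. g (z + s *\<^sub>R e) = g z + (s::real)"
    and gD: "\<And>z. z \<in> ball x0 r \<Longrightarrow> z \<in> D \<longleftrightarrow> g z > 0"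
    and gfr: "\<And>z. z \<in> ball x0 r \<Longrightarrow> z \<in> frontier D \<longleftrightarrow> g z = 0"
    and x: "x \<in> ball x0 r" "x \<in> frontier D"
  shows "inward_normal D x = sgn (G x)"
proof -
  have Gx: "G x \<noteq> 0" using G1[of x] by auto
  have gx: "g x = 0" using gfr x by blast
  have line: "((\<lambda>s::real. g (x + s *\<^sub>R v)) has_real_derivative (G x \<bullet> v)) (at 0)" for v
  proof -
    have "((\<lambda>s::real. x + s *\<^sub>R v) has_derivative (\<lambda>s. s *\<^sub>R v)) (at 0)"
      by (auto intro!: derivative_eq_intros)
    from has_derivative_compose[OF this, of g "\<lambda>v. G x \<bullet> v"] g'[of x]
    show ?thesis by (simp add: has_field_derivative_def mult_commute_abs)
  qed
  have in_ball: "\<forall>\<^sub>F s in nhds (0::real). c s \<in> ball x0 r"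
    if "isCont c 0" "c 0 = x" for c :: "real \<Rightarrow> 'a"
    using that x(1) by (intro topological_tendstoD) (auto simp: isCont_def tendsto_at_iff_tendsto_nhds)
  have ex: "is_inward_unit_normal D x (sgn (G x))"
    unfolding is_inward_unit_normal_def
  proof (intro conjI allI impI)
    show "norm (sgn (G x)) = 1" using Gx by (simp add: norm_sgn)
  next
    fix v assume "tangent_vector (frontier D) x v"
    then obtain c \<epsilon> where c: "\<epsilon> > 0" "c 0 = x" "\<And>t. \<bar>t\<bar> < \<epsilon> \<Longrightarrow> c t \<in> frontier D"
      "(c has_vector_derivative v) (at (0::real))" unfolding tangent_vector_def by blast
    have "isCont c 0" using c(4) has_vector_derivative_continuous by blast
    from in_ball[OF this c(2)] have "\<forall>\<^sub>F s in nhds 0. c s \<in> ball x0 r" .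
    moreover have "\<forall>\<^sub>F s in nhds (0::real). \<bar>s\<bar> < \<epsilon>"
      using c(1) by (auto simp: eventually_nhds_metric dist_real_def)
    ultimately have ev: "\<forall>\<^sub>F s in nhds 0. g (c s) = 0"
      by eventually_elim (use c(3) gfr in blast)
    have "(c has_derivative (\<lambda>s. s *\<^sub>R v)) (at 0)"
      using c(4) by (simp add: has_vector_derivative_def)
    from has_derivative_compose[OF this, of g "\<lambda>v. G x \<bullet> v"] g'[of x] c(2)
    have "((\<lambda>s. g (c s)) has_real_derivative (G x \<bullet> v)) (at 0)"
      by (simp add: has_field_derivative_def mult_commute_abs)
    then have "((\<lambda>s. 0) has_real_derivative (G x \<bullet> v)) (at 0)"
      using DERIV_cong_ev[OF refl ev refl] by blast
    then have "G x \<bullet> v = 0" using DERIV_const DERIV_unique by blast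
    then show "sgn (G x) \<bullet> v = 0" by (simp add: sgn_div_norm)
  next
    have pos: "G x \<bullet> sgn (G x) > 0" using Gx by (simp add: sgn_div_norm)
    obtain d where d: "d > 0" "\<And>s. s > 0 \<Longrightarrow> s < d \<Longrightarrow> g (x + s *\<^sub>R sgn (G x)) > 0"
      using DERIV_pos_inc_right[OF line pos] gx by auto
    have "isCont (\<lambda>s. x + s *\<^sub>R sgn (G x)) 0" by (intro continuous_intros)
    from in_ball[OF this] obtain d' where d': "d' > 0" "\<And>s. \<bar>s\<bar> < d' \<Longrightarrow> x + s *\<^sub>R sgn (G x) \<in> ball x0 r"
      by (auto simp: eventually_nhds_metric dist_real_def)
    show "\<exists>\<epsilon>>0. \<forall>s. 0 < s \<and> s < \<epsilon> \<longrightarrow> x + s *\<^sub>R sgn (G x) \<in> D"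
      using d d' gD by (intro exI[of _ "min d d'"]) auto
  qed
  have uniq: "m = sgn (G x)" if m: "is_inward_unit_normal D x m" for m
  proof -
    from m have nm: "norm m = 1" and tv: "\<And>v. tangent_vector (frontier D) x v \<Longrightarrow> m \<bullet> v = 0"
      unfolding is_inward_unit_normal_def by auto
    obtain \<epsilon> where \<epsilon>: "\<epsilon> > 0" "\<And>s. 0 < s \<Longrightarrow> s < \<epsilon> \<Longrightarrow> x + s *\<^sub>R m \<in> D"
      using m unfolding is_inward_unit_normal_def by blast
    have orth: "m \<bullet> v = 0" if v: "G x \<bullet> v = 0" for v
    proof (rule tv)
      \<comment> \<open>The line \<open>x + t v\<close> is slid back along \<open>e\<close> onto the
        zero set of \<open>g\<close>. The correction is of smaller order, since \<open>g\<close> has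
        derivative 0 in direction \<open>v\<close>.\<close>
      define c where "c = (\<lambda>t. x + t *\<^sub>R v - g (x + t *\<^sub>R v) *\<^sub>R e)"
      have c0: "c 0 = x" by (simp add: c_def gx)
      have "((\<lambda>t. g (x + t *\<^sub>R v)) has_vector_derivative 0) (at 0)"
        using line[of v] v by (metis has_real_derivative_iff_has_vector_derivative)
      then have dc: "(c has_vector_derivative v) (at 0)"
        unfolding c_def using has_vector_derivative_diff[of "\<lambda>t. x + t *\<^sub>R v" v "at 0"
            "\<lambda>t. g (x + t *\<^sub>R v) *\<^sub>R e" 0]
          bounded_linear.has_vector_derivative[OF bounded_linear_scaleR_left, of "\<lambda>t. g (x + t *\<^sub>R v)" 0 "at 0" e]
        by (auto simp: has_vector_derivative_def intro!: derivative_eq_intros)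
      have gc: "g (c t) = 0" for t
        using gs[of "x + t *\<^sub>R v" "- g (x + t *\<^sub>R v)"] by (simp add: c_def)
      have "\<forall>\<^sub>F s in nhds 0. c s \<in> ball x0 r"
        using in_ball c0 dc has_vector_derivative_continuous by blast
      then obtain d where "d > 0" "\<And>s. \<bar>s\<bar> < d \<Longrightarrow> c s \<in> ball x0 r"
        by (auto simp: eventually_nhds_metric dist_real_def)
      then show "tangent_vector (frontier D) x v"
        unfolding tangent_vector_def using c0 gc gfr dc by blast
    qed
    define l where "l = (G x \<bullet> m) / (G x \<bullet> G x)"
    have "G x \<bullet> (m - l *\<^sub>R G x) = 0" using Gx by (simp add: l_def inner_diff_right)
    then have "m \<bullet> (m - l *\<^sub>R G x) = 0" "G x \<bullet> (m - l *\<^sub>R G x) = 0" using orth by blast+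
    then have "(m - l *\<^sub>R G x) \<bullet> (m - l *\<^sub>R G x) = 0"
      by (metis inner_diff_left inner_scaleR_left diff_self mult_zero_right)
    then have ml: "m = l *\<^sub>R G x" by simp
    have "\<not> G x \<bullet> m < 0"
    proof
      assume "G x \<bullet> m < 0"
      then obtain d where d: "d > 0" "\<And>s. s > 0 \<Longrightarrow> s < d \<Longrightarrow> g (x + s *\<^sub>R m) < 0"
        using DERIV_neg_dec_right[OF line[of m]] gx by auto
      have "isCont (\<lambda>s. x + s *\<^sub>R m) 0" by (intro continuous_intros)
      from in_ball[OF this] obtain d' where d': "d' > 0" "\<And>s. \<bar>s\<bar> < d' \<Longrightarrow> x + s *\<^sub>R m \<in> ball x0 r"
        by (auto simp: eventually_nhds_metric dist_real_def)
      define s where "s = min (min d d') \<epsilon> / 2"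
      have "s > 0" "s < d" "s < d'" "s < \<epsilon>" using d(1) d'(1) \<epsilon>(1) by (auto simp: s_def min_def)
      then show False using d(2)[of s] d'(2)[of s] \<epsilon>(2)[of s] gD by force
    qed
    then have "l \<ge> 0" by (simp add: l_def)
    moreover have "\<bar>l\<bar> * norm (G x) = 1" using nm ml by (metis norm_scaleR)
    ultimately show ?thesis using ml Gx by (simp add: sgn_div_norm field_simps)
  qed
  show ?thesis
    unfolding inward_normal_def if_P[OF x(2)] by (intro the_equality ex uniq)
qed

text \<open>Both conditions are imposed at every boundary point of the ball and not only at its
  centre, because the last visit of a path to the boundary may take place anywhere in the
  ball.\<close>

definition flat_at :: "'a::euclidean_space set \<Rightarrow> real \<Rightarrow> real \<Rightarrow> 'a \<Rightarrow> 'a \<Rightarrow> bool" where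
  "flat_at D \<theta> r p n \<longleftrightarrow> norm n = 1 \<and>
     (\<forall>x \<in> frontier D \<inter> ball p r. norm (inward_normal D x - n) \<le> \<theta> \<and>
        (\<forall>z \<in> closure D \<inter> ball p r. - \<theta> * norm (z - x) \<le> (z - x) \<bullet> n))"

lemma flat_at_mono:
  "flat_at D \<theta> r p n \<Longrightarrow> ball q s \<subseteq> ball p r \<Longrightarrow> flat_at D \<theta> s q n"
  unfolding flat_at_def by blast

text \<open>The direction is \<open>sgn (G x0)\<close>, and continuity of the gradient controls the
  nearby normals. The one-sided inequality is the mean value inequality for \<open>g\<close> minus
  its linear part at \<open>x0\<close>, combined with \<open>g x = 0 <= g z\<close>; dividing by
  \<open>norm (G x0) >= 1\<close> only improves the error.\<close>

lemma boundary_point_flat: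
  fixes D :: "'a::euclidean_space set"
  assumes D: "open D" "C2_boundary D" and x0: "x0 \<in> frontier D" and \<theta>: "\<theta> > 0"
  shows "\<exists>r>0. \<exists>n. flat_at D \<theta> r x0 n"
proof -
  obtain r e g G where r: "r > 0" and e: "norm e = 1" and cG: "continuous_on UNIV G" and
    g': "\<And>z. (g has_derivative (\<lambda>v. G z \<bullet> v)) (at z)" and G1: "\<And>z. 1 \<le> norm (G z)" and
    gs: "\<And>z s. g (z + s *\<^sub>R e) = g z + (s::real)" and
    gD: "\<And>z. z \<in> ball x0 r \<Longrightarrow> z \<in> D \<longleftrightarrow> g z > 0" and
    gfr: "\<And>z. z \<in> ball x0 r \<Longrightarrow> z \<in> frontier D \<longleftrightarrow> g z = 0" and
    gcl: "\<And>z. z \<in> ball x0 r \<Longrightarrow> z \<in> closure D \<Longrightarrow> g z \<ge> 0"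
    by (rule chart_at_boundary_point[OF D x0]) (rule that; assumption)
  have G0: "G z \<noteq> 0" for z using G1[of z] by auto
  have cs: "isCont (\<lambda>z. sgn (G z)) x0"
    using cG G0 by (intro continuous_sgn) (auto simp: continuous_on_eq_continuous_at)
  obtain d1 where d1: "d1 > 0" "\<And>z. dist z x0 < d1 \<Longrightarrow> dist (sgn (G z)) (sgn (G x0)) < \<theta>"
    using cs \<theta> unfolding continuous_at_eps_delta by blast
  have "isCont G x0" using cG by (auto simp: continuous_on_eq_continuous_at)
  then obtain d2 where d2: "d2 > 0" "\<And>z. dist z x0 < d2 \<Longrightarrow> dist (G z) (G x0) < \<theta>"
    using \<theta> unfolding continuous_at_eps_delta by blast
  define r' where "r' = min r (min d1 d2)"
  have r': "r' > 0" using r d1 d2 by (simp add: r'_def)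
  have "norm (inward_normal D x - sgn (G x0)) \<le> \<theta>" if x: "x \<in> frontier D" "x \<in> ball x0 r'" for x
  proof -
    have "x \<in> ball x0 r" "dist x x0 < d1" using x by (auto simp: r'_def dist_commute)
    moreover have "inward_normal D x = sgn (G x)"
      by (rule inward_normal_chart[OF e g' G1 gs gD gfr \<open>x \<in> ball x0 r\<close> x(1)])
    ultimately show ?thesis using d1(2)[of x] by (simp add: dist_norm)
  qed
  moreover have "- \<theta> * norm (z - x) \<le> (z - x) \<bullet> sgn (G x0)"
    if x: "x \<in> frontier D" "x \<in> ball x0 r'" and z: "z \<in> closure D" "z \<in> ball x0 r'" for x z
  proof -
    define \<phi> where "\<phi> = (\<lambda>u. g u - G x0 \<bullet> u)"
    have "norm (\<phi> z - \<phi> x) \<le> \<theta> * norm (z - x)"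
    proof (rule differentiable_bound[of "ball x0 r'" \<phi> "\<lambda>u v. G u \<bullet> v - G x0 \<bullet> v"])
      show "convex (ball x0 r')" by simp
      show "(\<phi> has_derivative (\<lambda>v. G u \<bullet> v - G x0 \<bullet> v)) (at u within ball x0 r')" for u :: 'a
        unfolding \<phi>_def by (intro derivative_intros has_derivative_at_withinI[OF g'])
      show "onorm (\<lambda>v::'a. G u \<bullet> v - G x0 \<bullet> v) \<le> \<theta>" if "u \<in> ball x0 r'" for u :: 'a
      proof (rule onorm_bound)
        show "0 \<le> \<theta>" using \<theta> by simp
        fix v :: 'a
        have "dist (G u) (G x0) < \<theta>" using d2(2)[of u] that by (auto simp: r'_def dist_commute)
        then have "norm (G u - G x0) * norm v \<le> \<theta> * norm v"
          by (intro mult_right_mono) (auto simp: dist_norm)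
        then show "norm (G u \<bullet> v - G x0 \<bullet> v) \<le> \<theta> * norm v"
          using Cauchy_Schwarz_ineq2[of "G u - G x0" v] by (simp add: inner_diff_left)
      qed
    qed (use x z in auto)
    moreover have "g x = 0" using gfr x by (auto simp: r'_def)
    moreover have "g z \<ge> 0" using gcl z by (auto simp: r'_def)
    ultimately have *: "- (\<theta> * norm (z - x)) \<le> G x0 \<bullet> (z - x)"
      unfolding \<phi>_def by (simp add: inner_diff_right)
    have "(z - x) \<bullet> sgn (G x0) = (G x0 \<bullet> (z - x)) / norm (G x0)"
      by (simp add: sgn_div_norm inner_commute divide_inverse mult.commute)
    moreover have "- (\<theta> * norm (z - x)) \<le> - (\<theta> * norm (z - x)) / norm (G x0)"
    proof -
      have "\<theta> * norm (z - x) * 1 \<le> \<theta> * norm (z - x) * norm (G x0)"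
        using G1[of x0] \<theta> by (intro mult_left_mono) auto
      then have "\<theta> * norm (z - x) / norm (G x0) \<le> \<theta> * norm (z - x)"
        using G1[of x0] by (intro divide_le_eq[THEN iffD2]) auto
      then show ?thesis by simp
    qed
    ultimately show ?thesis
      using divide_right_mono[OF * norm_ge_zero, of "G x0"] by (simp only: mult_minus_left)
  qed
  ultimately have "flat_at D \<theta> r' x0 (sgn (G x0))"
    unfolding flat_at_def using G0 by (auto simp: norm_sgn)
  then show ?thesis using r' by blast
qed

text \<open>A Lebesgue number argument: half radii leave room for a common \<open>r\<close>.
  Finiteness of \<open>N\<close> is what permits a union bound over the directions.\<close>

lemma uniformly_flat:
  fixes D :: "'a::euclidean_space set"
  assumes D: "bounded D" "open D" "C2_boundary D" and \<theta>: "\<theta> > 0"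
  obtains r N where "r > 0" "finite N" "\<And>n. n \<in> N \<Longrightarrow> norm n = 1"
    "\<And>p. p \<in> frontier D \<Longrightarrow> \<exists>n\<in>N. flat_at D \<theta> r p n"
proof -
  have "\<forall>x\<in>frontier D. \<exists>r n. r > 0 \<and> flat_at D \<theta> r x n"
    using boundary_point_flat[OF D(2,3) _ \<theta>] by blast
  then obtain R \<nu> where R: "\<And>x. x \<in> frontier D \<Longrightarrow> R x > 0"
    "\<And>x. x \<in> frontier D \<Longrightarrow> flat_at D \<theta> (R x) x (\<nu> x)" by metis
  have "compact (frontier D)" using D(1) by (simp add: compact_frontier_bounded)
  then obtain T where T: "T \<subseteq> frontier D" "finite T" "frontier D \<subseteq> (\<Union>x\<in>T. ball x (R x / 2))"
    using R(1) by (elim compactE_image[of _ "frontier D" "\<lambda>x. ball x (R x / 2)"])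
      (auto intro!: bexI centre_in_ball[THEN iffD2])
  define r where "r = Min (insert 1 ((\<lambda>x. R x / 2) ` T))"
  have "r > 0" unfolding r_def using T R(1) by (subst Min_gr_iff) auto
  moreover have "finite (\<nu> ` T)" using T by simp
  moreover have "norm n = 1" if "n \<in> \<nu> ` T" for n
    using that R(2) T(1) unfolding flat_at_def by blast
  moreover have "\<exists>n\<in>\<nu> ` T. flat_at D \<theta> r p n" if "p \<in> frontier D" for p
  proof -
    obtain x where x: "x \<in> T" "p \<in> ball x (R x / 2)" using T(3) \<open>p \<in> frontier D\<close> by blast
    have "r \<le> R x / 2" unfolding r_def using T(2) x(1) by (intro Min_le) auto
    have "ball p r \<subseteq> ball x (R x)"
    proof
      fix u assume "u \<in> ball p r"
      then show "u \<in> ball x (R x)"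
        using x(2) \<open>r \<le> R x / 2\<close> dist_triangle[of x u p] by simp
    qed
    then show ?thesis using flat_at_mono R(2) T(1) x(1) by blast
  qed
  ultimately show ?thesis using that by blast
qed

text \<open>In each chart the normal is the normalised gradient. Continuity and the bound 1 make the
  integral in the Skorokhod equation a genuine Bochner integral.\<close>

lemma continuous_on_inward_normal:
  fixes D :: "'a::euclidean_space set"
  assumes "open D" "C2_boundary D"
  shows "continuous_on (frontier D) (inward_normal D)"
    and "\<And>x. norm (inward_normal D x) \<le> 1"
proof -
  have *: "isCont (\<lambda>z. sgn (G z)) x" if "continuous_on UNIV G" "G x \<noteq> 0" for G :: "'a \<Rightarrow> 'a" and x
    using that by (intro continuous_sgn) (auto simp: continuous_on_eq_continuous_at)
  show "continuous_on (frontier D) (inward_normal D)"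
    unfolding continuous_on_eq_continuous_within
  proof
    fix x assume x: "x \<in> frontier D"
    obtain r e g G where r: "r > 0" and e: "norm e = 1" and cG: "continuous_on UNIV G" and
      g': "\<And>z. (g has_derivative (\<lambda>v. G z \<bullet> v)) (at z)" and G1: "\<And>z. 1 \<le> norm (G z)" and
      gs: "\<And>z s. g (z + s *\<^sub>R e) = g z + (s::real)" and
      gD: "\<And>z. z \<in> ball x r \<Longrightarrow> z \<in> D \<longleftrightarrow> g z > 0" and
      gfr: "\<And>z. z \<in> ball x r \<Longrightarrow> z \<in> frontier D \<longleftrightarrow> g z = 0" and
      gcl: "\<And>z. z \<in> ball x r \<Longrightarrow> z \<in> closure D \<Longrightarrow> g z \<ge> 0"
      by (rule chart_at_boundary_point[OF assms x]) (rule that; assumption)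
    have "G x \<noteq> 0" using G1[of x] by auto
    then have "continuous (at x within frontier D) (\<lambda>z. sgn (G z))"
      using *[OF cG] continuous_at_imp_continuous_at_within by blast
    then show "continuous (at x within frontier D) (inward_normal D)"
    proof (rule continuous_transform_within[OF _ r x])
      fix z assume "z \<in> frontier D" "dist z x < r"
      then show "sgn (G z) = inward_normal D z"
        using inward_normal_chart[OF e g' G1 gs gD gfr _ \<open>z \<in> frontier D\<close>, of x r]
        by (simp add: dist_commute)
    qed
  qed
  show "norm (inward_normal D x) \<le> 1" for x
  proof (cases "x \<in> frontier D")
    case x: True
    obtain r e g G where r: "r > 0" and e: "norm e = 1" and cG: "continuous_on UNIV G" and
      g': "\<And>z. (g has_derivative (\<lambda>v. G z \<bullet> v)) (at z)" and G1: "\<And>z. 1 \<le> norm (G z)" and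
      gs: "\<And>z s. g (z + s *\<^sub>R e) = g z + (s::real)" and
      gD: "\<And>z. z \<in> ball x r \<Longrightarrow> z \<in> D \<longleftrightarrow> g z > 0" and
      gfr: "\<And>z. z \<in> ball x r \<Longrightarrow> z \<in> frontier D \<longleftrightarrow> g z = 0" and
      gcl: "\<And>z. z \<in> ball x r \<Longrightarrow> z \<in> closure D \<Longrightarrow> g z \<ge> 0"
      by (rule chart_at_boundary_point[OF assms x]) (rule that; assumption)
    show ?thesis
      using inward_normal_chart[OF e g' G1 gs gD gfr _ x, of x r] r by (simp add: norm_sgn)
  qed (simp add: inward_normal_def)
qed

section \<open>Paths of the Skorokhod equation\<close>

lemma skorokhod_set_integral_eq:
  assumes sol: "skorokhod_solution D b x X L" and "0 \<le> u" "u \<le> t"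
  shows "X t - X u - (b t - b u) =
    (LINT s:{0..t}|stieltjes_measure L. inward_normal D (X s)) -
    (LINT s:{0..u}|stieltjes_measure L. inward_normal D (X s))"
proof -
  have "\<And>t. t \<ge> 0 \<Longrightarrow> X t = x + b t + (LINT s:{0..t}|stieltjes_measure L. inward_normal D (X s))"
    using sol unfolding skorokhod_solution_def by blast
  from this[of t] this[of u] show ?thesis using assms by simp
qed

text \<open>Off the boundary \<open>inward_normal\<close> is 0 by default, so the integrands over
  \<open>{0..t}\<close> and \<open>{0..u}\<close> coincide. Time \<open>u\<close> itself is left out
  of \<open>free\<close>, so that it may be a last visit to the boundary.\<close>

lemma skorokhod_free_increment:
  assumes sol: "skorokhod_solution D b x X L" and "0 \<le> u" "u \<le> t"
    and free: "\<And>s. u < s \<Longrightarrow> s \<le> t \<Longrightarrow> X s \<notin> frontier D"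
  shows "X t - X u = b t - b u"
proof -
  have "(LINT s:{0..t}|stieltjes_measure L. inward_normal D (X s)) =
      (LINT s:{0..u}|stieltjes_measure L. inward_normal D (X s))"
    unfolding set_lebesgue_integral_def
  proof (rule Bochner_Integration.integral_cong[OF refl])
    fix s
    show "indicat_real {0..t} s *\<^sub>R inward_normal D (X s) =
        indicat_real {0..u} s *\<^sub>R inward_normal D (X s)"
      using free[of s] \<open>u \<le> t\<close> by (auto simp: indicator_def inward_normal_def)
  qed
  then show ?thesis
    using skorokhod_set_integral_eq[OF assms(1-3)] by simp
qed

lemma emeasure_stieltjes_Ioc:
  assumes L: "mono_on {0..} L" "continuous_on {0..} L" and "s \<le> t"
  shows "emeasure (stieltjes_measure L) {s<..t} = L (max 0 t) - L (max 0 s)"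
  unfolding stieltjes_measure_def
proof (rule emeasure_interval_measure_Ioc[OF \<open>s \<le> t\<close>])
  show "L (max 0 x) \<le> L (max 0 y)" if "x \<le> y" for x y :: real
    using that by (intro mono_onD[OF L(1)]) auto
  have "continuous_on UNIV (\<lambda>t. L (max 0 t))"
    by (rule continuous_on_compose2[OF L(2)]) (auto intro!: continuous_intros)
  then have "isCont (\<lambda>t. L (max 0 t)) a" for a
    by (simp add: continuous_on_eq_continuous_at)
  then show "continuous (at_right a) (\<lambda>t. L (max 0 t))" for a
    by (rule continuous_at_imp_continuous_at_within)
qed

lemma finite_stieltjes_measure:
  assumes "mono_on {0..} L" "continuous_on {0..} L"
  shows "emeasure (stieltjes_measure L) {0..t} < \<infinity>"
proof -
  \<comment> \<open>Starting the half-open interval at -1 includes the point 0 and adds no mass, as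
    the integrator is constant to the left of 0.\<close>
  have "emeasure (stieltjes_measure L) {0..t} \<le> emeasure (stieltjes_measure L) {- 1<..max 0 t}"
    by (rule emeasure_mono) (auto simp: stieltjes_measure_def)
  also have "\<dots> < \<infinity>" by (subst emeasure_stieltjes_Ioc[OF assms]) auto
  finally show ?thesis .
qed

lemma inward_normal_measurable:
  assumes "open D" "C2_boundary D"
  shows "inward_normal D \<in> borel_measurable borel"
proof -
  have "inward_normal D = (\<lambda>x. indicator (frontier D) x *\<^sub>R inward_normal D x)"
    by (auto simp: indicator_def inward_normal_def fun_eq_iff)
  moreover have "\<dots> \<in> borel_measurable borel"
    using continuous_on_inward_normal(1)[OF assms]
    by (intro borel_measurable_continuous_on_indicator) auto
  ultimately show ?thesis by simp
qed

lemma skorokhod_push_integrable: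
  assumes D: "open D" "C2_boundary D" and sol: "skorokhod_solution D b x X L"
  shows "set_integrable (stieltjes_measure L) {0..t} (\<lambda>s. inward_normal D (X s))"
proof -
  have cX: "continuous_on {0..} X" and L: "mono_on {0..} L" "continuous_on {0..} L"
    using sol unfolding skorokhod_solution_def by blast+
  \<comment> \<open>The path is known to be continuous on \<open>{0..}\<close> only;
    \<open>max 0 s\<close> gives a version that is measurable on the whole line and agrees with it
    where the integral is taken.\<close>
  have "continuous_on UNIV (\<lambda>s. X (max 0 s))"
    by (rule continuous_on_compose2[OF cX]) (auto intro!: continuous_intros)
  then have "(\<lambda>s. X (max 0 s)) \<in> borel_measurable borel"
    by (rule borel_measurable_continuous_onI)
  then have "(\<lambda>s. inward_normal D (X (max 0 s))) \<in> borel_measurable borel"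
    using measurable_compose inward_normal_measurable[OF D] by blast
  then have meas: "(\<lambda>s. inward_normal D (X (max 0 s))) \<in> borel_measurable (stieltjes_measure L)"
    by (simp add: stieltjes_measure_def cong: measurable_cong_sets)
  have "set_integrable (stieltjes_measure L) {0..t} (\<lambda>s. inward_normal D (X (max 0 s)))"
    unfolding set_integrable_def
  proof (rule Bochner_Integration.integrable_bound[where f="\<lambda>s. indicat_real {0..t} s"])
    show "integrable (stieltjes_measure L) (\<lambda>s. indicat_real {0..t} s)"
      using finite_stieltjes_measure[OF L] by (intro integrable_real_indicator) (auto simp: stieltjes_measure_def)
    show "(\<lambda>s. indicat_real {0..t} s *\<^sub>R inward_normal D (X (max 0 s))) \<in> borel_measurable (stieltjes_measure L)"
      using meas by (intro borel_measurable_scaleR) (auto simp: stieltjes_measure_def)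
    show "AE s in stieltjes_measure L. norm (indicat_real {0..t} s *\<^sub>R inward_normal D (X (max 0 s)))
        \<le> norm (indicat_real {0..t} s)"
      using continuous_on_inward_normal(2)[OF D] by (auto simp: indicator_def)
  qed
  moreover have "indicat_real {0..t} s *\<^sub>R inward_normal D (X (max 0 s)) =
      indicat_real {0..t} s *\<^sub>R inward_normal D (X s)" for s
    by (auto simp: indicator_def)
  ultimately show ?thesis unfolding set_integrable_def by simp
qed

text \<open>The push is an integral of unit vectors within \<theta> of \<open>n\<close>. The
  inequality holds for each integrand \<open>f s\<close>, and it survives integration because the
  norm of an integral is at most the integral of the norm.\<close>

lemma skorokhod_push_direction:
  assumes D: "open D" "C2_boundary D" and sol: "skorokhod_solution D b x X L"
    and t: "0 \<le> \<sigma>" "\<sigma> \<le> t" and n: "norm n = 1" and \<theta>: "0 \<le> \<theta>" "\<theta> \<le> 1"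
    and near: "\<And>s. \<sigma> \<le> s \<Longrightarrow> s \<le> t \<Longrightarrow> X s \<in> frontier D \<Longrightarrow> norm (inward_normal D (X s) - n) \<le> \<theta>"
  shows "(1 - \<theta>) * norm (X t - X \<sigma> - (b t - b \<sigma>)) \<le> (X t - X \<sigma> - (b t - b \<sigma>)) \<bullet> n"
proof -
  let ?\<mu> = "stieltjes_measure L"
  define f where "f = (\<lambda>s. indicat_real {\<sigma><..t} s *\<^sub>R inward_normal D (X s))"
  have int: "integrable ?\<mu> (\<lambda>s. indicat_real {0..u} s *\<^sub>R inward_normal D (X s))" for u
    using skorokhod_push_integrable[OF D sol] unfolding set_integrable_def .
  have f_eq: "f s = indicat_real {0..t} s *\<^sub>R inward_normal D (X s) -
      indicat_real {0..\<sigma>} s *\<^sub>R inward_normal D (X s)" for s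
    using t by (auto simp: f_def indicator_def)
  have fi: "integrable ?\<mu> f"
    unfolding f_eq by (intro Bochner_Integration.integrable_diff int)
  have I: "X t - X \<sigma> - (b t - b \<sigma>) = integral\<^sup>L ?\<mu> f"
    unfolding skorokhod_set_integral_eq[OF sol t] set_lebesgue_integral_def f_eq
    by (rule Bochner_Integration.integral_diff[OF int int, symmetric])
  have nn: "n \<bullet> n = 1" using n by (simp add: dot_square_norm)
  have pw: "(1 - \<theta>) * norm (f s) \<le> f s \<bullet> n" for s
  proof (cases "\<sigma> < s \<and> s \<le> t \<and> X s \<in> frontier D")
    case True
    let ?m = "inward_normal D (X s)"
    have "norm (?m - n) \<le> \<theta>" using near True by auto
    moreover have "\<bar>(?m - n) \<bullet> n\<bar> \<le> norm (?m - n)"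
      using Cauchy_Schwarz_ineq2[of "?m - n" n] n by simp
    ultimately have "1 - \<theta> \<le> ?m \<bullet> n" by (simp add: inner_diff_left nn)
    moreover have "(1 - \<theta>) * norm ?m \<le> (1 - \<theta>) * 1"
      using continuous_on_inward_normal(2)[OF D] \<theta> by (intro mult_left_mono) auto
    ultimately show ?thesis using True by (simp add: f_def)
  qed (auto simp: f_def indicator_def inward_normal_def)
  have "(1 - \<theta>) * norm (integral\<^sup>L ?\<mu> f) \<le> (1 - \<theta>) * (\<integral>s. norm (f s) \<partial>?\<mu>)"
    using \<theta> by (intro mult_left_mono integral_norm_bound) auto
  also have "\<dots> = (\<integral>s. (1 - \<theta>) * norm (f s) \<partial>?\<mu>)" by simp
  also have "\<dots> \<le> (\<integral>s. f s \<bullet> n \<partial>?\<mu>)"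
    using fi pw by (intro integral_mono) auto
  also have "\<dots> = integral\<^sup>L ?\<mu> f \<bullet> n" using fi by (rule integral_inner_left)
  finally show ?thesis unfolding I .
qed

section \<open>Confinement of the paths and forced presence on the boundary\<close>

lemma last_visit:
  fixes X :: "real \<Rightarrow> 'a::t2_space"
  assumes "continuous_on {\<sigma>..t} X" "closed F" "s \<in> {\<sigma>..t}" "X s \<in> F"
  obtains u where "u \<in> {\<sigma>..t}" "X u \<in> F" "\<And>s. u < s \<Longrightarrow> s \<le> t \<Longrightarrow> X s \<notin> F"
proof -
  let ?S = "{\<sigma>..t} \<inter> X -` F"
  have "closed ?S" using assms(1,2) by (rule continuous_closed_preimage[OF _ closed_atLeastAtMost])
  then have "compact ?S" by (metis compact_Icc compact_Int_closed inf.left_idem)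
  then obtain u where "u \<in> ?S" "\<And>s. s \<in> ?S \<Longrightarrow> s \<le> u"
    using compact_attains_sup[of ?S] assms(3,4) by blast
  then show ?thesis
  proof (intro that[of u])
    fix s assume "u < s" "s \<le> t"
    with \<open>u \<in> ?S\<close> \<open>\<And>s. s \<in> ?S \<Longrightarrow> s \<le> u\<close>[of s] show "X s \<notin> F" by auto
  qed auto
qed

text \<open>Consider the first time at distance \<open>r/2\<close> from \<open>p\<close>. Until then
  the total push \<open>I\<close> satisfies \<open>3/4 * norm I <= I \<bullet> n\<close>, so its
  length is controlled by its height, and the height is bounded since at the last visit the path
  lies on a nearly flat boundary. This gives
  \<open>norm I <= 4/3 * (r/8 + \<epsilon> + \<rho>)\<close>, hence a distance of at most
  \<open>r/6 + 7/3 * (\<epsilon> + \<rho>)\<close>, which is below \<open>r/2\<close> exactly when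
  \<open>\<epsilon> + \<rho> < r/7\<close>.\<close>

lemma skorokhod_confined:
  fixes D :: "'a::euclidean_space set"
  assumes D: "open D" "C2_boundary D" and sol: "skorokhod_solution D b x X L"
    and flat: "flat_at D \<theta> r p n" and p: "p \<in> frontier D" and \<theta>: "0 \<le> \<theta>" "\<theta> \<le> 1/4"
    and t: "0 \<le> \<sigma>" "\<sigma> \<le> t" and start: "norm (X \<sigma> - p) \<le> \<epsilon>"
    and osc: "\<And>s. s \<in> {\<sigma>..t} \<Longrightarrow> norm (b s - b \<sigma>) \<le> \<rho>" and small: "\<epsilon> + \<rho> < r / 7"
    and s: "s \<in> {\<sigma>..t}"
  shows "X s \<in> ball p r"
proof (rule ccontr)
  assume "X s \<notin> ball p r"
  have cX: "continuous_on {\<sigma>..t} X"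
    using sol t unfolding skorokhod_solution_def by (auto elim: continuous_on_subset)
  have n: "norm n = 1" using flat by (simp add: flat_at_def)
  have "\<rho> \<ge> 0" "\<epsilon> \<ge> 0"
    using osc[of \<sigma>] t order_trans[OF norm_ge_zero start] by auto
  then have r: "r > 0" using small by linarith
  define N where "N = (\<lambda>s. norm (X s - p))"
  have cN: "continuous_on {\<sigma>..t} N" unfolding N_def by (intro continuous_intros cX)
  have N\<sigma>: "N \<sigma> < r/2" using start small r \<open>\<rho> \<ge> 0\<close> unfolding N_def by linarith
  have Ns: "N s \<ge> r/2" using \<open>X s \<notin> ball p r\<close> r by (simp add: N_def dist_norm norm_minus_commute)
  let ?S = "{\<sigma>..t} \<inter> N -` {r/2..}"
  have "closed ?S" by (rule continuous_closed_preimage[OF cN]) auto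
  then have "compact ?S" by (metis compact_Icc compact_Int_closed inf.left_idem)
  then obtain s1 where s1: "s1 \<in> ?S" "\<And>s. s \<in> ?S \<Longrightarrow> s1 \<le> s"
    using compact_attains_inf[of ?S] s Ns by blast
  obtain s2 where s2: "\<sigma> \<le> s2" "s2 \<le> s1" "N s2 = r/2"
    using IVT'[of N \<sigma> "r/2" s1] N\<sigma> s1(1) continuous_on_subset[OF cN, of "{\<sigma>..s1}"] by auto
  have "s2 = s1" using s1(2)[of s2] s1(1) s2 by force
  have N1: "N s1 = r/2" using s2 \<open>s2 = s1\<close> by simp
  have Nle: "N u \<le> r/2" if "u \<in> {\<sigma>..s1}" for u
  proof (cases "u = s1")
    case False
    then show ?thesis using s1(2)[of u] s1(1) that by force
  qed (simp add: N1)
  then have in_ball: "X u \<in> ball p r" if "u \<in> {\<sigma>..s1}" for u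
    using that r unfolding N_def by (fastforce simp: dist_norm norm_minus_commute)
  have s1t: "s1 \<in> {\<sigma>..t}" using s1(1) by simp
  show False
  proof (cases "\<exists>u\<in>{\<sigma>..s1}. X u \<in> frontier D")
    case False
    then have "X s1 - X \<sigma> = b s1 - b \<sigma>"
      using t s1t by (intro skorokhod_free_increment[OF sol]) auto
    then have e: "X s1 - p = (b s1 - b \<sigma>) + (X \<sigma> - p)" by (simp add: algebra_simps)
    have "N s1 \<le> \<rho> + \<epsilon>"
      unfolding N_def e using norm_triangle_ineq[of "b s1 - b \<sigma>" "X \<sigma> - p"] osc[OF s1t] start
      by linarith
    then show False using N1 small r by linarith
  next
    case True
    then obtain u0 where u0: "u0 \<in> {\<sigma>..s1}" "X u0 \<in> frontier D" by blast
    have cX1: "continuous_on {\<sigma>..s1} X" using s1t by (intro continuous_on_subset[OF cX]) auto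
    obtain u where u: "u \<in> {\<sigma>..s1}" "X u \<in> frontier D" "\<And>s. u < s \<Longrightarrow> s \<le> s1 \<Longrightarrow> X s \<notin> frontier D"
      by (rule last_visit[OF cX1 frontier_closed u0]) (rule that)
    \<comment> \<open>No push is added after \<open>u\<close>, so the displacement up to
      \<open>s1\<close> contains the same vector \<open>I\<close> as the one up to
      \<open>u\<close>.\<close>
    define I where "I = X u - X \<sigma> - (b u - b \<sigma>)"
    have "X s1 - X u = b s1 - b u"
      using u t by (intro skorokhod_free_increment[OF sol]) auto
    then have I1: "X s1 - p = (b s1 - b \<sigma>) + I + (X \<sigma> - p)" by (simp add: I_def algebra_simps)
    have "(1 - \<theta>) * norm I \<le> I \<bullet> n"
      unfolding I_def
    proof (rule skorokhod_push_direction[OF D sol _ _ n])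
      fix v assume "\<sigma> \<le> v" "v \<le> u" "X v \<in> frontier D"
      then show "norm (inward_normal D (X v) - n) \<le> \<theta>"
        using flat in_ball[of v] u(1) unfolding flat_at_def by auto
    qed (use t u \<theta> in auto)
    also have "I \<bullet> n = (X u - p) \<bullet> n + (- (X \<sigma> - p)) \<bullet> n + (- (b u - b \<sigma>)) \<bullet> n"
      by (simp add: I_def inner_add_left inner_diff_left)
    also have "(- (X \<sigma> - p)) \<bullet> n \<le> \<epsilon>"
      using norm_cauchy_schwarz[of "- (X \<sigma> - p)" n] n start by (simp add: norm_minus_commute)
    also have "(- (b u - b \<sigma>)) \<bullet> n \<le> \<rho>"
      using norm_cauchy_schwarz[of "- (b u - b \<sigma>)" n] n osc[of u] u(1) s1t
      by (simp add: norm_minus_commute)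
    \<comment> \<open>Flatness is used in the reverse direction: based at the boundary point
      \<open>X u\<close> and tested with \<open>p\<close>, it bounds the height of
      \<open>X u\<close> from above.\<close>
    also have "(X u - p) \<bullet> n \<le> \<theta> * N u"
    proof -
      have "p \<in> closure D \<inter> ball p r" using p r by (simp add: frontier_def)
      then have "- \<theta> * norm (p - X u) \<le> (p - X u) \<bullet> n"
        using flat u(2) in_ball[OF u(1)] unfolding flat_at_def by blast
      then show ?thesis by (simp add: N_def inner_diff_left norm_minus_commute)
    qed
    also have "\<theta> * N u \<le> \<theta> * (r/2)" using Nle[OF u(1)] \<theta> by (intro mult_left_mono)
    also have "\<theta> * (r/2) \<le> 1/4 * (r/2)" using \<theta> r by (intro mult_right_mono) auto
    finally have "(1 - \<theta>) * norm I \<le> r/8 + \<epsilon> + \<rho>" by simp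
    moreover have "3/4 * norm I \<le> (1 - \<theta>) * norm I" using \<theta> by (intro mult_right_mono) auto
    ultimately have "3/4 * norm I \<le> r/8 + \<epsilon> + \<rho>" by (rule order_trans[rotated])
    then have "norm I \<le> 4/3 * (r/8 + \<epsilon> + \<rho>)" by simp
    moreover have "N s1 \<le> \<rho> + norm I + \<epsilon>"
      unfolding N_def I1 using osc[OF s1t] start norm_triangle_ineq[of "b s1 - b \<sigma> + I" "X \<sigma> - p"]
        norm_triangle_ineq[of "b s1 - b \<sigma>" I] by linarith
    moreover have False
      if "m \<le> 4/3 * (r/8 + \<epsilon> + \<rho>)" "N s1 \<le> \<rho> + m + \<epsilon>" for m :: real
      using that N1 small by simp
    ultimately show False by blast
  qed
qed

text \<open>Flatness at the last visit \<open>u\<close> allows \<open>b u - b t\<close> a height of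
  at most \<theta> times its norm, and the cone demands at least \<kappa> >= 2 \<theta> times its
  norm. The increment is therefore 0, and \<open>X t = X u\<close> is on the boundary.\<close>

lemma cone_time_on_boundary:
  fixes D :: "'a::euclidean_space set"
  assumes D: "open D" "C2_boundary D" and sol: "skorokhod_solution D b x X L"
    and flat: "flat_at D \<theta> r p n" and p: "p \<in> frontier D" and \<theta>: "0 < \<theta>" "\<theta> \<le> 1/4" "2 * \<theta> \<le> \<kappa>"
    and t: "0 \<le> \<sigma>" "\<sigma> \<le> t" and start: "norm (X \<sigma> - p) \<le> \<epsilon>"
    and osc: "\<And>s. s \<in> {\<sigma>..t} \<Longrightarrow> norm (b s - b \<sigma>) \<le> \<rho>" and small: "\<epsilon> + \<rho> < r / 7"
    and cone: "\<And>s. s \<in> {\<sigma>..t} \<Longrightarrow> \<kappa> * norm (b s - b t) \<le> (b s - b t) \<bullet> n"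
    and drop: "4 * \<epsilon> < (b \<sigma> - b t) \<bullet> n"
  shows "X t \<in> frontier D"
proof (rule ccontr)
  assume Xt: "X t \<notin> frontier D"
  have conf: "X s \<in> ball p r" if "s \<in> {\<sigma>..t}" for s
    using skorokhod_confined[OF D sol flat p _ _ t start osc small that] \<theta> by simp
  have cl: "X s \<in> closure D" if "s \<ge> 0" for s
    using sol that unfolding skorokhod_solution_def by blast
  have n: "norm n = 1" using flat by (simp add: flat_at_def)
  have cX: "continuous_on {\<sigma>..t} X"
    using sol t unfolding skorokhod_solution_def by (auto elim: continuous_on_subset)
  have "\<rho> \<ge> 0" "\<epsilon> \<ge> 0"
    using osc[of \<sigma>] t order_trans[OF norm_ge_zero start] by auto
  then have r: "r > 0" using small by linarith
  show False
  proof (cases "\<exists>u\<in>{\<sigma>..t}. X u \<in> frontier D")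
    case True
    then obtain u0 where u0: "u0 \<in> {\<sigma>..t}" "X u0 \<in> frontier D" by blast
    obtain u where u: "u \<in> {\<sigma>..t}" "X u \<in> frontier D" "\<And>s. u < s \<Longrightarrow> s \<le> t \<Longrightarrow> X s \<notin> frontier D"
      by (rule last_visit[OF cX frontier_closed u0]) (rule that)
    have inc: "X t - X u = b t - b u"
      using u t by (intro skorokhod_free_increment[OF sol]) auto
    have "- \<theta> * norm (X t - X u) \<le> (X t - X u) \<bullet> n"
      using flat u(2) conf[OF u(1)] conf[of t] cl[of t] t unfolding flat_at_def by auto
    then have "(b u - b t) \<bullet> n \<le> \<theta> * norm (b u - b t)"
      unfolding inc by (simp add: inner_diff_left norm_minus_commute)
    then have "\<kappa> * norm (b u - b t) \<le> \<theta> * norm (b u - b t)" using cone[OF u(1)] by linarith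
    moreover have "2 * \<theta> * norm (b u - b t) \<le> \<kappa> * norm (b u - b t)"
      using \<theta> by (intro mult_right_mono) auto
    ultimately have "\<theta> * norm (b u - b t) \<le> 0" by simp
    then have "norm (b u - b t) = 0" using \<theta> by (simp add: mult_le_0_iff)
    then have "X t = X u" using inc by simp
    then show False using u(2) Xt by simp
  next
    \<comment> \<open>Without a visit flatness applies at \<open>p\<close> itself. It bounds the
      drop \<open>v \<bullet> n\<close> by
      \<open>\<epsilon> + \<theta> * \<epsilon> + \<theta> * norm v\<close>, hence by
      \<open>5/4 * \<epsilon>\<close> plus half the drop, so the drop is at most
      \<open>5/2 * \<epsilon>\<close>, against \<open>drop\<close>.\<close>
    case False
    then have inc: "X t - X \<sigma> = b t - b \<sigma>"
      using t by (intro skorokhod_free_increment[OF sol]) auto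
    define v where "v = b \<sigma> - b t"
    have "p \<in> frontier D \<inter> ball p r" using p r by simp
    then have "- \<theta> * norm (X t - p) \<le> (X t - p) \<bullet> n"
      using flat conf[of t] cl[of t] t unfolding flat_at_def by auto
    moreover have Xtp: "X t - p = (X \<sigma> - p) - v" using inc by (simp add: v_def algebra_simps)
    moreover have "norm ((X \<sigma> - p) - v) \<le> \<epsilon> + norm v"
      using start norm_triangle_ineq4[of "X \<sigma> - p" v] by linarith
    then have "\<theta> * norm ((X \<sigma> - p) - v) \<le> \<theta> * (\<epsilon> + norm v)" using \<theta> by (intro mult_left_mono) auto
    moreover have "(X \<sigma> - p) \<bullet> n \<le> \<epsilon>"
      using norm_cauchy_schwarz[of "X \<sigma> - p" n] n start by simp
    ultimately have "v \<bullet> n \<le> \<epsilon> + \<theta> * \<epsilon> + \<theta> * norm v"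
      by (simp add: inner_diff_left algebra_simps)
    moreover have "\<theta> * norm v \<le> (v \<bullet> n) / 2"
    proof -
      have "(2 * \<theta>) * norm v \<le> \<kappa> * norm v" using \<theta> by (intro mult_right_mono) auto
      also have "\<dots> \<le> v \<bullet> n" using cone[of \<sigma>] t by (simp add: v_def)
      finally show ?thesis by simp
    qed
    moreover have "\<theta> * \<epsilon> \<le> 1/4 * \<epsilon>" using \<theta> \<open>\<epsilon> \<ge> 0\<close> by (intro mult_right_mono) auto
    ultimately show False using drop unfolding v_def[symmetric] using \<open>\<epsilon> \<ge> 0\<close> by linarith
  qed
qed

text \<open>Continuity of \<open>L\<close> excludes an atom at 0, so the integral over
  \<open>{0..0}\<close> vanishes.\<close>

lemma skorokhod_start:
  assumes sol: "skorokhod_solution D b x X L" and b0: "b 0 = 0"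
  shows "X 0 = x"
proof -
  have L: "mono_on {0..} L" "continuous_on {0..} L"
    and X: "\<And>t. t \<ge> 0 \<Longrightarrow> X t = x + b t + (LINT s:{0..t}|stieltjes_measure L. inward_normal D (X s))"
    using sol unfolding skorokhod_solution_def by blast+
  have "emeasure (stieltjes_measure L) {0} \<le> emeasure (stieltjes_measure L) {- 1<..0}"
    by (rule emeasure_mono) (auto simp: stieltjes_measure_def)
  also have "\<dots> = 0" by (subst emeasure_stieltjes_Ioc[OF L]) auto
  finally have "{0} \<in> null_sets (stieltjes_measure L)"
    by (auto simp: null_sets_def stieltjes_measure_def)
  then have "AE s in stieltjes_measure L. indicat_real {0..0} s *\<^sub>R inward_normal D (X s) = 0"
    using AE_not_in by (fastforce elim: eventually_mono)
  then have "(LINT s:{0..0}|stieltjes_measure L. inward_normal D (X s)) = 0"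
    unfolding set_lebesgue_integral_def by (rule integral_eq_zero_AE)
  with X[of 0] b0 show ?thesis by simp
qed

text \<open>The hypothesis \<open>inside\<close> concerns the free path. If the reflected path
  touched the frontier before \<sigma>, then at the first such time it would still equal the free
  path, which is in the open set \<open>D\<close>. The endpoint \<sigma> itself is reached by
  continuity.\<close>

lemma skorokhod_interior:
  fixes D :: "'a::euclidean_space set"
  assumes sol: "skorokhod_solution D b x X L" and D: "open D" and b0: "b 0 = 0"
    and cb: "continuous_on {0..} b" and \<sigma>: "0 \<le> \<sigma>"
    and inside: "\<And>s. 0 \<le> s \<Longrightarrow> s < \<sigma> \<Longrightarrow> x + b s \<in> D"
  shows "X \<sigma> = x + b \<sigma>"
proof -
  have X0: "X 0 = x" by (rule skorokhod_start[OF sol b0])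
  have cX: "continuous_on {0..} X" using sol by (simp add: skorokhod_solution_def)
  have free: "X \<tau> = x + b \<tau>" if \<tau>: "0 \<le> \<tau>" "\<And>s. 0 \<le> s \<Longrightarrow> s < \<tau> \<Longrightarrow> X s \<notin> frontier D" for \<tau>
  proof (cases "\<tau> = 0")
    case False
    then have cl: "closure {0..<\<tau>} = {0..\<tau>}" using \<tau>(1) by (intro closure_atLeastLessThan) auto
    have "X \<tau> - b \<tau> = x"
    proof (rule continuous_constant_on_closure[of "{0..<\<tau>}" "\<lambda>s. X s - b s"])
      show "continuous_on (closure {0..<\<tau>}) (\<lambda>s. X s - b s)"
        unfolding cl by (intro continuous_intros continuous_on_subset[OF cX] continuous_on_subset[OF cb]) auto
      show "\<tau> \<in> closure {0..<\<tau>}" unfolding cl using \<tau> by simp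
      fix s assume "s \<in> {0..<\<tau>}"
      then have "X s - X 0 = b s - b 0"
        using \<tau>(2) by (intro skorokhod_free_increment[OF sol]) auto
      then show "X s - b s = x" using X0 b0 by (simp add: algebra_simps)
    qed
    then show ?thesis by (simp add: algebra_simps)
  qed (simp add: X0 b0)
  show ?thesis
  proof (cases "\<exists>s. 0 \<le> s \<and> s < \<sigma> \<and> X s \<in> frontier D")
    case True
    then obtain s where s: "0 \<le> s" "s < \<sigma>" "X s \<in> frontier D" by blast
    let ?S = "{0..s} \<inter> X -` frontier D"
    have "closed ?S"
      by (rule continuous_closed_preimage[OF continuous_on_subset[OF cX]]) auto
    then have "compact ?S" by (metis compact_Icc compact_Int_closed inf.left_idem)
    then obtain \<tau> where \<tau>: "\<tau> \<in> ?S" "\<And>s. s \<in> ?S \<Longrightarrow> \<tau> \<le> s"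
      using compact_attains_inf[of ?S] s by fastforce
    then have "X \<tau> = x + b \<tau>" by (intro free) force+
    moreover have "x + b \<tau> \<in> D" using inside[of \<tau>] \<tau>(1) s by auto
    ultimately show ?thesis using \<tau>(1) D by (auto simp: frontier_def interior_open)
  qed (use free \<sigma> in blast)
qed

section \<open>A walk relative to a moving cone vertex\<close>

definition tang :: "'a::real_inner \<Rightarrow> 'a \<Rightarrow> 'a" where
  "tang n z = z - (z \<bullet> n) *\<^sub>R n"

text \<open>A circular cone around \<open>n\<close> of half-angle arctan(1/\<eta>), close to a
  half-space for small \<eta>; larger \<eta> means a narrower cone.\<close>

definition wide_cone :: "'a::real_inner \<Rightarrow> real \<Rightarrow> 'a set" where
  "wide_cone n \<eta> = {v. \<eta> * norm (tang n v) \<le> v \<bullet> n}"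

text \<open>The weight \<open>3 * \<eta>^2\<close> is chosen so that, for the inner product of this
  form, the polar cone of \<open>wide_cone n (3 * \<eta>)\<close> is the reflection of
  \<open>wide_cone n \<eta>\<close> at the origin.\<close>

definition quad :: "'a::real_inner \<Rightarrow> real \<Rightarrow> 'a \<Rightarrow> real" where
  "quad n \<eta> z = (z \<bullet> n)\<^sup>2 + 3 * \<eta>\<^sup>2 * (norm (tang n z))\<^sup>2"

text \<open>
  Moves a point into the cone of opening \<open>3 \<eta>\<close> by adding a vector of the wide cone; the vertex
  itself is reached when the point lies below the reflected wide cone.
\<close>

definition cone_shift :: "'a::real_inner \<Rightarrow> real \<Rightarrow> 'a \<Rightarrow> 'a" where
  "cone_shift n \<eta> z =
    (let s = z \<bullet> n; q = \<eta> * norm (tang n z) in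
     if 3 * q \<le> s then z else if s + q \<le> 0 then 0
     else ((s + q) / 4) *\<^sub>R (3 *\<^sub>R n + (1 / q) *\<^sub>R tang n z))"

lemma tang_add: "tang n (v + w) = tang n v + tang n w"
  by (simp add: tang_def algebra_simps)

lemma tang_diff: "tang n (v - w) = tang n v - tang n w"
  by (simp add: tang_def algebra_simps)

lemma tang_scaleR: "tang n (c *\<^sub>R v) = c *\<^sub>R tang n v"
  by (simp add: tang_def algebra_simps)

lemma tang_0 [simp]: "tang n 0 = 0"
  by (simp add: tang_def)

lemma tang_inner: "norm n = 1 \<Longrightarrow> tang n z \<bullet> n = 0"
  by (simp add: tang_def inner_diff_left dot_square_norm)

lemma tang_normal: "norm n = 1 \<Longrightarrow> tang n n = 0"
  by (simp add: tang_def dot_square_norm)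

lemma tang_tang: "norm n = 1 \<Longrightarrow> tang n (tang n z) = tang n z"
  by (simp add: tang_def[of n "tang n z"] tang_inner)

lemma norm_tang_decomp:
  assumes "norm n = 1"
  shows "(norm z)\<^sup>2 = (z \<bullet> n)\<^sup>2 + (norm (tang n z))\<^sup>2"
proof -
  have "n \<bullet> n = 1" using assms by (simp add: dot_square_norm)
  then show ?thesis
    unfolding power2_norm_eq_inner tang_def
    by (simp add: inner_diff_left inner_diff_right inner_commute[of n z] power2_eq_square)
qed

lemma zero_in_wide_cone [simp]: "0 \<in> wide_cone n \<eta>"
  by (simp add: wide_cone_def)

lemma wide_cone_add:
  assumes "0 \<le> \<eta>" "v \<in> wide_cone n \<eta>" "w \<in> wide_cone n \<eta>"
  shows "v + w \<in> wide_cone n \<eta>"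
proof -
  have "\<eta> * norm (tang n (v + w)) \<le> \<eta> * (norm (tang n v) + norm (tang n w))"
    unfolding tang_add using assms(1) by (intro mult_left_mono norm_triangle_ineq)
  then show ?thesis using assms(2,3) by (simp add: wide_cone_def inner_add_left algebra_simps)
qed

lemma closed_wide_cone: "closed (wide_cone n \<eta>)"
  unfolding wide_cone_def tang_def by (intro closed_Collect_le continuous_intros)

text \<open>Turns the cone into the form with the full norm used for reflected paths, at the cost of
  a factor 2.\<close>

lemma wide_cone_lower:
  assumes n: "norm n = 1" and \<eta>: "0 < \<eta>" "\<eta> \<le> 1" and v: "v \<in> wide_cone n \<eta>"
  shows "\<eta> / 2 * norm v \<le> v \<bullet> n"
proof -
  have "v = (v \<bullet> n) *\<^sub>R n + tang n v" by (simp add: tang_def)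
  then have "norm v \<le> \<bar>v \<bullet> n\<bar> + norm (tang n v)"
    using norm_triangle_ineq[of "(v \<bullet> n) *\<^sub>R n" "tang n v"] n by simp
  then have "\<eta> * norm v \<le> \<eta> * \<bar>v \<bullet> n\<bar> + \<eta> * norm (tang n v)"
    using \<eta> by (metis distrib_left mult_left_mono less_imp_le)
  moreover have "0 \<le> v \<bullet> n" "\<eta> * norm (tang n v) \<le> v \<bullet> n"
    using v \<eta> order_trans[of 0 "\<eta> * norm (tang n v)" "v \<bullet> n"] by (auto simp: wide_cone_def)
  moreover have "\<eta> * \<bar>v \<bullet> n\<bar> \<le> 1 * \<bar>v \<bullet> n\<bar>" using \<eta> by (intro mult_right_mono) auto
  ultimately show ?thesis by simp
qed

lemma quad_nonneg: "0 \<le> quad n \<eta> z"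
  by (simp add: quad_def)

lemma quad_le_norm:
  assumes "norm n = 1" "3 * \<eta>\<^sup>2 \<le> 1"
  shows "quad n \<eta> z \<le> (norm z)\<^sup>2"
proof -
  have "3 * \<eta>\<^sup>2 * (norm (tang n z))\<^sup>2 \<le> 1 * (norm (tang n z))\<^sup>2"
    using assms by (intro mult_right_mono) auto
  then show ?thesis by (simp add: quad_def norm_tang_decomp[OF assms(1), of z])
qed

lemma norm_le_quad:
  assumes "norm n = 1" "3 * \<eta>\<^sup>2 \<le> 1"
  shows "3 * \<eta>\<^sup>2 * (norm z)\<^sup>2 \<le> quad n \<eta> z"
proof -
  have "3 * \<eta>\<^sup>2 * (z \<bullet> n)\<^sup>2 \<le> 1 * (z \<bullet> n)\<^sup>2"
    using assms by (intro mult_right_mono) auto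
  then show ?thesis by (simp add: quad_def norm_tang_decomp[OF assms(1), of z] algebra_simps)
qed

lemma quad_normal: "norm n = 1 \<Longrightarrow> quad n \<eta> (c *\<^sub>R n) = c\<^sup>2"
  by (simp add: quad_def tang_scaleR tang_normal dot_square_norm)

text \<open>For the inner product of \<open>quad\<close>, \<open>cone_shift\<close> is the
  orthogonal projection onto the narrow cone, and the three claims are Moreau's decomposition. In
  the coordinates \<open>s\<close> and \<open>q\<close> the narrow cone is \<open>3 q <= s\<close>
  and its polar \<open>s + q <= 0\<close>; points between the two move in direction (1, -1), which
  is orthogonal to the ray through (3, 1).\<close>

lemma cone_shift:
  assumes n: "norm n = 1" and \<eta>: "0 < \<eta>"
  shows cone_shift_narrow: "cone_shift n \<eta> z \<in> wide_cone n (3 * \<eta>)"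
    and cone_shift_diff: "cone_shift n \<eta> z - z \<in> wide_cone n \<eta>"
    and quad_cone_shift_le: "quad n \<eta> (cone_shift n \<eta> z) \<le> quad n \<eta> z"
proof -
  define s q where "s = z \<bullet> n" and "q = \<eta> * norm (tang n z)"
  have q0: "q \<ge> 0" using \<eta> by (simp add: q_def)
  have nn: "n \<bullet> n = 1" using n by (simp add: dot_square_norm)
  have Qz: "quad n \<eta> z = s\<^sup>2 + 3 * q\<^sup>2"
    by (simp add: quad_def s_def q_def power_mult_distrib)
  consider "3 * q \<le> s" | "\<not> 3 * q \<le> s" "s + q \<le> 0" | "3 * q > s" "s + q > 0" by linarith
  then have "cone_shift n \<eta> z \<in> wide_cone n (3 * \<eta>) \<and> cone_shift n \<eta> z - z \<in> wide_cone n \<eta> \<and>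
      quad n \<eta> (cone_shift n \<eta> z) \<le> quad n \<eta> z"
  proof cases
    case 1
    then have "cone_shift n \<eta> z = z" by (simp add: cone_shift_def s_def q_def Let_def)
    then show ?thesis using 1 by (simp add: wide_cone_def s_def q_def)
  next
    case 2
    then have e: "cone_shift n \<eta> z = 0" by (simp add: cone_shift_def s_def q_def Let_def)
    have "- z \<in> wide_cone n \<eta>"
      using 2 tang_diff[of n 0 z] by (simp add: wide_cone_def s_def q_def)
    then show ?thesis using quad_nonneg[of n \<eta> z] by (simp add: e quad_def)
  next
    case 3
    then have q: "q > 0" using q0 by linarith
    define w where "w = cone_shift n \<eta> z"
    define c where "c = (s + q) / 4"
    have c: "c > 0" using 3 by (simp add: c_def)
    have w: "w = c *\<^sub>R (3 *\<^sub>R n + (1 / q) *\<^sub>R tang n z)"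
      using 3 by (simp add: w_def cone_shift_def s_def q_def Let_def c_def)
    have wn: "w \<bullet> n = 3 * c"
      by (simp add: w inner_add_left nn tang_inner[OF n])
    have tw: "tang n w = (c / q) *\<^sub>R tang n z"
      by (simp add: w tang_scaleR tang_add tang_normal[OF n] tang_tang[OF n])
    have eq_c: "\<eta> * norm (tang n w) = c"
    proof -
      have "\<eta> * norm (tang n w) = (c / q) * q"
        unfolding tw q_def using c q q_def by simp
      then show ?thesis using q by simp
    qed
    have "w \<in> wide_cone n (3 * \<eta>)" using eq_c wn by (simp add: wide_cone_def)
    moreover have "w - z \<in> wide_cone n \<eta>"
    proof -
      have "tang n (w - z) = ((c - q) / q) *\<^sub>R tang n z"
        unfolding tang_diff tw using q by (simp add: diff_divide_distrib scaleR_diff_left)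
      then have "\<eta> * norm (tang n (w - z)) = \<bar>(c - q) / q\<bar> * q" by (simp add: q_def)
      also have "\<dots> = q - c" using q 3 by (simp add: abs_mult c_def)
      also have "\<dots> = (w - z) \<bullet> n" by (simp add: inner_diff_left wn s_def[symmetric] c_def field_simps)
      finally show ?thesis by (simp add: wide_cone_def)
    qed
    moreover have "quad n \<eta> w \<le> quad n \<eta> z"
    proof -
      have "quad n \<eta> w = (w \<bullet> n)\<^sup>2 + 3 * (\<eta> * norm (tang n w))\<^sup>2"
        by (simp add: quad_def power_mult_distrib)
      also have "\<dots> = 12 * c\<^sup>2" by (simp add: wn eq_c power_mult_distrib)
      \<comment> \<open>The difference of the two sides is \<open>(s - 3 q)^2 / 4\<close>, the
        squared length of the shift.\<close>
      also have "\<dots> \<le> s\<^sup>2 + 3 * q\<^sup>2"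
        using zero_le_power2[of "s - 3 * q"] by (simp add: c_def power2_eq_square algebra_simps)
      finally show ?thesis using Qz by simp
    qed
    ultimately show ?thesis unfolding w_def by blast
  qed
  then show "cone_shift n \<eta> z \<in> wide_cone n (3 * \<eta>)" "cone_shift n \<eta> z - z \<in> wide_cone n \<eta>"
    "quad n \<eta> (cone_shift n \<eta> z) \<le> quad n \<eta> z" by blast+
qed

lemma measurable_tang [measurable]: "tang (n::'a::euclidean_space) \<in> borel_measurable borel"
  unfolding tang_def by measurable

lemma measurable_quad [measurable]: "quad (n::'a::euclidean_space) \<eta> \<in> borel_measurable borel"
  unfolding quad_def by measurable

lemma measurable_cone_shift [measurable]:
  "cone_shift (n::'a::euclidean_space) \<eta> \<in> borel_measurable borel"
  unfolding cone_shift_def Let_def by measurable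

text \<open>
  \<open>S\<^sub>k = x\<^sub>0 + \<dots> + x\<^sub>k\<^sub>-\<^sub>1\<close> is a path in discrete time.  Once it has met \<open>F\<close>, the walk records
  \<open>S\<^sub>k\<close> relative to a moving vertex such that the path since then lies in the wide cone at the vertex.
\<close>

locale cone_walk =
  fixes n :: "'a::euclidean_space" and \<eta> lo y0 :: real and F :: "'a set"
  assumes norm_n: "norm n = 1" and \<eta>_pos: "0 < \<eta>" and \<eta>_small: "48 * \<eta>\<^sup>2 * DIM('a) \<le> 1"
    and closed_F: "closed F" and lo_pos: "0 < lo" and y0_pos: "0 < y0"
begin

text \<open>Waiting for \<open>F\<close> is part of the dynamics, so the walk has a deterministic
  start and depends at time \<open>k\<close> on the first \<open>k\<close> steps only; this takes
  the place of the strong Markov property. Below \<open>lo\<close> a single step is no longer small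
  compared with the distance to the vertex, and the walk has succeeded; above 1 it is given
  up.\<close>

definition active :: "nat \<Rightarrow> (nat \<Rightarrow> 'a) \<Rightarrow> 'a \<Rightarrow> bool" where
  "active k x z \<longleftrightarrow> (\<exists>j\<le>k. (\<Sum>i<j. x i) \<in> F) \<and> lo < quad n \<eta> z \<and> quad n \<eta> z \<le> 1"

primrec walk :: "nat \<Rightarrow> (nat \<Rightarrow> 'a) \<Rightarrow> 'a" where
  "walk 0 x = y0 *\<^sub>R n"
| "walk (Suc k) x = (if active k x (walk k x) then cone_shift n \<eta> (walk k x + x k) else walk k x)"

text \<open>Active steps are counted at a fixed horizon. The event then does not mention the random
  time at which \<open>F\<close> is met, and its complement is controlled by the summed
  drift.\<close>

definition calm :: "nat \<Rightarrow> nat \<Rightarrow> (nat \<Rightarrow> 'a) \<Rightarrow> bool" where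
  "calm N m x \<longleftrightarrow> quad n \<eta> (walk N x) \<le> 1 \<and> card {k. k < N \<and> active k x (walk k x)} < m"

lemma \<eta>_le: "\<eta> \<le> 1" "3 * \<eta>\<^sup>2 \<le> 1"
proof -
  have "\<eta>\<^sup>2 * 1 \<le> \<eta>\<^sup>2 * DIM('a)" using DIM_positive[where 'a='a] by (intro mult_left_mono) auto
  then have "48 * \<eta>\<^sup>2 \<le> 1" using \<eta>_small by linarith
  then show "3 * \<eta>\<^sup>2 \<le> 1" "\<eta> \<le> 1" using power2_le_imp_le[of \<eta> 1] by auto
qed

lemma walk_narrow: "walk k x \<in> wide_cone n (3 * \<eta>)"
proof (induction k)
  case 0
  then show ?case using y0_pos norm_n
    by (simp add: wide_cone_def tang_scaleR tang_normal dot_square_norm)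
next
  case (Suc k)
  then show ?case using cone_shift_narrow[OF norm_n \<eta>_pos] by simp
qed

lemma walk_cong: "(\<And>i. i < k \<Longrightarrow> x i = x' i) \<Longrightarrow> walk k x = walk k x'"
proof (induction k)
  case (Suc k)
  have "(\<Sum>i<j. x i) = (\<Sum>i<j. x' i)" if "j \<le> k" for j
    using Suc.prems that by (intro sum.cong) auto
  then have "active k x z = active k x' z" for z unfolding active_def by auto
  then show ?case using Suc by simp
qed simp

lemma active_cong: "(\<And>i. i < k \<Longrightarrow> x i = x' i) \<Longrightarrow> active k x (walk k x) = active k x' (walk k x')"
proof -
  assume a: "\<And>i. i < k \<Longrightarrow> x i = x' i"
  have "(\<Sum>i<j. x i) = (\<Sum>i<j. x' i)" if "j \<le> k" for j
    using a that by (intro sum.cong) auto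
  then show ?thesis using walk_cong[OF a] unfolding active_def by auto
qed

lemma active_le:
  "active k x (walk k x) \<Longrightarrow> lo < quad n \<eta> (walk k x) \<and> quad n \<eta> (walk k x) \<le> 1"
  by (simp add: active_def)

lemma walk_waiting: "(\<And>j. j < k \<Longrightarrow> (\<Sum>i<j. x i) \<notin> F) \<Longrightarrow> walk k x = y0 *\<^sub>R n"
  by (induction k) (auto simp: active_def)

text \<open>An inactive walk does not move, and once \<open>F\<close> has been met only the position
  decides about activity; so it never becomes active again.\<close>

lemma walk_frozen:
  assumes "\<not> active k x (walk k x)" "\<exists>j\<le>k. (\<Sum>i<j. x i) \<in> F" "k \<le> m"
  shows "walk m x = walk k x"
  using \<open>k \<le> m\<close>
proof (induction m rule: dec_induct)
  case (step m)
  then have "\<not> active m x (walk m x)" using assms(1,2) by (auto simp: active_def)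
  then show ?case using step.IH by simp
qed simp

text \<open>The walk is active from \<open>a\<close> on until it freezes at \<open>k\<close>, and
  the count leaves room for fewer than \<open>m\<close> such steps. The last claim measures the
  descent: at time \<open>a\<close> the path is at \<open>y0 *\<^sub>R n\<close> over the vertex,
  and afterwards the vertex moves only by vectors of minus the wide cone.\<close>

lemma walk_success:
  assumes hit: "a \<le> N1" "(\<Sum>i<a. x i) \<in> F" and wait: "\<And>j. j < a \<Longrightarrow> (\<Sum>i<j. x i) \<notin> F"
    and calm: "calm (N1 + m) m x"
  obtains k z where "a \<le> k" "k < a + m" "quad n \<eta> z \<le> lo"
    "\<And>j. j \<in> {a..k} \<Longrightarrow> (\<Sum>i<j. x i) - (\<Sum>i<k. x i) + z \<in> wide_cone n \<eta>"
    "(\<Sum>i<a. x i) - (\<Sum>i<k. x i) + z - y0 *\<^sub>R n \<in> wide_cone n \<eta>"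
proof -
  let ?act = "\<lambda>k. active k x (walk k x)"
  let ?S = "\<lambda>k. \<Sum>i<k. x i"
  have few: "card {k. k < N1 + m \<and> ?act k} < m" and low: "quad n \<eta> (walk (N1 + m) x) \<le> 1"
    using calm by (simp_all add: calm_def)
  have "\<exists>k\<in>{a..<a+m}. \<not> ?act k"
  proof (rule ccontr)
    assume "\<not> ?thesis"
    then have "{a..<a+m} \<subseteq> {k. k < N1 + m \<and> ?act k}" using hit by auto
    then have "card {a..<a+m} \<le> card {k. k < N1 + m \<and> ?act k}" by (intro card_mono) auto
    then show False using few by simp
  qed
  then have ex: "\<exists>k. a \<le> k \<and> \<not> ?act k" and ex': "\<exists>k\<ge>a. k < a + m \<and> \<not> ?act k" by auto
  define k where "k = (LEAST k. a \<le> k \<and> \<not> ?act k)"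
  have k: "a \<le> k" "\<not> ?act k" using LeastI_ex[OF ex] unfolding k_def by auto
  have km: "k < a + m"
    using ex' Least_le[of "\<lambda>k. a \<le> k \<and> \<not> ?act k"] unfolding k_def by (meson order_le_less_trans)
  have act: "?act j" if "a \<le> j" "j < k" for j
    using not_less_Least[of j "\<lambda>k. a \<le> k \<and> \<not> ?act k"] that unfolding k_def by auto
  have met: "\<exists>j\<le>k. ?S j \<in> F" using hit(2) k(1) by blast
  define z where "z = walk k x"
  have "walk (N1 + m) x = z"
    unfolding z_def using km hit(1) by (intro walk_frozen[OF k(2) met]) auto
  then have "quad n \<eta> z \<le> 1" using low by simp
  \<comment> \<open>\<open>F\<close> has been met and the form is at most 1, so the only remaining
    reason for inactivity is that the form is at most \<open>lo\<close>.\<close>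
  then have qz: "quad n \<eta> z \<le> lo" using k(2) met unfolding active_def z_def by auto
  \<comment> \<open>\<open>V j\<close> is the vertex at time \<open>j\<close>.\<close>
  define V where "V = (\<lambda>j. ?S j - walk j x)"
  have "j \<le> i \<Longrightarrow> a \<le> j \<Longrightarrow> i \<le> k \<Longrightarrow> V j - V i \<in> wide_cone n \<eta>" for i j
  proof (induction i rule: dec_induct)
    case (step i)
    have "V i - V (Suc i) = cone_shift n \<eta> (walk i x + x i) - (walk i x + x i)"
      using act[of i] step by (simp add: V_def)
    then have "V i - V (Suc i) \<in> wide_cone n \<eta>" using cone_shift_diff[OF norm_n \<eta>_pos] by simp
    from wide_cone_add[OF _ step.IH this] show ?case using step \<eta>_pos by simp
  qed simp
  note mono = this
  have sub: "wide_cone n (3 * \<eta>) \<subseteq> wide_cone n \<eta>"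
  proof
    fix v assume v: "v \<in> wide_cone n (3 * \<eta>)"
    have "\<eta> * norm (tang n v) \<le> 3 * (\<eta> * norm (tang n v))" using \<eta>_pos by simp
    then show "v \<in> wide_cone n \<eta>" using v unfolding wide_cone_def by (simp add: mult.assoc)
  qed
  show ?thesis
  proof (rule that[OF k(1) km qz])
    fix j assume j: "j \<in> {a..k}"
    have "walk j x + (V j - V k) \<in> wide_cone n \<eta>"
      using sub walk_narrow mono[of j k] j \<eta>_pos by (intro wide_cone_add) auto
    then show "?S j - ?S k + z \<in> wide_cone n \<eta>" by (simp add: V_def z_def algebra_simps)
  next
    have "V a - V k \<in> wide_cone n \<eta>" using mono[of a k] k by simp
    moreover have "walk a x = y0 *\<^sub>R n" using wait by (rule walk_waiting)
    ultimately show "?S a - ?S k + z - y0 *\<^sub>R n \<in> wide_cone n \<eta>"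
      by (simp add: V_def z_def algebra_simps)
  qed
qed

lemma measurable_walk:
  assumes "{..<k} \<subseteq> I"
  shows "walk k \<in> borel_measurable (Pi\<^sub>M I (\<lambda>_. borel))"
    and "Measurable.pred (Pi\<^sub>M I (\<lambda>_. borel)) (\<lambda>x. active k x (walk k x))"
proof -
  have F: "F \<in> sets borel" using closed_F by simp
  have comp: "(\<lambda>x. x i) \<in> borel_measurable (Pi\<^sub>M I (\<lambda>_. borel :: 'a measure))" if "i \<in> I" for i
    using that by (rule measurable_component_singleton)
  have S: "(\<lambda>x. \<Sum>i<j. x i) \<in> borel_measurable (Pi\<^sub>M I (\<lambda>_. borel :: 'a measure))" if "{..<j} \<subseteq> I" for j
    using that by (intro borel_measurable_sum comp) auto
  have act: "Measurable.pred (Pi\<^sub>M I (\<lambda>_. borel)) (\<lambda>x. active k x (walk k x))"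
    if "{..<k} \<subseteq> I" "walk k \<in> borel_measurable (Pi\<^sub>M I (\<lambda>_. borel))" for k
  proof -
    have [measurable]: "walk k \<in> borel_measurable (Pi\<^sub>M I (\<lambda>_. borel))" by (rule that)
    have "Measurable.pred (Pi\<^sub>M I (\<lambda>_. borel)) (\<lambda>x. (\<Sum>i<j. x i) \<in> F)" if "j \<le> k" for j
      using that \<open>{..<k} \<subseteq> I\<close> by (intro pred_sets2[OF F] S) auto
    then have "Measurable.pred (Pi\<^sub>M I (\<lambda>_. borel)) (\<lambda>x. \<exists>j\<in>{..k}. (\<Sum>i<j. x i) \<in> F)"
      by (intro pred_intros_finite) auto
    moreover have "Measurable.pred (Pi\<^sub>M I (\<lambda>_. borel))
        (\<lambda>x. lo < quad n \<eta> (walk k x) \<and> quad n \<eta> (walk k x) \<le> 1)"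
      by measurable
    ultimately have "Measurable.pred (Pi\<^sub>M I (\<lambda>_. borel)) (\<lambda>x. (\<exists>j\<in>{..k}. (\<Sum>i<j. x i) \<in> F) \<and>
        lo < quad n \<eta> (walk k x) \<and> quad n \<eta> (walk k x) \<le> 1)"
      by (rule pred_intros_logic)
    then show ?thesis unfolding active_def Bex_def atMost_iff .
  qed
  show w: "walk k \<in> borel_measurable (Pi\<^sub>M I (\<lambda>_. borel))"
    using assms
  proof (induction k)
    case (Suc k)
    have k: "{..<k} \<subseteq> I" "k \<in> I" using Suc.prems by auto
    have [measurable]: "walk k \<in> borel_measurable (Pi\<^sub>M I (\<lambda>_. borel))" by (rule Suc.IH[OF k(1)])
    have [measurable]: "Measurable.pred (Pi\<^sub>M I (\<lambda>_. borel)) (\<lambda>x. active k x (walk k x))"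
      using k(1) Suc.IH by (intro act) auto
    have [measurable]: "(\<lambda>x. x k) \<in> borel_measurable (Pi\<^sub>M I (\<lambda>_. borel :: 'a measure))"
      by (rule comp[OF k(2)])
    have "walk (Suc k) = (\<lambda>x. if active k x (walk k x) then cone_shift n \<eta> (walk k x + x k) else walk k x)"
      by (simp add: fun_eq_iff)
    then show ?case by simp
  next
    case 0
    have "walk 0 = (\<lambda>x. y0 *\<^sub>R n)" by (simp add: fun_eq_iff)
    then show ?case by simp
  qed
  show "Measurable.pred (Pi\<^sub>M I (\<lambda>_. borel)) (\<lambda>x. active k x (walk k x))"
    by (rule act[OF assms w])
qed

end

section \<open>Gaussian steps\<close>

text \<open>The right-hand side is the third order Taylor polynomial of the fourth root at \<open>1\<close>.\<close>

lemma fourth_root_taylor: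
  fixes t :: real
  assumes "t \<ge> 0"
  defines "x \<equiv> t ^ 4 - 1"
  shows "t \<le> 1 + x / 4 - 3 / 32 * x\<^sup>2 + 7 / 128 * x ^ 3"
proof -
  have "128 * (1 + x / 4 - 3 / 32 * x\<^sup>2 + 7 / 128 * x ^ 3 - t) =
      128 + 32 * x - 12 * x\<^sup>2 + 7 * x ^ 3 - 128 * t"
    by (simp add: algebra_simps)
  also have "\<dots> = (t - 1) ^ 4 *
      (7 * t ^ 8 + 28 * t ^ 7 + 70 * t ^ 6 + 140 * t ^ 5 + 212 * t ^ 4 + 260 * t ^ 3
        + 258 * t ^ 2 + 180 * t + 77)"
    unfolding x_def by algebra
  finally have "128 * (1 + x / 4 - 3 / 32 * x\<^sup>2 + 7 / 128 * x ^ 3 - t) = (t - 1) ^ 4 *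
      (7 * t ^ 8 + 28 * t ^ 7 + 70 * t ^ 6 + 140 * t ^ 5 + 212 * t ^ 4 + 260 * t ^ 3
        + 258 * t ^ 2 + 180 * t + 77)" .
  moreover have "0 \<le> (t - 1) ^ 4 * (7 * t ^ 8 + 28 * t ^ 7 + 70 * t ^ 6 + 140 * t ^ 5 + 212 * t ^ 4
      + 260 * t ^ 3 + 258 * t ^ 2 + 180 * t + 77)"
    using assms(1) by (intro mult_nonneg_nonneg add_nonneg_nonneg) auto
  ultimately show ?thesis by simp
qed

text \<open>Here \<open>a\<close> and \<open>e\<close> are the linear and the quadratic part of a
  relative change, and \<open>g\<close> is the relative size of the step. Odd powers of
  \<open>g\<close> are traded for even ones, whose Gaussian moments are explicit: g^3 by Young's
  inequality with parameter \<epsilon>, g^5 with parameter 1. The term in \<open>a^2\<close> is kept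
  exactly, because it provides the negative drift.\<close>

lemma taylor_remainder_bound:
  fixes a e g \<epsilon> :: real
  assumes a: "\<bar>a\<bar> \<le> 2 * g" and e: "0 \<le> e" "e \<le> g\<^sup>2" and \<epsilon>: "\<epsilon> > 0"
  shows "1 + (a + e) / 4 - 3 / 32 * (a + e)\<^sup>2 + 7 / 128 * (a + e) ^ 3
    \<le> 1 + a / 4 + e / 4 - 3 / 32 * a\<^sup>2 + \<epsilon> / 2 * g\<^sup>2 + (1 / (2 * \<epsilon>) + 1) * g ^ 4 + g ^ 6"
proof -
  have g: "g \<ge> 0" using a by linarith
  have ae: "- (a * e) \<le> 2 * g ^ 3"
  proof -
    have "- (a * e) \<le> \<bar>a\<bar> * e" using e abs_ge_minus_self[of "a * e"] by (simp add: abs_mult)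
    also have "\<dots> \<le> (2 * g) * g\<^sup>2" using a e g by (intro mult_mono) auto
    finally show ?thesis by (simp add: power2_eq_square power3_eq_cube)
  qed
  have cube: "(a + e) ^ 3 \<le> 8 * g ^ 3 + 12 * g ^ 4 + 6 * g ^ 5 + g ^ 6"
  proof -
    have "(a + e) ^ 3 \<le> \<bar>a + e\<bar> ^ 3" by (metis abs_ge_self power_abs)
    also have "\<dots> \<le> (2 * g + g\<^sup>2) ^ 3" using a e by (intro power_mono) auto
    also have "\<dots> = 8 * g ^ 3 + 12 * g ^ 4 + 6 * g ^ 5 + g ^ 6" by algebra
    finally show ?thesis .
  qed
  have "0 \<le> g ^ 4 * (1 - g)\<^sup>2" by simp
  also have "g ^ 4 * (1 - g)\<^sup>2 = g ^ 4 - 2 * g ^ 5 + g ^ 6" by algebra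
  finally have g5: "2 * g ^ 5 \<le> g ^ 4 + g ^ 6" by simp
  have "0 \<le> g\<^sup>2 * (\<epsilon> - g)\<^sup>2" by simp
  also have "g\<^sup>2 * (\<epsilon> - g)\<^sup>2 = \<epsilon>\<^sup>2 * g\<^sup>2 - 2 * \<epsilon> * g ^ 3 + g ^ 4" by algebra
  finally have "2 * \<epsilon> * g ^ 3 \<le> \<epsilon>\<^sup>2 * g\<^sup>2 + g ^ 4" by simp
  then have "2 * \<epsilon> * g ^ 3 / (2 * \<epsilon>) \<le> (\<epsilon>\<^sup>2 * g\<^sup>2 + g ^ 4) / (2 * \<epsilon>)"
    using \<epsilon> by (intro divide_right_mono) auto
  then have g3: "g ^ 3 \<le> \<epsilon> / 2 * g\<^sup>2 + 1 / (2 * \<epsilon>) * g ^ 4"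
    using \<epsilon> by (simp add: add_divide_distrib power2_eq_square)
  have pos: "0 \<le> g ^ 3" "0 \<le> g ^ 4" "0 \<le> g ^ 6" "0 \<le> e\<^sup>2" using g by auto
  have "1 + (a + e) / 4 - 3 / 32 * (a + e)\<^sup>2 + 7 / 128 * (a + e) ^ 3
      = 1 + a / 4 + e / 4 - 3 / 32 * a\<^sup>2 - 3 / 32 * e\<^sup>2 + 6 / 32 * (- (a * e)) + 7 / 128 * (a + e) ^ 3"
    by (simp add: power2_sum field_simps)
  also have "\<dots> \<le> 1 + a / 4 + e / 4 - 3 / 32 * a\<^sup>2 - 3 / 32 * 0 + 6 / 32 * (2 * g ^ 3)
      + 7 / 128 * (8 * g ^ 3 + 12 * g ^ 4 + 6 * g ^ 5 + g ^ 6)"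
    using pos(4) by (intro add_mono diff_mono mult_left_mono ae cube order_refl) auto
  also have "\<dots> = 1 + a / 4 + e / 4 - 3 / 32 * a\<^sup>2 + 13 / 16 * g ^ 3 + 21 / 32 * g ^ 4
      + 21 / 128 * (2 * g ^ 5) + 7 / 128 * g ^ 6"
    by (simp add: field_simps)
  also have "\<dots> \<le> 1 + a / 4 + e / 4 - 3 / 32 * a\<^sup>2 + g ^ 3 + g ^ 4 + g ^ 6"
    using g5 pos by linarith
  also have "\<dots> \<le> 1 + a / 4 + e / 4 - 3 / 32 * a\<^sup>2 + \<epsilon> / 2 * g\<^sup>2 + (1 / (2 * \<epsilon>) + 1) * g ^ 4 + g ^ 6"
    using g3 by (simp add: algebra_simps)
  finally show ?thesis .
qed

lemma power_sum_le:
  fixes a :: "'b \<Rightarrow> real"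
  assumes "finite I" "I \<noteq> {}" "\<And>i. i \<in> I \<Longrightarrow> 0 \<le> a i"
  shows "(\<Sum>i\<in>I. a i) ^ k \<le> real (card I) ^ k * (\<Sum>i\<in>I. a i ^ k)"
proof -
  define m where "m = Max (a ` I)"
  have m: "m \<in> a ` I" "\<And>i. i \<in> I \<Longrightarrow> a i \<le> m"
    using assms(1,2) unfolding m_def by auto
  then obtain j where j: "j \<in> I" "m = a j" by blast
  have "(\<Sum>i\<in>I. a i) \<le> real (card I) * m"
    using sum_bounded_above[of I a m] m(2) by simp
  then have "(\<Sum>i\<in>I. a i) ^ k \<le> (real (card I) * m) ^ k"
    using assms(3) by (intro power_mono sum_nonneg) auto
  also have "\<dots> = real (card I) ^ k * a j ^ k" by (simp add: power_mult_distrib j)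
  also have "\<dots> \<le> real (card I) ^ k * (\<Sum>i\<in>I. a i ^ k)"
    using assms j(1) by (intro mult_left_mono member_le_sum) auto
  finally show ?thesis .
qed

definition (in prob_space) gaussian_step :: "real \<Rightarrow> ('a \<Rightarrow> 'b::euclidean_space) \<Rightarrow> bool" where
  "gaussian_step h \<xi> \<longleftrightarrow> h > 0 \<and> \<xi> \<in> borel_measurable M \<and>
     indep_vars (\<lambda>_. borel) (\<lambda>i \<omega>. \<xi> \<omega> \<bullet> i) Basis \<and>
     (\<forall>i\<in>Basis. distributed M lborel (\<lambda>\<omega>. \<xi> \<omega> \<bullet> i) (normal_density 0 (sqrt h)))"

context prob_space
begin

lemma gaussian_coordinate_moments:
  assumes \<xi>: "gaussian_step h \<xi>" and i: "i \<in> Basis"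
  shows "integrable M (\<lambda>\<omega>. (\<xi> \<omega> \<bullet> i) ^ k)"
    and "expectation (\<lambda>\<omega>. \<xi> \<omega> \<bullet> i) = 0"
    and "expectation (\<lambda>\<omega>. (\<xi> \<omega> \<bullet> i) ^ 2) = h"
    and "expectation (\<lambda>\<omega>. (\<xi> \<omega> \<bullet> i) ^ 4) = 3 * h ^ 2"
    and "expectation (\<lambda>\<omega>. (\<xi> \<omega> \<bullet> i) ^ 6) = 15 * h ^ 3"
proof -
  have h: "h > 0" "sqrt h > 0" using \<xi> by (auto simp: gaussian_step_def)
  have d: "distributed M lborel (\<lambda>\<omega>. \<xi> \<omega> \<bullet> i) (normal_density 0 (sqrt h))"
    using \<xi> i by (auto simp: gaussian_step_def)
  have E: "expectation (\<lambda>\<omega>. (\<xi> \<omega> \<bullet> i) ^ k) = (\<integral>x. normal_density 0 (sqrt h) x * x ^ k \<partial>lborel)" for k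
    using distributed_integral[OF d, of "\<lambda>x. x ^ k"] by simp
  show "integrable M (\<lambda>\<omega>. (\<xi> \<omega> \<bullet> i) ^ k)"
    using distributed_integrable[OF d, of "\<lambda>x. x ^ k"] integrable_normal_moment[OF h(2), of 0 k] by simp
  have even: "expectation (\<lambda>\<omega>. (\<xi> \<omega> \<bullet> i) ^ (2 * k)) = fact (2 * k) / ((2 / h) ^ k * fact k)" for k
    using integral_normal_moment_even[OF h(2), of 0 k] h(1) unfolding E by simp
  show "expectation (\<lambda>\<omega>. \<xi> \<omega> \<bullet> i) = 0"
    using integral_normal_moment_odd[OF h(2), of 0 0] E[of 1] by simp
  show "expectation (\<lambda>\<omega>. (\<xi> \<omega> \<bullet> i) ^ 2) = h"
    using even[of 1] by (simp add: fact_numeral)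
  show "expectation (\<lambda>\<omega>. (\<xi> \<omega> \<bullet> i) ^ 4) = 3 * h ^ 2"
    using even[of 2] by (simp add: fact_numeral power2_eq_square)
  show "expectation (\<lambda>\<omega>. (\<xi> \<omega> \<bullet> i) ^ 6) = 15 * h ^ 3"
    using even[of 3] by (simp add: fact_numeral power3_eq_cube)
qed

text \<open>Mixed products of coordinates have mean 0 by independence, so the variance in direction
  \<open>w\<close> depends on the length of \<open>w\<close> only.\<close>

lemma gaussian_inner_moments:
  assumes \<xi>: "gaussian_step h \<xi>"
  shows "integrable M (\<lambda>\<omega>. \<xi> \<omega> \<bullet> w)" and "expectation (\<lambda>\<omega>. \<xi> \<omega> \<bullet> w) = 0"
    and "integrable M (\<lambda>\<omega>. (\<xi> \<omega> \<bullet> w)\<^sup>2)" and "expectation (\<lambda>\<omega>. (\<xi> \<omega> \<bullet> w)\<^sup>2) = h * (norm w)\<^sup>2"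
proof -
  note mom = gaussian_coordinate_moments[OF \<xi>]
  have i1: "integrable M (\<lambda>\<omega>. \<xi> \<omega> \<bullet> i)" if "i \<in> Basis" for i using mom(1)[OF that, of 1] by simp
  have inn: "\<xi> \<omega> \<bullet> w = (\<Sum>i\<in>Basis. (w \<bullet> i) * (\<xi> \<omega> \<bullet> i))" for \<omega>
    by (subst euclidean_inner) (simp add: mult.commute)
  show "integrable M (\<lambda>\<omega>. \<xi> \<omega> \<bullet> w)"
    unfolding inn using i1 by (intro Bochner_Integration.integrable_sum integrable_mult_right) auto
  show "expectation (\<lambda>\<omega>. \<xi> \<omega> \<bullet> w) = 0"
    unfolding inn using i1 mom(2) by (subst Bochner_Integration.integral_sum) auto
  have ind: "indep_vars (\<lambda>_. borel) (\<lambda>i \<omega>. \<xi> \<omega> \<bullet> i) Basis"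
    using \<xi> by (auto simp: gaussian_step_def)
  have prod: "integrable M (\<lambda>\<omega>. (\<xi> \<omega> \<bullet> i) * (\<xi> \<omega> \<bullet> j)) \<and>
      expectation (\<lambda>\<omega>. (\<xi> \<omega> \<bullet> i) * (\<xi> \<omega> \<bullet> j)) = (if i = j then h else 0)"
    if ij: "i \<in> Basis" "j \<in> Basis" for i j
  proof (cases "i = j")
    case True
    then show ?thesis using mom(1)[OF ij(1), of 2] mom(3)[OF ij(1)] by (simp add: power2_eq_square)
  next
    case False
    have sub: "indep_vars (\<lambda>_. borel) (\<lambda>i \<omega>. \<xi> \<omega> \<bullet> i) {i, j}"
      by (rule indep_vars_subset[OF ind]) (use ij in auto)
    have int: "integrable M (\<lambda>\<omega>. \<xi> \<omega> \<bullet> l)" if "l \<in> {i, j}" for l using i1 ij that by auto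
    show ?thesis
      using indep_vars_lebesgue_integral[OF _ sub int] indep_vars_integrable[OF _ sub int] ij mom(2) False
      by simp
  qed
  have sq: "(\<xi> \<omega> \<bullet> w)\<^sup>2 = (\<Sum>i\<in>Basis. \<Sum>j\<in>Basis. (w \<bullet> i) * (w \<bullet> j) * ((\<xi> \<omega> \<bullet> i) * (\<xi> \<omega> \<bullet> j)))" for \<omega>
    unfolding inn power2_eq_square sum_product by (simp add: mult.assoc mult.left_commute)
  show "integrable M (\<lambda>\<omega>. (\<xi> \<omega> \<bullet> w)\<^sup>2)"
    unfolding sq using prod by (intro Bochner_Integration.integrable_sum integrable_mult_right) auto
  let ?f = "\<lambda>i j \<omega>. (w \<bullet> i) * (w \<bullet> j) * ((\<xi> \<omega> \<bullet> i) * (\<xi> \<omega> \<bullet> j))"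
  have int: "integrable M (?f i j)" if "i \<in> Basis" "j \<in> Basis" for i j
    using prod[OF that] by (intro integrable_mult_right) auto
  have "expectation (\<lambda>\<omega>. (\<xi> \<omega> \<bullet> w)\<^sup>2) = (\<Sum>i\<in>Basis. expectation (\<lambda>\<omega>. \<Sum>j\<in>Basis. ?f i j \<omega>))"
    unfolding sq using int
    by (intro Bochner_Integration.integral_sum Bochner_Integration.integrable_sum) auto
  also have "\<dots> = (\<Sum>i\<in>Basis. \<Sum>j\<in>Basis. expectation (?f i j))"
    using int by (intro sum.cong refl Bochner_Integration.integral_sum) auto
  also have "\<dots> = (\<Sum>i\<in>Basis. \<Sum>j\<in>Basis. if i = j then h * ((w \<bullet> i) * (w \<bullet> j)) else 0)"
    using prod by (intro sum.cong refl) simp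
  also have "\<dots> = h * (norm w)\<^sup>2"
  proof -
    have "(\<Sum>i\<in>Basis. \<Sum>j\<in>Basis. if i = j then h * ((w \<bullet> i) * (w \<bullet> j)) else 0) =
        (\<Sum>i\<in>Basis. h * ((w \<bullet> i) * (w \<bullet> i)))"
      by (intro sum.cong refl) (simp add: sum.delta')
    then show ?thesis
      by (simp add: power2_norm_eq_inner euclidean_inner[of w w] sum_distrib_left)
  qed
  finally show "expectation (\<lambda>\<omega>. (\<xi> \<omega> \<bullet> w)\<^sup>2) = h * (norm w)\<^sup>2" .
qed

lemma gaussian_norm_moments:
  fixes \<xi> :: "'a \<Rightarrow> 'b::euclidean_space"
  assumes \<xi>: "gaussian_step h \<xi>"
  shows "integrable M (\<lambda>\<omega>. norm (\<xi> \<omega>) ^ 2)" "integrable M (\<lambda>\<omega>. norm (\<xi> \<omega>) ^ 4)"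
    "integrable M (\<lambda>\<omega>. norm (\<xi> \<omega>) ^ 6)"
    and "expectation (\<lambda>\<omega>. norm (\<xi> \<omega>) ^ 2) = real DIM('b) * h"
    and "expectation (\<lambda>\<omega>. norm (\<xi> \<omega>) ^ 4) \<le> 3 * real DIM('b) ^ 3 * h ^ 2"
    and "expectation (\<lambda>\<omega>. norm (\<xi> \<omega>) ^ 6) \<le> 15 * real DIM('b) ^ 4 * h ^ 3"
proof -
  note mom = gaussian_coordinate_moments[OF \<xi>]
  have [measurable]: "\<xi> \<in> borel_measurable M" using \<xi> by (simp add: gaussian_step_def)
  have n2: "norm v ^ 2 = (\<Sum>i\<in>Basis. (v \<bullet> i) ^ 2)" for v :: 'b
    unfolding power2_norm_eq_inner by (subst euclidean_inner) (simp add: power2_eq_square)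
  show "integrable M (\<lambda>\<omega>. norm (\<xi> \<omega>) ^ 2)"
    unfolding n2 using mom(1) by (intro Bochner_Integration.integrable_sum) auto
  show "expectation (\<lambda>\<omega>. norm (\<xi> \<omega>) ^ 2) = real DIM('b) * h"
    unfolding n2 using mom(1,3) by (subst Bochner_Integration.integral_sum) auto
  have bound: "norm v ^ (2 * k) \<le> real DIM('b) ^ k * (\<Sum>i\<in>Basis. (v \<bullet> i) ^ (2 * k))" for v :: 'b and k
    using power_sum_le[of Basis "\<lambda>i. (v \<bullet> i) ^ 2" k] by (simp add: power_mult n2)
  have int: "integrable M (\<lambda>\<omega>. real DIM('b) ^ k * (\<Sum>i\<in>Basis. (\<xi> \<omega> \<bullet> i) ^ (2 * k)))" for k
    using mom(1) by (intro integrable_mult_right Bochner_Integration.integrable_sum) auto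
  have int': "integrable M (\<lambda>\<omega>. norm (\<xi> \<omega>) ^ (2 * k))" for k
    by (rule Bochner_Integration.integrable_bound[OF int[of k]])
      (use bound in \<open>auto intro!: AE_I2 order_trans[OF bound] mult_nonneg_nonneg sum_nonneg\<close>)
  show "integrable M (\<lambda>\<omega>. norm (\<xi> \<omega>) ^ 4)" "integrable M (\<lambda>\<omega>. norm (\<xi> \<omega>) ^ 6)"
    using int'[of 2] int'[of 3] by simp_all
  have E: "expectation (\<lambda>\<omega>. norm (\<xi> \<omega>) ^ (2 * k)) \<le>
      real DIM('b) ^ k * (\<Sum>i\<in>Basis. expectation (\<lambda>\<omega>. (\<xi> \<omega> \<bullet> i) ^ (2 * k)))" for k
  proof -
    have "expectation (\<lambda>\<omega>. norm (\<xi> \<omega>) ^ (2 * k)) \<le>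
        expectation (\<lambda>\<omega>. real DIM('b) ^ k * (\<Sum>i\<in>Basis. (\<xi> \<omega> \<bullet> i) ^ (2 * k)))"
      by (intro integral_mono int' int bound)
    also have "\<dots> = real DIM('b) ^ k * (\<Sum>i\<in>Basis. expectation (\<lambda>\<omega>. (\<xi> \<omega> \<bullet> i) ^ (2 * k)))"
      using mom(1) by (simp add: Bochner_Integration.integral_sum)
    finally show ?thesis .
  qed
  show "expectation (\<lambda>\<omega>. norm (\<xi> \<omega>) ^ 4) \<le> 3 * real DIM('b) ^ 3 * h ^ 2"
    using E[of 2] mom(4) by (simp add: power2_eq_square power3_eq_cube mult_ac)
  show "expectation (\<lambda>\<omega>. norm (\<xi> \<omega>) ^ 6) \<le> 15 * real DIM('b) ^ 4 * h ^ 3"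
    using E[of 3] mom(5) by (simp add: power3_eq_cube power4_eq_xxxx mult_ac)
qed

end

section \<open>The drift of the walk\<close>

lemma quad_add:
  assumes "norm n = 1"
  shows "quad n \<eta> (z + y) =
    quad n \<eta> z + 2 * (y \<bullet> ((z \<bullet> n) *\<^sub>R n + (3 * \<eta>\<^sup>2) *\<^sub>R tang n z)) + quad n \<eta> y"
proof -
  have "tang n z \<bullet> y = tang n z \<bullet> tang n y"
    using tang_inner[OF assms, of z] by (simp add: tang_def[of n y] inner_diff_right)
  moreover have "(norm (tang n (z + y)))\<^sup>2 =
      (norm (tang n z))\<^sup>2 + 2 * (tang n z \<bullet> tang n y) + (norm (tang n y))\<^sup>2"
    unfolding tang_add power2_norm_eq_inner by (simp add: inner_add_left inner_add_right inner_commute)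
  ultimately show ?thesis
    unfolding quad_def
    by (simp add: inner_add_left inner_add_right inner_commute[of y] power2_sum algebra_simps)
qed

text \<open>
  With \<open>u = h / quad n \<eta> z\<close>, the second order terms contribute a relative drift of at most \<open>- u / 64\<close>;
  the part of the cubic terms that Young's inequality turns into quadratic ones and, by the lower bound
  on the quadratic form, all terms of order \<open>u\<^sup>2\<close> cost at most \<open>u / 256\<close> each.
\<close>

lemma (in prob_space) quad_drift:
  fixes \<xi> :: "'a \<Rightarrow> 'b::euclidean_space" and \<eta> h :: real
  assumes \<xi>: "gaussian_step h \<xi>" and n: "norm n = 1" and \<eta>: "48 * \<eta>\<^sup>2 * DIM('b) \<le> 1"
    and z: "z \<in> wide_cone n (3 * \<eta>)" "0 \<le> \<eta>"
    and Q: "53760 * real DIM('b) ^ 4 * h \<le> quad n \<eta> z" "quad n \<eta> z \<le> 1"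
  shows "(\<integral>\<^sup>+\<omega>. sqrt (sqrt (quad n \<eta> (z + \<xi> \<omega>))) \<partial>M) + ennreal (h / 128)
    \<le> sqrt (sqrt (quad n \<eta> z))"
proof -
  define d where "d = real DIM('b)"
  have d: "d \<ge> 1" using DIM_positive[where 'a='b] by (simp add: d_def Suc_le_eq)
  have h: "h > 0" and [measurable]: "\<xi> \<in> borel_measurable M"
    using \<xi> by (auto simp: gaussian_step_def)
  have \<eta>3: "3 * \<eta>\<^sup>2 * d \<le> 1 / 16" using \<eta> by (simp add: d_def)
  have \<eta>1: "3 * \<eta>\<^sup>2 \<le> 1"
  proof -
    have "3 * \<eta>\<^sup>2 * 1 \<le> 3 * \<eta>\<^sup>2 * d" using d by (intro mult_left_mono) auto
    then show ?thesis using \<eta>3 by linarith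
  qed
  define q s where "q = quad n \<eta> z" and "s = z \<bullet> n"
  \<comment> \<open>Half the gradient of the form at \<open>z\<close>.\<close>
  define w where "w = (z \<bullet> n) *\<^sub>R n + (3 * \<eta>\<^sup>2) *\<^sub>R tang n z"
  have q: "q > 0" "q \<le> 1" "53760 * d ^ 4 * h \<le> q"
  proof -
    show "53760 * d ^ 4 * h \<le> q" "q \<le> 1" using Q by (auto simp: q_def d_def)
    have "53760 * d ^ 4 * h > 0" using d h by simp
    then show "q > 0" using \<open>53760 * d ^ 4 * h \<le> q\<close> by (rule less_le_trans)
  qed
  have w2: "(norm w)\<^sup>2 = s\<^sup>2 + (3 * \<eta>\<^sup>2)\<^sup>2 * (norm (tang n z))\<^sup>2"
  proof -
    have "w \<bullet> w = s\<^sup>2 * (n \<bullet> n) + (3 * \<eta>\<^sup>2)\<^sup>2 * (tang n z \<bullet> tang n z)"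
      using tang_inner[OF n, of z] inner_commute[of n "tang n z"]
      by (simp add: w_def s_def inner_add_left inner_add_right power2_eq_square)
    then show ?thesis using n by (simp add: power2_norm_eq_inner[symmetric])
  qed
  have w_le: "(norm w)\<^sup>2 \<le> q"
  proof -
    have "(3 * \<eta>\<^sup>2)\<^sup>2 \<le> (3 * \<eta>\<^sup>2) * 1"
      unfolding power2_eq_square[of "3 * \<eta>\<^sup>2"] using \<eta>1 by (intro mult_left_mono) auto
    then have "(3 * \<eta>\<^sup>2)\<^sup>2 * (norm (tang n z))\<^sup>2 \<le> 3 * \<eta>\<^sup>2 * (norm (tang n z))\<^sup>2"
      by (intro mult_right_mono) auto
    then show ?thesis unfolding w2 q_def quad_def s_def by simp
  qed
  \<comment> \<open>This is where \<open>z\<close> has to lie in the narrow cone: there the height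
    dominates, so the gradient is long enough for the concavity term to prevail.\<close>
  have w_ge: "3 / 4 * q \<le> (norm w)\<^sup>2"
  proof -
    have "(3 * \<eta> * norm (tang n z))\<^sup>2 \<le> s\<^sup>2"
      using z by (intro power_mono) (auto simp: wide_cone_def s_def)
    then have "9 * \<eta>\<^sup>2 * (norm (tang n z))\<^sup>2 \<le> s\<^sup>2" by (simp add: power_mult_distrib)
    then have "3 / 4 * q \<le> s\<^sup>2" unfolding q_def quad_def s_def[symmetric] by simp
    also have "\<dots> \<le> (norm w)\<^sup>2" unfolding w2 by simp
    finally show ?thesis .
  qed
  define v where "v = sqrt (sqrt q)"
  have v: "v > 0" "v ^ 4 = q"
  proof -
    show "v > 0" using q by (simp add: v_def)
    have "v ^ 4 = (v\<^sup>2)\<^sup>2" by (simp flip: power_mult)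
    then show "v ^ 4 = q" using q by (simp add: v_def)
  qed
  \<comment> \<open>Since \<open>q <= 1\<close>, the relative drift \<open>h / (128 q)\<close> of
    \<open>v\<close> amounts to an absolute drift of at least \<open>h / 128\<close>. This is why
    the walk is given up above level 1.\<close>
  have vq: "q \<le> v"
  proof -
    have "v \<le> 1" using q by (simp add: v_def)
    then have "v ^ 4 \<le> v ^ 1" using v(1) by (intro power_decreasing) auto
    then show ?thesis using v(2) by simp
  qed
  \<comment> \<open>The coefficients of the Taylor bound with Young parameter
    \<open>1 / (128 d)\<close>; the factor \<open>d\<close> offsets the second moment
    \<open>d h\<close> of a step.\<close>
  define c1 c2 c3 c4 c5 c6 where "c1 = 1 / (2 * q)" and "c2 = 1 / (4 * q)"
    and "c3 = 3 * \<eta>\<^sup>2 / (4 * q) + 1 / (256 * d * q)" and "c4 = 3 / (8 * q\<^sup>2)"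
    and "c5 = (64 * d + 1) / q\<^sup>2" and "c6 = 1 / q ^ 3"
  define P where "P = (\<lambda>y. 1 + c1 * (y \<bullet> w) + c2 * (y \<bullet> n)\<^sup>2 + c3 * norm y ^ 2 - c4 * (y \<bullet> w)\<^sup>2
      + c5 * norm y ^ 4 + c6 * norm y ^ 6)"
  have pointwise: "sqrt (sqrt (quad n \<eta> (z + y))) \<le> v * P y" for y
  proof -
    define t where "t = sqrt (sqrt (quad n \<eta> (z + y))) / v"
    define a e g where "a = 2 * (y \<bullet> w) / q" and "e = quad n \<eta> y / q" and "g = norm y / sqrt q"
    have t: "t \<ge> 0"
      unfolding t_def using v(1) quad_nonneg[of n \<eta> "z + y"]
      by (intro divide_nonneg_nonneg real_sqrt_ge_zero) auto
    have "(sqrt (sqrt (quad n \<eta> (z + y)))) ^ 4 = ((sqrt (sqrt (quad n \<eta> (z + y))))\<^sup>2)\<^sup>2"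
      by (simp flip: power_mult)
    then have "t ^ 4 = quad n \<eta> (z + y) / q"
      using quad_nonneg[of n \<eta> "z + y"] by (simp add: t_def power_divide v(2))
    also have "\<dots> = 1 + (a + e)"
      unfolding quad_add[OF n, of \<eta> z y] w_def[symmetric] q_def[symmetric] a_def e_def
      using q by (simp add: add_divide_distrib)
    finally have t4: "t ^ 4 - 1 = a + e" by simp
    have g2: "g\<^sup>2 = norm y ^ 2 / q" using q by (simp add: g_def power_divide)
    have g0: "g \<ge> 0" using q by (simp add: g_def)
    have "a\<^sup>2 \<le> (2 * g)\<^sup>2"
    proof -
      have "(y \<bullet> w)\<^sup>2 \<le> (norm y * norm w)\<^sup>2"
        using Cauchy_Schwarz_ineq2[of y w] by (intro abs_le_square_iff[THEN iffD1]) auto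
      also have "\<dots> = (norm y)\<^sup>2 * (norm w)\<^sup>2" by (rule power_mult_distrib)
      also have "\<dots> \<le> (norm y)\<^sup>2 * q" using w_le by (intro mult_left_mono) auto
      finally have "(y \<bullet> w)\<^sup>2 * (4 / q\<^sup>2) \<le> (norm y)\<^sup>2 * q * (4 / q\<^sup>2)" by (rule mult_right_mono) simp
      then show ?thesis unfolding power_mult_distrib g2 using q
        by (simp add: a_def power_divide power_mult_distrib power2_eq_square mult_ac)
    qed
    then have "\<bar>a\<bar> \<le> \<bar>2 * g\<bar>" by (rule abs_le_square_iff[THEN iffD2])
    then have a: "\<bar>a\<bar> \<le> 2 * g" using g0 by simp
    have e: "0 \<le> e" "e \<le> g\<^sup>2"
      using quad_nonneg[of n \<eta> y] quad_le_norm[OF n \<eta>1, of y] q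
      unfolding g2 e_def by (auto intro: divide_right_mono)
    have "t \<le> 1 + a / 4 + e / 4 - 3 / 32 * a\<^sup>2 + 1 / (128 * d) / 2 * g\<^sup>2
        + (1 / (2 * (1 / (128 * d))) + 1) * g ^ 4 + g ^ 6"
      by (rule order_trans[OF fourth_root_taylor[OF t, unfolded t4] taylor_remainder_bound[OF a e]])
        (use d in simp)
    moreover have "e / 4 \<le> c2 * (y \<bullet> n)\<^sup>2 + 3 * \<eta>\<^sup>2 / (4 * q) * norm y ^ 2"
    proof -
      have "quad n \<eta> y \<le> (y \<bullet> n)\<^sup>2 + 3 * \<eta>\<^sup>2 * norm y ^ 2"
        unfolding quad_def by (simp add: norm_tang_decomp[OF n, of y] mult_left_mono)
      then have "quad n \<eta> y / (4 * q) \<le> ((y \<bullet> n)\<^sup>2 + 3 * \<eta>\<^sup>2 * norm y ^ 2) / (4 * q)"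
        using q by (intro divide_right_mono) auto
      then show ?thesis by (simp add: e_def c2_def add_divide_distrib)
    qed
    moreover have "a / 4 = c1 * (y \<bullet> w)" by (simp add: a_def c1_def)
    moreover have "3 / 32 * a\<^sup>2 = c4 * (y \<bullet> w)\<^sup>2"
      by (simp add: a_def c4_def power_divide power_mult_distrib)
    moreover have "1 / (128 * d) / 2 * g\<^sup>2 = 1 / (256 * d * q) * norm y ^ 2" by (simp add: g2)
    moreover have "(1 / (2 * (1 / (128 * d))) + 1) * g ^ 4 = c5 * norm y ^ 4"
    proof -
      have "g ^ 4 = (g\<^sup>2)\<^sup>2" by (simp flip: power_mult)
      also have "\<dots> = norm y ^ 4 / q\<^sup>2" unfolding g2 by (simp add: power_divide flip: power_mult)
      finally show ?thesis by (simp add: c5_def)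
    qed
    moreover have "g ^ 6 = c6 * norm y ^ 6"
    proof -
      have "g ^ 6 = (g\<^sup>2) ^ 3" by (simp flip: power_mult)
      also have "\<dots> = norm y ^ 6 / q ^ 3" unfolding g2 by (simp add: power_divide flip: power_mult)
      finally show ?thesis by (simp add: c6_def)
    qed
    ultimately have "t \<le> P y" unfolding P_def c3_def distrib_right by linarith
    then show ?thesis using v(1) by (simp add: t_def divide_le_eq mult.commute)
  qed
  note gi = gaussian_inner_moments[OF \<xi>] and gn = gaussian_norm_moments[OF \<xi>]
  have Pint: "integrable M (\<lambda>\<omega>. P (\<xi> \<omega>))"
    unfolding P_def
    by (intro Bochner_Integration.integrable_add Bochner_Integration.integrable_diff
        integrable_mult_right gi(1,3) gn(1-3)) simp
  have "expectation (\<lambda>\<omega>. P (\<xi> \<omega>)) = 1 + c1 * 0 + c2 * (h * (norm n)\<^sup>2) + c3 * (d * h) - c4 * (h * (norm w)\<^sup>2)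
      + c5 * expectation (\<lambda>\<omega>. norm (\<xi> \<omega>) ^ 4) + c6 * expectation (\<lambda>\<omega>. norm (\<xi> \<omega>) ^ 6)"
    unfolding P_def using gi gn(1-4)
    by (simp add: prob_space d_def)
  also have "\<dots> \<le> 1 + c1 * 0 + c2 * (h * (norm n)\<^sup>2) + c3 * (d * h) - c4 * (h * (3 / 4 * q))
      + c5 * (3 * d ^ 3 * h ^ 2) + c6 * (15 * d ^ 4 * h ^ 3)"
    using gn(5,6) w_ge q d h unfolding d_def[symmetric]
    by (intro add_mono diff_mono mult_left_mono order_refl)
      (auto simp: c4_def c5_def c6_def)
  also have "\<dots> \<le> 1 - h / q / 128"
  proof -
    define u where "u = h / q"
    have u: "0 < u" "53760 * d ^ 4 * u \<le> 1" using h q by (auto simp: u_def field_simps)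
    have "1 \<le> d ^ 4" using d by simp
    then have "1 * u \<le> d ^ 4 * u" using u(1) by (intro mult_right_mono) auto
    then have u1: "u \<le> 1" using u(2) by linarith
    have 1: "c2 * (h * (norm n)\<^sup>2) = 1 / 4 * u" by (simp add: c2_def u_def n)
    have 2: "c3 * (d * h) = 1 / 4 * (3 * \<eta>\<^sup>2 * d * u) + 1 / 256 * u"
      using d q by (simp add: c3_def u_def field_simps)
    have "3 * \<eta>\<^sup>2 * d * u \<le> 1 / 16 * u" using \<eta>3 u by (intro mult_right_mono) auto
    then have 2: "c3 * (d * h) \<le> 1 / 64 * u + 1 / 256 * u" unfolding 2 by (simp add: mult_ac)
    have 3: "c4 * (h * (3 / 4 * q)) = 9 / 32 * u"
      using q by (simp add: c4_def u_def field_simps power2_eq_square)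
    have 4: "c5 * (3 * d ^ 3 * h ^ 2) = (64 * d + 1) * (3 * d ^ 3) * u\<^sup>2"
      by (simp add: c5_def u_def power_divide)
    have "(64 * d + 1) * (3 * d ^ 3) * u\<^sup>2 \<le> (65 * d) * (3 * d ^ 3) * u\<^sup>2"
      using d by (intro mult_right_mono) auto
    also have "\<dots> = 195 * (d ^ 4 * u) * u" by (simp add: eval_nat_numeral algebra_simps)
    finally have 4: "c5 * (3 * d ^ 3 * h ^ 2) \<le> 195 * (d ^ 4 * u) * u" unfolding 4 .
    have 5: "c6 * (15 * d ^ 4 * h ^ 3) = 15 * (d ^ 4 * u) * u * u"
      by (simp add: c6_def u_def power_divide eval_nat_numeral algebra_simps)
    have "15 * (d ^ 4 * u) * u * u \<le> 15 * (d ^ 4 * u) * u * 1"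
      using u u1 d by (intro mult_left_mono) auto
    then have 5: "c6 * (15 * d ^ 4 * h ^ 3) \<le> 15 * (d ^ 4 * u) * u" unfolding 5 by simp
    \<comment> \<open>53760 = 256 * (195 + 15), the last two being the coefficients left from the
      fourth and sixth moments.\<close>
    have "(d ^ 4 * u) * u \<le> 1 / 53760 * u" using u by (intro mult_right_mono) auto
    then have "195 * (d ^ 4 * u) * u + 15 * (d ^ 4 * u) * u \<le> 1 / 256 * u" by (simp add: mult_ac)
    then show ?thesis unfolding u_def[symmetric] using 1 2 3 4 5 by linarith
  qed
  finally have E: "expectation (\<lambda>\<omega>. P (\<xi> \<omega>)) \<le> 1 - h / q / 128" .
  have "(\<integral>\<^sup>+\<omega>. sqrt (sqrt (quad n \<eta> (z + \<xi> \<omega>))) \<partial>M) \<le> (\<integral>\<^sup>+\<omega>. ennreal (v * P (\<xi> \<omega>)) \<partial>M)"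
    using pointwise by (intro nn_integral_mono ennreal_leI)
  also have "\<dots> = ennreal (expectation (\<lambda>\<omega>. v * P (\<xi> \<omega>)))"
    using Pint pointwise quad_nonneg
    by (intro nn_integral_eq_integral integrable_mult_right AE_I2 order_trans[OF _ pointwise]) auto
  also have "expectation (\<lambda>\<omega>. v * P (\<xi> \<omega>)) = v * expectation (\<lambda>\<omega>. P (\<xi> \<omega>))" by simp
  also have "ennreal \<dots> \<le> ennreal (v - h / 128)"
  proof (rule ennreal_leI)
    have "v * expectation (\<lambda>\<omega>. P (\<xi> \<omega>)) \<le> v * (1 - h / q / 128)"
      using E v(1) by (intro mult_left_mono) auto
    also have "\<dots> = v - (h / q / 128) * v" by (simp add: algebra_simps)
    also have "\<dots> \<le> v - (h / q / 128) * q" using vq h q by (intro diff_mono mult_left_mono) auto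
    finally show "v * expectation (\<lambda>\<omega>. P (\<xi> \<omega>)) \<le> v - h / 128" using q by simp
  qed
  finally have "(\<integral>\<^sup>+\<omega>. sqrt (sqrt (quad n \<eta> (z + \<xi> \<omega>))) \<partial>M) + ennreal (h / 128)
      \<le> ennreal (v - h / 128) + ennreal (h / 128)" by (rule add_right_mono)
  also have "\<dots> = ennreal v"
  proof -
    have "1 \<le> d ^ 4" using d by simp
    then have "1 * h \<le> (53760 * d ^ 4) * h" using h by (intro mult_right_mono) auto
    then have "h \<le> q" using q(3) by linarith
    then have "v - h / 128 \<ge> 0" using vq h by simp
    then show ?thesis using h by (simp flip: ennreal_plus)
  qed
  finally show ?thesis unfolding v_def q_def .
qed

locale random_cone_walk = cone_walk n \<eta> lo y0 F + prob_space M
  for n :: "'b::euclidean_space" and \<eta> lo y0 :: real and F :: "'b set" and M :: "'w measure" +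
  fixes \<xi> :: "nat \<Rightarrow> 'w \<Rightarrow> 'b" and h :: real
  assumes indep: "indep_vars (\<lambda>_. borel) \<xi> UNIV"
    and gauss: "\<And>k. gaussian_step h (\<xi> k)"
    and lo: "lo = 53760 * real DIM('b) ^ 4 * h"
begin

abbreviation "W k \<omega> \<equiv> walk k (\<lambda>i. \<xi> i \<omega>)"
abbreviation "A k \<omega> \<equiv> active k (\<lambda>i. \<xi> i \<omega>) (W k \<omega>)"
abbreviation "V z \<equiv> ennreal (sqrt (sqrt (quad n \<eta> z)))"

lemma h_pos: "h > 0"
  using gauss[of 0] by (simp add: gaussian_step_def)

lemma measurable_\<xi> [measurable]: "\<xi> k \<in> borel_measurable M"
  using gauss[of k] by (simp add: gaussian_step_def)

lemma measurable_history: "(\<lambda>\<omega>. \<lambda>i\<in>{..<k}. \<xi> i \<omega>) \<in> measurable M (Pi\<^sub>M {..<k} (\<lambda>_. borel))"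
  by (intro measurable_restrict) simp

lemma W_restrict: "W k \<omega> = walk k (\<lambda>i\<in>{..<k}. \<xi> i \<omega>)"
  by (rule walk_cong) simp

lemma A_restrict: "A k \<omega> = active k (\<lambda>i\<in>{..<k}. \<xi> i \<omega>) (walk k (\<lambda>i\<in>{..<k}. \<xi> i \<omega>))"
  by (rule active_cong) simp

lemma measurable_W [measurable]: "W k \<in> borel_measurable M"
  unfolding W_restrict by (rule measurable_compose[OF measurable_history measurable_walk(1)]) simp

lemma measurable_A [measurable]: "Measurable.pred M (A k)"
  unfolding A_restrict by (rule measurable_compose[OF measurable_history measurable_walk(2)]) simp

text \<open>On the active event the next step is independent of the position, and the drift estimate
  is integrated over the position by Fubini; the shift that follows does not raise the potential.
  Setting \<open>X = 0\<close> on the inactive event makes activity a function of \<open>X\<close>,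
  since \<open>0\<close> is not in \<open>U\<close>, so the joint law of \<open>X\<close> and
  \<open>\<xi> k\<close> is enough.\<close>

lemma walk_step:
  "(\<integral>\<^sup>+\<omega>. V (W (Suc k) \<omega>) \<partial>M) + ennreal (h / 128) * emeasure M {\<omega> \<in> space M. A k \<omega>}
    \<le> (\<integral>\<^sup>+\<omega>. V (W k \<omega>) \<partial>M)"
proof -
  define U where "U = {z. z \<in> wide_cone n (3 * \<eta>) \<and> lo < quad n \<eta> z \<and> quad n \<eta> z \<le> 1}"
  have U [measurable]: "U \<in> sets borel"
    using closed_wide_cone[of n "3 * \<eta>"] unfolding U_def by measurable
  define X where "X = (\<lambda>\<omega>. if A k \<omega> then W k \<omega> else 0)"
  define f where "f = (\<lambda>x. if active k x (walk k x) then walk k x else 0)"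
  define \<phi> where "\<phi> = (\<lambda>(x, y). indicator U x * V (cone_shift n \<eta> (x + y)))"
  have zero: "0 \<notin> U" using lo_pos by (simp add: U_def quad_def)
  have AU: "A k \<omega> \<Longrightarrow> W k \<omega> \<in> U" for \<omega>
    using walk_narrow[of k] active_le[of k] by (auto simp: U_def)
  have XU: "X \<omega> \<in> U \<longleftrightarrow> A k \<omega>" for \<omega>
    using zero AU by (auto simp: X_def)
  have [measurable]: "X \<in> borel_measurable M" unfolding X_def by measurable
  have "f \<in> borel_measurable (Pi\<^sub>M {..<k} (\<lambda>_. borel))"
    unfolding f_def using measurable_walk[of k "{..<k}"] by (intro measurable_If) auto
  moreover have "(\<lambda>x. x k) \<in> borel_measurable (Pi\<^sub>M {k} (\<lambda>_. borel :: 'b measure))"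
    by (rule measurable_component_singleton) simp
  moreover have "indep_var (Pi\<^sub>M {..<k} (\<lambda>_. borel)) (\<lambda>\<omega>. \<lambda>i\<in>{..<k}. \<xi> i \<omega>)
      (Pi\<^sub>M {k} (\<lambda>_. borel)) (\<lambda>\<omega>. \<lambda>i\<in>{k}. \<xi> i \<omega>)"
    by (rule indep_var_restrict[OF indep]) auto
  ultimately have "indep_var borel (f \<circ> (\<lambda>\<omega>. \<lambda>i\<in>{..<k}. \<xi> i \<omega>)) borel ((\<lambda>x. x k) \<circ> (\<lambda>\<omega>. \<lambda>i\<in>{k}. \<xi> i \<omega>))"
    by (intro indep_var_compose)
  moreover have "f \<circ> (\<lambda>\<omega>. \<lambda>i\<in>{..<k}. \<xi> i \<omega>) = X"
  proof
    show "(f \<circ> (\<lambda>\<omega>. \<lambda>i\<in>{..<k}. \<xi> i \<omega>)) \<omega> = X \<omega>" for \<omega>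
      using A_restrict[of k \<omega>] W_restrict[of k \<omega>] by (simp add: f_def X_def)
  qed
  moreover have "(\<lambda>x. x k) \<circ> (\<lambda>\<omega>. \<lambda>i\<in>{k}. \<xi> i \<omega>) = \<xi> k" by (simp add: comp_def)
  ultimately have joint: "distr M borel X \<Otimes>\<^sub>M distr M borel (\<xi> k) =
      distr M (borel \<Otimes>\<^sub>M borel) (\<lambda>\<omega>. (X \<omega>, \<xi> k \<omega>))"
    using indep_var_distribution_eq by metis
  interpret E: prob_space "distr M borel (\<xi> k)" by (rule prob_space_distr) simp
  have \<phi> [measurable]: "\<phi> \<in> borel_measurable (borel \<Otimes>\<^sub>M borel)" unfolding \<phi>_def by measurable
  have "(\<integral>\<^sup>+\<omega>. indicator {\<omega>. A k \<omega>} \<omega> * V (W (Suc k) \<omega>) \<partial>M) = (\<integral>\<^sup>+\<omega>. \<phi> (X \<omega>, \<xi> k \<omega>) \<partial>M)"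
    using AU by (intro nn_integral_cong) (auto simp: \<phi>_def X_def indicator_def zero)
  also have "\<dots> = (\<integral>\<^sup>+p. \<phi> p \<partial>distr M (borel \<Otimes>\<^sub>M borel) (\<lambda>\<omega>. (X \<omega>, \<xi> k \<omega>)))"
    by (subst nn_integral_distr) auto
  also have "\<dots> = (\<integral>\<^sup>+x. \<integral>\<^sup>+y. \<phi> (x, y) \<partial>distr M borel (\<xi> k) \<partial>distr M borel X)"
    unfolding joint[symmetric] by (rule E.nn_integral_fst[symmetric]) (simp cong: measurable_cong_sets sets_pair_measure_cong)
  also have "\<dots> = (\<integral>\<^sup>+\<omega>. \<integral>\<^sup>+\<omega>'. \<phi> (X \<omega>, \<xi> k \<omega>') \<partial>M \<partial>M)"
    by (simp add: nn_integral_distr)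
  finally have fub: "(\<integral>\<^sup>+\<omega>. indicator {\<omega>. A k \<omega>} \<omega> * V (W (Suc k) \<omega>) \<partial>M) =
      (\<integral>\<^sup>+\<omega>. \<integral>\<^sup>+\<omega>'. \<phi> (X \<omega>, \<xi> k \<omega>') \<partial>M \<partial>M)" .
  have drift: "(\<integral>\<^sup>+\<omega>'. \<phi> (x, \<xi> k \<omega>') \<partial>M) + ennreal (h / 128) * indicator U x \<le> indicator U x * V x" for x
  proof (cases "x \<in> U")
    case True
    have "(\<integral>\<^sup>+\<omega>'. \<phi> (x, \<xi> k \<omega>') \<partial>M) \<le> (\<integral>\<^sup>+\<omega>'. V (x + \<xi> k \<omega>') \<partial>M)"
      unfolding \<phi>_def using True quad_cone_shift_le[OF norm_n \<eta>_pos]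
      by (intro nn_integral_mono) (auto intro!: ennreal_leI)
    moreover have "(\<integral>\<^sup>+\<omega>'. V (x + \<xi> k \<omega>') \<partial>M) + ennreal (h / 128) \<le> V x"
      using True \<eta>_pos \<eta>_small unfolding U_def lo
      by (intro quad_drift[OF gauss norm_n]) auto
    ultimately show ?thesis using True by (auto intro: order_trans add_right_mono)
  qed (simp add: \<phi>_def)
  have split: "(\<integral>\<^sup>+\<omega>. V (W j \<omega>) \<partial>M) =
      (\<integral>\<^sup>+\<omega>. indicator {\<omega>. A k \<omega>} \<omega> * V (W j \<omega>) \<partial>M) + (\<integral>\<^sup>+\<omega>. indicator {\<omega>. \<not> A k \<omega>} \<omega> * V (W j \<omega>) \<partial>M)" for j
    by (subst nn_integral_add[symmetric]) (auto intro!: nn_integral_cong simp: indicator_def)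
  have "(\<integral>\<^sup>+\<omega>. indicator {\<omega>. A k \<omega>} \<omega> * V (W (Suc k) \<omega>) \<partial>M) +
      ennreal (h / 128) * emeasure M {\<omega> \<in> space M. A k \<omega>} =
      (\<integral>\<^sup>+\<omega>. (\<integral>\<^sup>+\<omega>'. \<phi> (X \<omega>, \<xi> k \<omega>') \<partial>M) + ennreal (h / 128) * indicator U (X \<omega>) \<partial>M)"
  proof -
    have "emeasure M {\<omega> \<in> space M. A k \<omega>} = (\<integral>\<^sup>+\<omega>. indicator U (X \<omega>) \<partial>M)"
    proof -
      have "(\<integral>\<^sup>+\<omega>. indicator U (X \<omega>) \<partial>M) = (\<integral>\<^sup>+\<omega>. indicator {\<omega> \<in> space M. A k \<omega>} \<omega> \<partial>M)"
        by (intro nn_integral_cong) (auto simp: indicator_def XU)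
      also have "\<dots> = emeasure M {\<omega> \<in> space M. A k \<omega>}"
        by (rule nn_integral_indicator) measurable
      finally show ?thesis by simp
    qed
    then show ?thesis unfolding fub
      by (subst nn_integral_add) (auto simp: nn_integral_cmult)
  qed
  also have "\<dots> \<le> (\<integral>\<^sup>+\<omega>. indicator U (X \<omega>) * V (X \<omega>) \<partial>M)"
    by (intro nn_integral_mono drift)
  also have "\<dots> = (\<integral>\<^sup>+\<omega>. indicator {\<omega>. A k \<omega>} \<omega> * V (W k \<omega>) \<partial>M)"
    by (intro nn_integral_cong) (auto simp: indicator_def XU, simp add: X_def)
  finally have act: "(\<integral>\<^sup>+\<omega>. indicator {\<omega>. A k \<omega>} \<omega> * V (W (Suc k) \<omega>) \<partial>M) +
      ennreal (h / 128) * emeasure M {\<omega> \<in> space M. A k \<omega>} \<le>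
      (\<integral>\<^sup>+\<omega>. indicator {\<omega>. A k \<omega>} \<omega> * V (W k \<omega>) \<partial>M)" .
  have idle: "(\<integral>\<^sup>+\<omega>. indicator {\<omega>. \<not> A k \<omega>} \<omega> * V (W (Suc k) \<omega>) \<partial>M) =
      (\<integral>\<^sup>+\<omega>. indicator {\<omega>. \<not> A k \<omega>} \<omega> * V (W k \<omega>) \<partial>M)"
    by (intro nn_integral_cong) (auto simp: indicator_def)
  show ?thesis
    unfolding split[of "Suc k"] split[of k] idle
    using add_right_mono[OF act] by (simp add: add_ac)
qed

lemma walk_potential:
  "(\<integral>\<^sup>+\<omega>. V (W N \<omega>) \<partial>M) + ennreal (h / 128) * (\<Sum>k<N. emeasure M {\<omega> \<in> space M. A k \<omega>})
    \<le> ennreal (sqrt y0)"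
proof (induction N)
  case 0
  show ?case using quad_normal[OF norm_n, of \<eta> y0] y0_pos by (simp add: emeasure_space_1)
next
  case (Suc N)
  have "(\<integral>\<^sup>+\<omega>. V (W (Suc N) \<omega>) \<partial>M) + ennreal (h / 128) * (\<Sum>k<Suc N. emeasure M {\<omega> \<in> space M. A k \<omega>}) =
      (\<integral>\<^sup>+\<omega>. V (W (Suc N) \<omega>) \<partial>M) + ennreal (h / 128) * emeasure M {\<omega> \<in> space M. A N \<omega>}
      + ennreal (h / 128) * (\<Sum>k<N. emeasure M {\<omega> \<in> space M. A k \<omega>})"
    by (simp add: distrib_left add_ac)
  also have "\<dots> \<le> (\<integral>\<^sup>+\<omega>. V (W N \<omega>) \<partial>M) + ennreal (h / 128) * (\<Sum>k<N. emeasure M {\<omega> \<in> space M. A k \<omega>})"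
    by (intro add_right_mono walk_step)
  finally show ?case using Suc.IH by (rule order_trans)
qed

lemma real_card_active:
  "real (card {k. k < N \<and> A k \<omega>}) = (\<Sum>k<N. indicator {\<omega>. A k \<omega>} \<omega>)"
proof -
  have "{k. k < N \<and> A k \<omega>} = {k\<in>{..<N}. A k \<omega>}" by auto
  then show ?thesis by (simp add: indicator_def sum.If_cases Int_def)
qed

lemma measurable_card_active [measurable]:
  "(\<lambda>\<omega>. real (card {k. k < N \<and> A k \<omega>})) \<in> borel_measurable M"
  unfolding real_card_active by measurable

lemma calm_event: "{\<omega> \<in> space M. calm N l (\<lambda>i. \<xi> i \<omega>)} \<in> events"
proof -
  have "{\<omega> \<in> space M. calm N l (\<lambda>i. \<xi> i \<omega>)} =
      {\<omega> \<in> space M. quad n \<eta> (W N \<omega>) \<le> 1 \<and> real (card {k. k < N \<and> A k \<omega>}) < real l}"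
    by (simp add: calm_def)
  also have "\<dots> \<in> events" by measurable
  finally show ?thesis .
qed

text \<open>Markov's inequality twice: for the potential at time \<open>N\<close>, which exceeds 1
  if the walk has been given up, and for the number of active steps, whose mean is at most
  \<open>128 * sqrt y0 / h\<close> by \<open>walk_potential\<close>.\<close>

lemma prob_not_calm:
  assumes m: "m > 0"
  shows "prob {\<omega> \<in> space M. \<not> calm N m (\<lambda>i. \<xi> i \<omega>)} \<le> sqrt y0 * (1 + 128 / (h * real m))"
proof -
  let ?B1 = "{\<omega> \<in> space M. quad n \<eta> (W N \<omega>) > 1}"
  let ?B2 = "{\<omega> \<in> space M. m \<le> card {k. k < N \<and> A k \<omega>}}"
  have card: "(of_nat (card {k. k < N \<and> A k \<omega>}) :: ennreal) = (\<Sum>k<N. indicator {\<omega>. A k \<omega>} \<omega>)" for \<omega>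
  proof -
    have "{k. k < N \<and> A k \<omega>} = {k\<in>{..<N}. A k \<omega>}" by auto
    then show ?thesis by (simp add: indicator_def sum.If_cases Int_def)
  qed
  have B2_eq: "?B2 = {\<omega> \<in> space M. real m \<le> real (card {k. k < N \<and> A k \<omega>})}" by simp
  have B1 [measurable]: "?B1 \<in> sets M" by measurable
  have B2 [measurable]: "?B2 \<in> sets M" unfolding B2_eq by measurable
  have h: "h > 0" by (rule h_pos)
  have "emeasure M ?B1 \<le> (\<integral>\<^sup>+\<omega>. V (W N \<omega>) \<partial>M)"
  proof -
    have "emeasure M ?B1 = (\<integral>\<^sup>+\<omega>. indicator ?B1 \<omega> \<partial>M)" by simp
    also have "\<dots> \<le> (\<integral>\<^sup>+\<omega>. V (W N \<omega>) \<partial>M)"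
      by (intro nn_integral_mono) (auto simp: indicator_def ennreal_ge_1)
    finally show ?thesis .
  qed
  also have "\<dots> \<le> ennreal (sqrt y0)"
    using walk_potential[of N] by (rule order_trans[rotated]) simp
  finally have 1: "prob ?B1 \<le> sqrt y0" using y0_pos by (simp add: emeasure_eq_measure)
  have "ennreal (h / 128) * (of_nat m * emeasure M ?B2) \<le>
      ennreal (h / 128) * (\<Sum>k<N. emeasure M {\<omega> \<in> space M. A k \<omega>})"
  proof (rule mult_left_mono)
    have "of_nat m * emeasure M ?B2 = (\<integral>\<^sup>+\<omega>. of_nat m * indicator ?B2 \<omega> \<partial>M)"
      by (simp add: nn_integral_cmult)
    also have "\<dots> \<le> (\<integral>\<^sup>+\<omega>. (\<Sum>k<N. indicator {\<omega>. A k \<omega>} \<omega>) \<partial>M)"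
      unfolding card[symmetric] by (intro nn_integral_mono) (auto simp: indicator_def)
    also have "\<dots> = (\<Sum>k<N. \<integral>\<^sup>+\<omega>. indicator {\<omega>. A k \<omega>} \<omega> \<partial>M)"
      by (rule nn_integral_sum) measurable
    also have "\<dots> = (\<Sum>k<N. \<integral>\<^sup>+\<omega>. indicator {\<omega> \<in> space M. A k \<omega>} \<omega> \<partial>M)"
      by (intro sum.cong refl nn_integral_cong) (auto simp: indicator_def)
    also have "\<dots> = (\<Sum>k<N. emeasure M {\<omega> \<in> space M. A k \<omega>})"
      by (intro sum.cong refl nn_integral_indicator) measurable
    finally show "of_nat m * emeasure M ?B2 \<le> (\<Sum>k<N. emeasure M {\<omega> \<in> space M. A k \<omega>})" .
  qed simp
  also have "\<dots> \<le> ennreal (sqrt y0)"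
    using walk_potential[of N] by (rule order_trans[rotated]) simp
  finally have "ennreal (h / 128 * (real m * prob ?B2)) \<le> ennreal (sqrt y0)"
    using h by (simp add: emeasure_eq_measure ennreal_of_nat_eq_real_of_nat flip: ennreal_mult)
  then have "h / 128 * (real m * prob ?B2) \<le> sqrt y0" using y0_pos by simp
  then have 2: "prob ?B2 \<le> sqrt y0 * (128 / (h * real m))"
    using h m by (simp add: field_simps)
  have "{\<omega> \<in> space M. \<not> calm N m (\<lambda>i. \<xi> i \<omega>)} = ?B1 \<union> ?B2" by (auto simp: calm_def)
  then have "prob {\<omega> \<in> space M. \<not> calm N m (\<lambda>i. \<xi> i \<omega>)} \<le> prob ?B1 + prob ?B2"
    using measure_Un_le[OF B1 B2] by simp
  then show ?thesis using 1 2 by (simp add: distrib_left)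
qed

end

section \<open>Cone times of continuous paths\<close>

definition increments :: "nat \<Rightarrow> (real \<Rightarrow> 'a::real_vector) \<Rightarrow> nat \<Rightarrow> 'a" where
  "increments m w i = w (real (Suc i) / real m) - w (real i / real m)"

lemma sum_increments: "(\<Sum>i<j. increments m w i) = w (real j / real m) - w 0"
  using sum_lessThan_telescope[of "\<lambda>i. w (real i / real m)" j] by (simp add: increments_def)

lemma (in cone_walk) grid_cone_time:
  assumes w0: "w 0 = 0" and calm: "calm (N1 + l) l (increments m w)"
    and hit: "a \<le> N1" "w (real a / m) \<in> F" and wait: "\<And>j. j < a \<Longrightarrow> w (real j / m) \<notin> F"
  obtains k z where "a \<le> k" "k < a + l" "3 * \<eta>\<^sup>2 * (norm z)\<^sup>2 \<le> lo"
    "\<And>j. j \<in> {a..k} \<Longrightarrow> w (real j / m) - w (real k / m) + z \<in> wide_cone n \<eta>"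
    "w (real a / m) - w (real k / m) + z - y0 *\<^sub>R n \<in> wide_cone n \<eta>"
proof -
  have S: "(\<Sum>i<j. increments m w i) = w (real j / m)" for j
    by (simp add: sum_increments w0)
  show ?thesis
  proof (rule walk_success[of a N1 "increments m w" l, unfolded S])
    fix k z
    assume k: "a \<le> k" "k < a + l" and z: "quad n \<eta> z \<le> lo"
      and c: "\<And>j. j \<in> {a..k} \<Longrightarrow> w (real j / m) - w (real k / m) + z \<in> wide_cone n \<eta>"
      "w (real a / m) - w (real k / m) + z - y0 *\<^sub>R n \<in> wide_cone n \<eta>"
    have "3 * \<eta>\<^sup>2 * (norm z)\<^sup>2 \<le> lo"
      using norm_le_quad[OF norm_n \<eta>_le(2), of z] z by linarith
    then show ?thesis by (rule that[OF k _ c])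
  qed (use hit wait calm in auto)
qed

lemma grid_floor_tendsto:
  assumes "filterlim g at_top sequentially" "s \<ge> 0"
  shows "(\<lambda>i. real (nat \<lfloor>s * real (g i)\<rfloor>) / real (g i)) \<longlonglongrightarrow> s"
proof (rule tendsto_sandwich[of "\<lambda>i. s - 1 / real (g i)" _ _ "\<lambda>i. s"])
  have pos: "\<forall>\<^sub>F i in sequentially. g i > 0"
    by (rule eventually_compose_filterlim[OF eventually_gt_at_top assms(1)])
  show "\<forall>\<^sub>F i in sequentially. s - 1 / real (g i) \<le> real (nat \<lfloor>s * real (g i)\<rfloor>) / real (g i)"
    using pos
  proof eventually_elim
    case (elim i)
    have "s * real (g i) - 1 \<le> real (nat \<lfloor>s * real (g i)\<rfloor>)"
      using assms(2) by (simp add: of_nat_nat)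
    from divide_right_mono[OF this, of "real (g i)"] elim show ?case
      by (simp add: diff_divide_distrib)
  qed
  show "\<forall>\<^sub>F i in sequentially. real (nat \<lfloor>s * real (g i)\<rfloor>) / real (g i) \<le> s"
    using pos
  proof eventually_elim
    case (elim i)
    have "real (nat \<lfloor>s * real (g i)\<rfloor>) \<le> s * real (g i)"
      using assms(2) by (simp add: of_nat_nat)
    then show ?case using elim by (simp add: field_simps)
  qed
  have "filterlim (\<lambda>i. real (g i)) at_top sequentially"
    using filterlim_compose[OF filterlim_real_sequentially assms(1)] by simp
  then have "(\<lambda>i. 1 / real (g i)) \<longlonglongrightarrow> 0"
    by (intro tendsto_divide_0[OF tendsto_const] filterlim_at_top_imp_at_infinity)
  then show "(\<lambda>i. s - 1 / real (g i)) \<longlonglongrightarrow> s"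
    using tendsto_diff[OF tendsto_const, of "\<lambda>i. 1 / real (g i)" 0 sequentially s] by simp
qed simp

lemma path_tendsto:
  assumes w: "continuous_on {0..} w" and u: "u \<longlonglongrightarrow> s" and "\<And>i. (0::real) \<le> u i"
  shows "(\<lambda>i. w (u i)) \<longlonglongrightarrow> w s"
proof (rule continuous_on_tendsto_compose[OF w u])
  show "s \<in> {0..}" using LIMSEQ_le_const[OF u] assms(3) by auto
  show "\<forall>\<^sub>F i in sequentially. u i \<in> {0..}" using assms(3) by simp
qed

text \<open>The grid cone times are bounded, so a subsequence converges to some \<open>t\<close>.
  The defects \<open>z i\<close> tend to 0 because their squares are of order
  \<open>1 / g i\<close>, and the closed cone conditions pass to the limit by continuity of
  \<open>w\<close>.\<close>

lemma cone_time_limit: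
  fixes w :: "real \<Rightarrow> 'a::euclidean_space"
  assumes w: "continuous_on {0..} w" and g: "filterlim g at_top sequentially" "\<And>i. g i > 0"
    and \<sigma>: "(\<lambda>i. real (a i) / real (g i)) \<longlonglongrightarrow> \<sigma>" "\<sigma> \<le> T" and T2: "0 \<le> T2"
    and k: "\<And>i. a i \<le> k i" "\<And>i. real (k i) \<le> real (a i) + real (g i) * T2 + 1"
    and \<eta>: "0 < \<eta>" and z: "\<And>i. 3 * \<eta>\<^sup>2 * (norm (z i))\<^sup>2 \<le> C / real (g i)"
    and cone: "\<And>i j. j \<in> {a i..k i} \<Longrightarrow> w (real j / g i) - w (real (k i) / g i) + z i \<in> wide_cone n \<eta>"
    and drop: "\<And>i. w (real (a i) / g i) - w (real (k i) / g i) + z i - y0 *\<^sub>R n \<in> wide_cone n \<eta>"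
    and y0: "0 < y0" "norm n = 1"
  shows "\<exists>t. \<sigma> \<le> t \<and> t \<le> \<sigma> + T2 \<and> (\<forall>s\<in>{\<sigma>..t}. w s - w t \<in> wide_cone n \<eta>) \<and>
    w \<sigma> - w t - y0 *\<^sub>R n \<in> wide_cone n \<eta>"
proof -
  define \<alpha> \<beta> where "\<alpha> = (\<lambda>i. real (a i) / real (g i))" and "\<beta> = (\<lambda>i. real (k i) / real (g i))"
  have \<alpha>\<beta>: "\<alpha> i \<le> \<beta> i" for i using k(1) by (simp add: \<alpha>_def \<beta>_def divide_right_mono)
  have \<alpha>0: "0 \<le> \<alpha> i" for i by (simp add: \<alpha>_def)
  have \<beta>_le: "\<beta> i \<le> \<alpha> i + T2 + 1 / real (g i)" for i
    using divide_right_mono[OF k(2), of "real (g i)" i] g(2)[of i]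
    by (simp add: \<alpha>_def \<beta>_def add_divide_distrib)
  have g_real: "filterlim (\<lambda>i. real (g i)) at_top sequentially"
    using filterlim_compose[OF filterlim_real_sequentially g(1)] by simp
  then have inv0: "(\<lambda>i. c / real (g i)) \<longlonglongrightarrow> 0" for c
    by (intro tendsto_divide_0[OF tendsto_const] filterlim_at_top_imp_at_infinity)
  have "(\<lambda>i. \<alpha> i + T2 + 1 / real (g i)) \<longlonglongrightarrow> \<sigma> + T2 + 0"
    using \<sigma>(1) unfolding \<alpha>_def[symmetric] by (intro tendsto_add tendsto_const inv0)
  then have "Bseq (\<lambda>i. \<alpha> i + T2 + 1 / real (g i))" by (intro convergent_imp_Bseq convergentI)
  then obtain K where K: "\<And>i. \<bar>\<alpha> i + T2 + 1 / real (g i)\<bar> \<le> K" unfolding Bseq_def by auto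
  have "\<forall>i. \<beta> i \<in> {0..K}"
  proof
    fix i show "\<beta> i \<in> {0..K}" using K[of i] \<beta>_le[of i] \<alpha>\<beta>[of i] \<alpha>0[of i] by auto
  qed
  then obtain t r where t: "t \<in> {0..K}" "strict_mono r" "(\<beta> \<circ> r) \<longlonglongrightarrow> t"
    using compact_Icc[of 0 K] unfolding compact_def by metis
  have gr: "filterlim (\<lambda>i. g (r i)) at_top sequentially"
    using filterlim_compose[OF g(1) filterlim_subseq[OF t(2)]] .
  have \<alpha>r: "(\<lambda>i. \<alpha> (r i)) \<longlonglongrightarrow> \<sigma>"
    using LIMSEQ_subseq_LIMSEQ[OF \<sigma>(1) t(2)] by (simp add: \<alpha>_def comp_def)
  have \<beta>r: "(\<lambda>i. \<beta> (r i)) \<longlonglongrightarrow> t" using t(3) by (simp add: comp_def)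
  have invr: "(\<lambda>i. c / real (g (r i))) \<longlonglongrightarrow> 0" for c
    using LIMSEQ_subseq_LIMSEQ[OF inv0[of c] t(2)] by (simp add: comp_def)
  have w\<alpha>: "(\<lambda>i. w (\<alpha> (r i))) \<longlonglongrightarrow> w \<sigma>" by (rule path_tendsto[OF w \<alpha>r]) (rule \<alpha>0)
  have w\<beta>: "(\<lambda>i. w (\<beta> (r i))) \<longlonglongrightarrow> w t"
    by (rule path_tendsto[OF w \<beta>r]) (simp add: \<beta>_def)
  have z0: "(\<lambda>i. z (r i)) \<longlonglongrightarrow> 0"
  proof -
    have bound: "norm (z i) \<le> sqrt ((C / (3 * \<eta>\<^sup>2)) / real (g i))" for i
    proof (rule real_le_rsqrt)
      have "(norm (z i))\<^sup>2 * (3 * \<eta>\<^sup>2) \<le> C / real (g i)" using z[of i] by (simp add: mult.commute)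
      then have "(norm (z i))\<^sup>2 \<le> (C / real (g i)) / (3 * \<eta>\<^sup>2)"
        by (subst pos_le_divide_eq) (use \<eta> in auto)
      also have "\<dots> = (C / (3 * \<eta>\<^sup>2)) / real (g i)" by simp
      finally show "(norm (z i))\<^sup>2 \<le> (C / (3 * \<eta>\<^sup>2)) / real (g i)" .
    qed
    have "(\<lambda>i. sqrt ((C / (3 * \<eta>\<^sup>2)) / real (g (r i)))) \<longlonglongrightarrow> sqrt 0"
      by (intro tendsto_real_sqrt invr)
    then have "(\<lambda>i. sqrt ((C / (3 * \<eta>\<^sup>2)) / real (g (r i)))) \<longlonglongrightarrow> 0" by simp
    then show ?thesis by (rule Lim_null_comparison[OF always_eventually, rotated]) (intro allI bound)
  qed
  have \<sigma>t: "\<sigma> \<le> t" using LIMSEQ_le[OF \<alpha>r \<beta>r] \<alpha>\<beta> by blast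
  have "(\<lambda>i. \<alpha> (r i) + T2 + 1 / real (g (r i))) \<longlonglongrightarrow> \<sigma> + T2 + 0"
    by (intro tendsto_add tendsto_const invr \<alpha>r)
  then have t\<sigma>: "t \<le> \<sigma> + T2" using LIMSEQ_le[OF \<beta>r] \<beta>_le by fastforce
  have "(\<lambda>i. w (\<alpha> (r i)) - w (\<beta> (r i)) + z (r i) - y0 *\<^sub>R n) \<longlonglongrightarrow> w \<sigma> - w t + 0 - y0 *\<^sub>R n"
    by (intro tendsto_add tendsto_diff w\<alpha> w\<beta> z0 tendsto_const)
  then have "w \<sigma> - w t + 0 - y0 *\<^sub>R n \<in> wide_cone n \<eta>"
    by (rule Lim_in_closed_set[OF closed_wide_cone _ sequentially_bot, rotated])
      (use drop in \<open>simp add: \<alpha>_def \<beta>_def\<close>)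
  then have dropt: "w \<sigma> - w t - y0 *\<^sub>R n \<in> wide_cone n \<eta>" by simp
  have "y0 *\<^sub>R n \<in> wide_cone n \<eta>"
    using y0 by (simp add: wide_cone_def tang_scaleR tang_normal dot_square_norm)
  from wide_cone_add[OF _ dropt this] have at_\<sigma>: "w \<sigma> - w t \<in> wide_cone n \<eta>" using \<eta> by simp
  \<comment> \<open>Strict inequalities ensure that the grid points below \<open>s\<close>
    eventually lie between \<open>a\<close> and \<open>k\<close>. At \<sigma> the claim comes from
    \<open>drop\<close>, at \<open>t\<close> it is trivial.\<close>
  have "w s - w t \<in> wide_cone n \<eta>" if s: "\<sigma> < s" "s < t" for s
  proof -
    define b where "b = (\<lambda>i. nat \<lfloor>s * real (g (r i))\<rfloor>)"
    have s0: "s \<ge> 0" using s LIMSEQ_le_const[OF \<alpha>r] \<alpha>0 by fastforce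
    have bs: "(\<lambda>i. real (b i) / real (g (r i))) \<longlonglongrightarrow> s"
      unfolding b_def by (rule grid_floor_tendsto[OF gr s0])
    obtain c1 where c1: "\<sigma> < c1" "c1 < s" using dense[OF s(1)] by blast
    obtain c2 where c2: "s < c2" "c2 < t" using dense[OF s(2)] by blast
    note order_tendstoD(2)[OF \<alpha>r c1(1)] order_tendstoD(1)[OF \<beta>r c2(2)]
    moreover note order_tendstoD(1)[OF bs c1(2)] order_tendstoD(2)[OF bs c2(1)]
    ultimately have ev: "\<forall>\<^sub>F i in sequentially. w (real (b i) / g (r i)) - w (\<beta> (r i)) + z (r i) \<in> wide_cone n \<eta>"
    proof eventually_elim
      case (elim i)
      have gi: "real (g (r i)) > 0" using g(2)[of "r i"] by simp
      have "\<alpha> (r i) < real (b i) / real (g (r i))" "real (b i) / real (g (r i)) < \<beta> (r i)"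
        using elim by linarith+
      then have "real (a (r i)) < real (b i)" "real (b i) < real (k (r i))"
        using gi unfolding \<alpha>_def \<beta>_def by (auto dest: divide_less_cancel[THEN iffD1])
      then have "b i \<in> {a (r i)..k (r i)}" by simp
      then show ?case unfolding \<beta>_def by (rule cone)
    qed
    have "(\<lambda>i. w (real (b i) / g (r i)) - w (\<beta> (r i)) + z (r i)) \<longlonglongrightarrow> w s - w t + 0"
      by (intro tendsto_add tendsto_diff w\<beta> z0 path_tendsto[OF w bs]) simp
    from Lim_in_closed_set[OF closed_wide_cone ev sequentially_bot this] show ?thesis by simp
  qed
  then have "\<forall>s\<in>{\<sigma>..t}. w s - w t \<in> wide_cone n \<eta>"
    using at_\<sigma> by (metis atLeastAtMost_iff cancel_comm_monoid_add_class.diff_cancel order_le_less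
        zero_in_wide_cone)
  then show ?thesis using \<sigma>t t\<sigma> dropt by blast
qed

lemma frontier_point_near:
  fixes z :: "'a::euclidean_space"
  assumes z: "z \<in> closure D" and D: "open D" "- D \<noteq> {}" and \<delta>: "infdist z (- D) \<le> \<delta>"
  obtains p where "p \<in> frontier D" "norm (z - p) \<le> (\<delta>::real)"
proof (cases "z \<in> D")
  case False
  then have "z \<in> frontier D" using z D by (simp add: frontier_def interior_open)
  moreover have "0 \<le> \<delta>" using \<delta> infdist_nonneg order_trans by blast
  ultimately show ?thesis using that[of z] by simp
next
  case True
  have "closed (- D)" using D(1) by (rule closed_Compl)
  then obtain c where c: "c \<in> - D" "infdist z (- D) = dist z c"
    using infdist_attains_inf[OF _ D(2)] by blast
  have "closed_segment z c \<inter> frontier D \<noteq> {}"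
    using True c(1) by (intro connected_Int_frontier) (auto intro: ends_in_segment)
  then obtain p where p: "p \<in> closed_segment z c" "p \<in> frontier D" by blast
  have "dist z p \<le> dist z c"
    using dist_in_closed_segment[OF p(1)] by (simp add: dist_commute)
  then show ?thesis using that[OF p(2)] c(2) \<delta> by (simp add: dist_norm)
qed

text \<open>The first grid point in \<open>F\<close> depends on the path but not on the direction,
  so the subsequence that defines \<sigma> is fixed before \<open>n\<close>; one \<sigma> serves all
  directions, while \<open>t\<close> may vary. Before \<sigma> the path is a limit of values outside
  \<open>F\<close>, hence only \<open>closure (- F)\<close> is obtained.\<close>

lemma path_cone_time:
  fixes w :: "real \<Rightarrow> 'a::euclidean_space" and T1 j :: nat
  assumes w: "continuous_on {0..} w" "w 0 = 0" and j: "j > 0" and \<eta>: "0 < \<eta>" and y0: "0 < y0"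
    and walk: "\<And>n m. n \<in> NS \<Longrightarrow> m > 0 \<Longrightarrow> cone_walk n \<eta> (C / real m) y0 F"
    and hit: "w (real T1) \<in> F" and F: "closed F"
    and inf: "\<exists>\<^sub>\<infinity>m. m > 0 \<and> (\<forall>n\<in>NS. cone_walk.calm n \<eta> (C / real m) y0 F
      (m * T1 + (m div j + 1)) (m div j + 1) (increments m w))"
  shows "\<exists>\<sigma>. 0 \<le> \<sigma> \<and> \<sigma> \<le> real T1 \<and> w \<sigma> \<in> F \<and> (\<forall>s. 0 \<le> s \<and> s < \<sigma> \<longrightarrow> w s \<in> closure (- F)) \<and>
    (\<forall>n\<in>NS. \<exists>t. \<sigma> \<le> t \<and> t \<le> \<sigma> + 1 / real j \<and> (\<forall>s\<in>{\<sigma>..t}. w s - w t \<in> wide_cone n \<eta>) \<and>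
       w \<sigma> - w t - y0 *\<^sub>R n \<in> wide_cone n \<eta>)"
proof -
  define good where "good = (\<lambda>m. m > 0 \<and> (\<forall>n\<in>NS. cone_walk.calm n \<eta> (C / real m) y0 F
      (m * T1 + (m div j + 1)) (m div j + 1) (increments m w)))"
  have "infinite {m. good m}" using inf unfolding good_def INFM_iff_infinite .
  then obtain f :: "nat \<Rightarrow> nat" where f: "strict_mono f" "\<And>i. good (f i)"
    using infinite_enumerate[of "{m. good m}"] by blast
  have fpos: "f i > 0" for i using f(2)[of i] by (simp add: good_def)
  define a where "a = (\<lambda>m. LEAST a. w (real a / real m) \<in> F)"
  have a_hit: "w (real (a m) / real m) \<in> F" and a_le: "a m \<le> m * T1" if "m > 0" for m
  proof -
    have 1: "w (real (m * T1) / real m) \<in> F" using hit that by simp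
    show "w (real (a m) / real m) \<in> F" unfolding a_def by (rule LeastI[of "\<lambda>a. w (real a / real m) \<in> F", OF 1])
    show "a m \<le> m * T1" unfolding a_def by (rule Least_le[of "\<lambda>a. w (real a / real m) \<in> F", OF 1])
  qed
  have a_wait: "w (real i / real m) \<notin> F" if "i < a m" for i m
    using not_less_Least[of i "\<lambda>a. w (real a / real m) \<in> F"] that unfolding a_def by blast
  have "\<forall>i. real (a (f i)) / real (f i) \<in> {0..real T1}"
  proof
    fix i
    have "real (a (f i)) \<le> real (f i) * real T1"
      using a_le[OF fpos[of i]] by (metis of_nat_le_iff of_nat_mult)
    then show "real (a (f i)) / real (f i) \<in> {0..real T1}"
      using fpos[of i] by (simp add: divide_le_eq mult.commute)
  qed
  then obtain \<sigma> r where \<sigma>: "\<sigma> \<in> {0..real T1}" "strict_mono (r :: nat \<Rightarrow> nat)"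
    "((\<lambda>i. real (a (f i)) / real (f i)) \<circ> r) \<longlonglongrightarrow> \<sigma>"
    by (rule seq_compactE[OF compact_imp_seq_compact[OF compact_Icc]]) (rule that)
  define g where "g = (\<lambda>i. f (r i))"
  have g: "filterlim g at_top sequentially" "\<And>i. g i > 0" "\<And>i. good (g i)"
    using filterlim_subseq[OF strict_mono_o[OF f(1) \<sigma>(2)]] fpos f(2) by (simp_all add: g_def comp_def)
  have a\<sigma>: "(\<lambda>i. real (a (g i)) / real (g i)) \<longlonglongrightarrow> \<sigma>" using \<sigma>(3) by (simp add: g_def comp_def)
  have wa: "(\<lambda>i. w (real (a (g i)) / real (g i))) \<longlonglongrightarrow> w \<sigma>"
    by (rule path_tendsto[OF w(1) a\<sigma>]) simp
  have w\<sigma>: "w \<sigma> \<in> F"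
    by (rule Lim_in_closed_set[OF F _ sequentially_bot wa]) (intro always_eventually allI a_hit g(2))
  have wait: "w s \<in> closure (- F)" if s: "0 \<le> s" "s < \<sigma>" for s
  proof -
    obtain c where c: "s < c" "c < \<sigma>" using dense[OF s(2)] by blast
    define b where "b = (\<lambda>i. nat \<lfloor>s * real (g i)\<rfloor>)"
    have bs: "(\<lambda>i. real (b i) / real (g i)) \<longlonglongrightarrow> s"
      unfolding b_def by (rule grid_floor_tendsto[OF g(1) s(1)])
    have wb: "(\<lambda>i. w (real (b i) / real (g i))) \<longlonglongrightarrow> w s"
      by (rule path_tendsto[OF w(1) bs]) simp
    have "\<forall>\<^sub>F i in sequentially. w (real (b i) / real (g i)) \<in> closure (- F)"
      using order_tendstoD(2)[OF bs c(1)] order_tendstoD(1)[OF a\<sigma> c(2)]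
    proof eventually_elim
      case (elim i)
      then have "real (b i) / real (g i) < real (a (g i)) / real (g i)" by linarith
      then have "b i < a (g i)" using g(2)[of i] by (auto dest: divide_less_cancel[THEN iffD1])
      then have "w (real (b i) / real (g i)) \<in> - F" using a_wait by simp
      then show ?case using closure_subset by blast
    qed
    from Lim_in_closed_set[OF closed_closure this sequentially_bot wb] show ?thesis .
  qed
  have "\<exists>t. \<sigma> \<le> t \<and> t \<le> \<sigma> + 1 / real j \<and> (\<forall>s\<in>{\<sigma>..t}. w s - w t \<in> wide_cone n \<eta>) \<and>
       w \<sigma> - w t - y0 *\<^sub>R n \<in> wide_cone n \<eta>" if n: "n \<in> NS" for n
  proof -
    have "\<forall>i. \<exists>k z. a (g i) \<le> k \<and> k < a (g i) + (g i div j + 1) \<and> 3 * \<eta>\<^sup>2 * (norm z)\<^sup>2 \<le> C / real (g i) \<and>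
        (\<forall>l\<in>{a (g i)..k}. w (real l / g i) - w (real k / g i) + z \<in> wide_cone n \<eta>) \<and>
        w (real (a (g i)) / g i) - w (real k / g i) + z - y0 *\<^sub>R n \<in> wide_cone n \<eta>"
    proof
      fix i
      interpret cone_walk n \<eta> "C / real (g i)" y0 F by (rule walk[OF n g(2)])
      have "calm (g i * T1 + (g i div j + 1)) (g i div j + 1) (increments (g i) w)"
        using g(3)[of i] n unfolding good_def by blast
      then show "\<exists>k z. a (g i) \<le> k \<and> k < a (g i) + (g i div j + 1) \<and> 3 * \<eta>\<^sup>2 * (norm z)\<^sup>2 \<le> C / real (g i) \<and>
        (\<forall>l\<in>{a (g i)..k}. w (real l / g i) - w (real k / g i) + z \<in> wide_cone n \<eta>) \<and>
        w (real (a (g i)) / g i) - w (real k / g i) + z - y0 *\<^sub>R n \<in> wide_cone n \<eta>"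
        by (rule grid_cone_time[OF w(2) _ a_le[OF g(2)] a_hit[OF g(2)] a_wait]) blast+
    qed
    then obtain k z where k: "\<And>i. a (g i) \<le> k i" "\<And>i. k i < a (g i) + (g i div j + 1)"
      and z: "\<And>i. 3 * \<eta>\<^sup>2 * (norm (z i))\<^sup>2 \<le> C / real (g i)"
      and cone: "\<And>i l. l \<in> {a (g i)..k i} \<Longrightarrow> w (real l / g i) - w (real (k i) / g i) + z i \<in> wide_cone n \<eta>"
      and drop: "\<And>i. w (real (a (g i)) / g i) - w (real (k i) / g i) + z i - y0 *\<^sub>R n \<in> wide_cone n \<eta>"
      by metis
    have k2: "real (k i) \<le> real (a (g i)) + real (g i) * (1 / real j) + 1" for i
    proof -
      have "real (k i) \<le> real (a (g i)) + real (g i div j) + 1" using k(2)[of i] by linarith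
      moreover have "real (g i div j) \<le> real (g i) / real j" by (rule of_nat_div_le_of_nat)
      ultimately show ?thesis by simp
    qed
    have nn: "norm n = 1" using walk[OF n, of 1] by (simp add: cone_walk_def)
    show ?thesis
      by (rule cone_time_limit[OF w(1) g(1,2) a\<sigma> _ _ k(1) k2 \<eta> z cone drop y0 nn]) (use \<sigma>(1) in auto)
  qed
  then show ?thesis using \<sigma>(1) w\<sigma> wait by (intro exI[of _ \<sigma>]) auto
qed

text \<open>Once \<sigma> is known, a nearby boundary point \<open>p\<close> selects the direction,
  and the cone time of that direction does not depend on \<open>x\<close>. At time \<sigma> the
  paths are within \<open>2 * \<delta>\<close> of \<open>p\<close>: one \<delta> for the path from
  \<open>y\<close>, one for continuity in \<open>x\<close>. A visit is forced by a drop above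
  \<open>4 * (2 * \<delta>)\<close>, whence the height \<open>9 * \<delta>\<close>.\<close>

lemma simultaneous_boundary_time:
  fixes w :: "real \<Rightarrow> 'a::euclidean_space"
  assumes D: "bounded D" "open D" "C2_boundary D" and y: "y \<in> closure D"
    and \<eta>: "0 < \<eta>" "\<eta> \<le> 1" and \<delta>: "0 < \<delta>"
    and flat: "\<And>p. p \<in> frontier D \<Longrightarrow> \<exists>n\<in>NS. flat_at D (\<eta> / 4) r p n"
    and w: "continuous_on {0..} w" "w 0 = 0"
    and sol: "\<And>x. x \<in> closure D \<Longrightarrow> skorokhod_solution D w x (X x) (L x)"
    and joint: "continuous_on (closure D \<times> {0..}) (\<lambda>(x, t). X x t)"
    and \<sigma>: "0 \<le> \<sigma>" "infdist (y + w \<sigma>) (- D) \<le> \<delta>"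
    and inside: "\<And>s. 0 \<le> s \<Longrightarrow> s < \<sigma> \<Longrightarrow> y + w s \<in> D"
    and cone: "\<And>n. n \<in> NS \<Longrightarrow> \<exists>t. \<sigma> \<le> t \<and> t \<le> \<sigma> + T2 \<and> (\<forall>s\<in>{\<sigma>..t}. w s - w t \<in> wide_cone n \<eta>) \<and>
       w \<sigma> - w t - (9 * \<delta>) *\<^sub>R n \<in> wide_cone n \<eta>"
    and osc: "\<And>s. s \<in> {\<sigma>..\<sigma> + T2} \<Longrightarrow> norm (w s - w \<sigma>) \<le> \<rho>" and small: "2 * \<delta> + \<rho> < r / 7"
  shows "\<exists>t>0. \<exists>r>0. \<forall>x \<in> ball y r \<inter> closure D. X x t \<in> frontier D"
proof -
  have X\<sigma>: "X y \<sigma> = y + w \<sigma>"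
    by (rule skorokhod_interior[OF sol[OF y] D(2) w(2,1) \<sigma>(1) inside])
  have "skorokhod_solution D w y (X y) (L y)" by (rule sol[OF y])
  then have "X y \<sigma> \<in> closure D" using \<sigma>(1) unfolding skorokhod_solution_def by blast
  moreover have "- D \<noteq> {}" using D(1) not_bounded_UNIV by (metis Compl_empty_eq double_compl)
  ultimately obtain p where p: "p \<in> frontier D" "norm (X y \<sigma> - p) \<le> \<delta>"
    using frontier_point_near[OF _ D(2)] \<sigma>(2) X\<sigma> by metis
  obtain n where n: "n \<in> NS" "flat_at D (\<eta> / 4) r p n" using flat[OF p(1)] by blast
  have nn: "norm n = 1" using n(2) by (simp add: flat_at_def)
  obtain t where t: "\<sigma> \<le> t" "t \<le> \<sigma> + T2" "\<And>s. s \<in> {\<sigma>..t} \<Longrightarrow> w s - w t \<in> wide_cone n \<eta>"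
    "w \<sigma> - w t - (9 * \<delta>) *\<^sub>R n \<in> wide_cone n \<eta>" using cone[OF n(1)] by blast
  have drop: "9 * \<delta> \<le> (w \<sigma> - w t) \<bullet> n"
  proof -
    have "0 \<le> \<eta> * norm (tang n (w \<sigma> - w t - (9 * \<delta>) *\<^sub>R n))" using \<eta> by simp
    also have "\<dots> \<le> (w \<sigma> - w t - (9 * \<delta>) *\<^sub>R n) \<bullet> n" using t(4) by (simp add: wide_cone_def)
    finally show ?thesis using nn by (simp add: inner_diff_left dot_square_norm)
  qed
  \<comment> \<open>This covers \<sigma> = 0, which may occur when \<open>y\<close> is on or close
    to the boundary: the positive drop still gives \<open>t > 0\<close>.\<close>
  then have "\<sigma> \<noteq> t" using \<delta> by auto
  then have tpos: "t > 0" using t(1) \<sigma>(1) by simp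
  have "continuous_on (closure D) (\<lambda>x. X x \<sigma>)"
  proof -
    have "continuous_on (closure D) (\<lambda>x. (\<lambda>(x, t). X x t) (x, \<sigma>))"
      by (rule continuous_on_compose2[OF joint]) (use \<sigma>(1) in \<open>auto intro!: continuous_intros\<close>)
    then show ?thesis by simp
  qed
  then obtain e where e: "e > 0" "\<And>x. x \<in> closure D \<Longrightarrow> dist x y < e \<Longrightarrow> dist (X x \<sigma>) (X y \<sigma>) < \<delta>"
    using y \<delta> unfolding continuous_on_iff by meson
  have "X x t \<in> frontier D" if x: "x \<in> ball y e \<inter> closure D" for x
  proof (rule cone_time_on_boundary[OF D(2,3) sol n(2) p(1), where \<kappa>="\<eta> / 2" and \<epsilon>="2 * \<delta>" and \<rho>=\<rho> and \<sigma>=\<sigma>])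
    show "x \<in> closure D" using x by simp
    have "dist (X x \<sigma>) (X y \<sigma>) < \<delta>" using e(2) x by (simp add: dist_commute)
    then show "norm (X x \<sigma> - p) \<le> 2 * \<delta>"
      using p(2) norm_triangle_ineq[of "X x \<sigma> - X y \<sigma>" "X y \<sigma> - p"] by (simp add: dist_norm)
    show "norm (w s - w \<sigma>) \<le> \<rho>" if "s \<in> {\<sigma>..t}" for s using osc that t(2) by simp
    show "\<eta> / 2 * norm (w s - w t) \<le> (w s - w t) \<bullet> n" if "s \<in> {\<sigma>..t}" for s
      by (rule wide_cone_lower[OF nn \<eta> t(3)[OF that]])
    show "4 * (2 * \<delta>) < (w \<sigma> - w t) \<bullet> n" using drop \<delta> by linarith
  qed (use \<eta> \<sigma>(1) t(1) small in auto)
  then show ?thesis using tpos e(1) by blast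
qed

text \<open>A limit of points farther than \<delta> from the complement still has distance at least
  \<delta> > 0 from it.\<close>

lemma closure_far_from_complement:
  fixes D :: "'a::euclidean_space set"
  assumes "v \<in> closure (- {v. infdist (y + v) (- D) \<le> \<delta>})" "0 < \<delta>"
  shows "y + v \<in> D"
proof (rule ccontr)
  have "closed {v. \<delta> \<le> infdist (y + v) (- D)}"
    by (intro closed_Collect_le continuous_intros)
  moreover have "- {v. infdist (y + v) (- D) \<le> \<delta>} \<subseteq> {v. \<delta> \<le> infdist (y + v) (- D)}" by auto
  ultimately have "v \<in> {v. \<delta> \<le> infdist (y + v) (- D)}"
    using assms(1) closure_minimal by blast
  moreover assume "y + v \<notin> D"
  then have "infdist (y + v) (- D) = 0" by (intro infdist_zero) simp
  ultimately show False using assms(2) by simp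
qed

section \<open>Almost sure existence\<close>

context prob_space
begin

text \<open>Reverse Fatou for events: all tail unions have probability at least \<open>c\<close>,
  and they decrease to the limit superior. The dependence between the events is immaterial.\<close>

lemma prob_frequently:
  assumes E: "\<And>m. E m \<in> events" and c: "\<forall>\<^sub>F m in sequentially. c \<le> prob (E m)"
  shows "{\<omega> \<in> space M. \<exists>\<^sub>\<infinity>m. \<omega> \<in> E m} \<in> events" and "c \<le> prob {\<omega> \<in> space M. \<exists>\<^sub>\<infinity>m. \<omega> \<in> E m}"
proof -
  define U where "U = (\<lambda>N. \<Union>m\<in>{N..}. E m)"
  have U: "range U \<subseteq> events" unfolding U_def using E by auto
  have eq: "{\<omega> \<in> space M. \<exists>\<^sub>\<infinity>m. \<omega> \<in> E m} = (\<Inter>N. U N)"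
    using E[THEN sets.sets_into_space] by (fastforce simp: U_def INFM_nat_le)
  show ev: "{\<omega> \<in> space M. \<exists>\<^sub>\<infinity>m. \<omega> \<in> E m} \<in> events" unfolding eq using U by auto
  have "decseq U" unfolding U_def by (intro decseq_SucI UN_mono) auto
  then have "(\<lambda>N. prob (U N)) \<longlonglongrightarrow> prob (\<Inter>N. U N)"
    using finite_Lim_measure_decseq[OF U] by simp
  moreover have "\<exists>N. \<forall>n\<ge>N. c \<le> prob (U n)"
  proof -
    obtain N where N: "\<And>m. m \<ge> N \<Longrightarrow> c \<le> prob (E m)" using c unfolding eventually_sequentially by blast
    have "prob (E m) \<le> prob (U m)" for m using U by (intro finite_measure_mono) (auto simp: U_def)
    then show ?thesis using N order_trans by blast
  qed
  ultimately show "c \<le> prob {\<omega> \<in> space M. \<exists>\<^sub>\<infinity>m. \<omega> \<in> E m}"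
    unfolding eq by (rule LIMSEQ_le_const)
qed

lemma gaussian_small_ball:
  assumes N: "distributed M lborel N (normal_density 0 (sqrt t))" and t: "t > 0" and R: "R \<ge> 0"
  shows "prob {\<omega> \<in> space M. \<bar>N \<omega>\<bar> \<le> R} \<le> 2 * R / sqrt t"
proof -
  have dens: "normal_density 0 (sqrt t) x \<le> 1 / sqrt t" for x
  proof -
    have "sqrt t \<le> sqrt (2 * pi * t)"
      using t pi_ge_two by (intro real_sqrt_le_mono) (simp add: mult_le_cancel_right1)
    then have "1 / sqrt (2 * pi * t) * exp (- x\<^sup>2 / (2 * t)) \<le> 1 / sqrt t * 1"
      using t by (intro mult_mono frac_le) auto
    then show ?thesis using t by (simp add: normal_density_def)
  qed
  have "{\<omega> \<in> space M. \<bar>N \<omega>\<bar> \<le> R} = N -` {-R..R} \<inter> space M" by auto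
  then have "emeasure M {\<omega> \<in> space M. \<bar>N \<omega>\<bar> \<le> R} =
      (\<integral>\<^sup>+x. ennreal (normal_density 0 (sqrt t) x) * indicator {-R..R} x \<partial>lborel)"
    using distributed_emeasure[OF N, of "{-R..R}"] by simp
  also have "\<dots> \<le> (\<integral>\<^sup>+x. ennreal (1 / sqrt t) * indicator {-R..R} x \<partial>lborel)"
    using dens by (intro nn_integral_mono mult_right_mono ennreal_leI) auto
  also have "\<dots> = ennreal (1 / sqrt t) * ennreal (2 * R)"
    using R by (simp add: nn_integral_cmult_indicator)
  also have "\<dots> = ennreal (2 * R / sqrt t)" using R t by (simp flip: ennreal_mult)
  finally show ?thesis using R t by (simp add: emeasure_eq_measure)
qed

end

context standard_brownian_motion
begin

lemma measurable_increment:
  "0 \<le> s \<Longrightarrow> 0 \<le> t \<Longrightarrow> (\<lambda>\<omega>. B t \<omega> - B s \<omega>) \<in> borel_measurable M"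
  using random_variable_B by (intro borel_measurable_diff) auto

lemma gaussian_increment:
  assumes "m > 0"
  shows "gaussian_step (1 / real m) (\<lambda>\<omega>. increments m (\<lambda>t. B t \<omega>) k)"
proof -
  have st: "0 \<le> real k / real m" "real k / real m < real (Suc k) / real m"
    "real (Suc k) / real m - real k / real m = 1 / real m"
    using assms by (auto simp: divide_strict_right_mono diff_divide_distrib[symmetric])
  show ?thesis
    unfolding gaussian_step_def increments_def
    using assms measurable_increment independent_coordinates[OF st(1,2)] gaussian_increments[OF st(1,2)]
    unfolding st(3) by auto
qed

lemma indep_increments:
  "indep_vars (\<lambda>_. borel) (\<lambda>k \<omega>. increments m (\<lambda>t. B t \<omega>) k) UNIV"
  unfolding increments_def
  by (rule independent_increments[of "\<lambda>i. real i / real m"])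
    (auto intro!: monoI divide_right_mono)

text \<open>One coordinate suffices, its density at time \<open>t\<close> being at most
  \<open>1 / sqrt t\<close>. The increment from time 0 appears because \<open>B 0 = 0\<close> holds
  only almost surely.\<close>

lemma prob_stays_bounded:
  fixes D :: "'a set"
  assumes "bounded D" "open D"
  obtains K where "\<And>t. t > 0 \<Longrightarrow> prob {\<omega> \<in> space M. y + (B t \<omega> - B 0 \<omega>) \<in> D} \<le> K / sqrt t"
proof -
  obtain R0 where R0: "\<And>x. x \<in> D \<Longrightarrow> norm x \<le> R0" using assms(1) unfolding bounded_iff by blast
  define R where "R = \<bar>R0\<bar> + norm y"
  obtain i :: 'a where i: "i \<in> Basis" using nonempty_Basis by blast
  have "prob {\<omega> \<in> space M. y + (B t \<omega> - B 0 \<omega>) \<in> D} \<le> 2 * R / sqrt t" if t: "t > 0" for t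
  proof -
    have d: "distributed M lborel (\<lambda>\<omega>. (B t \<omega> - B 0 \<omega>) \<bullet> i) (normal_density 0 (sqrt t))"
      using gaussian_increments[of 0 t i] t i by simp
    have [measurable]: "(\<lambda>\<omega>. (B t \<omega> - B 0 \<omega>) \<bullet> i) \<in> borel_measurable M"
      using measurable_increment[of 0 t] t by simp
    have "{\<omega> \<in> space M. y + (B t \<omega> - B 0 \<omega>) \<in> D} \<subseteq> {\<omega> \<in> space M. \<bar>(B t \<omega> - B 0 \<omega>) \<bullet> i\<bar> \<le> R}"
    proof safe
      fix \<omega> assume *: "y + (B t \<omega> - B 0 \<omega>) \<in> D"
      have "\<bar>(B t \<omega> - B 0 \<omega>) \<bullet> i\<bar> \<le> norm ((y + (B t \<omega> - B 0 \<omega>)) - y)"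
        using Basis_le_norm[OF i] by simp
      also have "\<dots> \<le> R" using norm_triangle_ineq4[of "y + (B t \<omega> - B 0 \<omega>)" y] R0[OF *] by (simp add: R_def)
      finally show "\<bar>(B t \<omega> - B 0 \<omega>) \<bullet> i\<bar> \<le> R" .
    qed
    then have "prob {\<omega> \<in> space M. y + (B t \<omega> - B 0 \<omega>) \<in> D} \<le> prob {\<omega> \<in> space M. \<bar>(B t \<omega> - B 0 \<omega>) \<bullet> i\<bar> \<le> R}"
      by (intro finite_measure_mono) measurable
    also have "\<dots> \<le> 2 * R / sqrt t" by (rule gaussian_small_ball[OF d t]) (simp add: R_def)
    finally show ?thesis .
  qed
  then show ?thesis by (rule that)
qed

end

theorem theorem2p1:
  fixes M :: "'w measure"
    and B :: "real \<Rightarrow> 'w \<Rightarrow> 'a::euclidean_space"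
    and D :: "'a set"
    and X :: "'a \<Rightarrow> real \<Rightarrow> 'w \<Rightarrow> 'a"
    and L :: "'a \<Rightarrow> real \<Rightarrow> 'w \<Rightarrow> real"
    and y :: 'a
  assumes "DIM('a) \<ge> 2"
    and "bounded D" "connected D" "open D" "C2_boundary D"
    and "synchronous_coupling M B D X L"
    and "y \<in> closure D"
  shows "AE \<omega> in M. \<exists>t>0. \<exists>r>0. \<forall>x \<in> ball y r \<inter> closure D. X x t \<omega> \<in> frontier D"
proof -
  interpret synchronous_coupling M B D X L by fact

  \<comment> \<open>Choice of the cone, of the directions and of the distances to the
    boundary\<close>
  define d where "d = real DIM('a)"
  have d: "d \<ge> 1" using DIM_positive[where 'a='a] by (simp add: d_def Suc_le_eq)
  \<comment> \<open>7 is the least integer whose square is at least 48, as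
    \<open>48 * \<eta>^2 * d <= 1\<close> requires for this form of \<eta> when
    \<open>d = 1\<close>.\<close>
  define \<eta> where "\<eta> = 1 / (7 * d)"
  have \<eta>: "0 < \<eta>" "\<eta> \<le> 1" "48 * \<eta>\<^sup>2 * DIM('a) \<le> 1"
  proof -
    show "0 < \<eta>" "\<eta> \<le> 1" using d by (auto simp: \<eta>_def)
    have "48 * \<eta>\<^sup>2 * d = 48 / (49 * d)" using d by (simp add: \<eta>_def power2_eq_square)
    also have "\<dots> \<le> 1" using d by simp
    finally show "48 * \<eta>\<^sup>2 * DIM('a) \<le> 1" by (simp add: d_def)
  qed
  obtain r NS where r: "r > 0" and NS: "finite NS" "\<And>n. n \<in> NS \<Longrightarrow> norm n = 1"
    and flat: "\<And>p. p \<in> frontier D \<Longrightarrow> \<exists>n\<in>NS. flat_at D (\<eta> / 4) r p n"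
    using uniformly_flat[OF assms(2,4,5), of "\<eta> / 4"] \<eta>(1) by (metis zero_less_divide_iff zero_less_numeral)
  define c where "c = real (card NS)"
  \<comment> \<open>The first entry gives
    \<open>2 * \<delta> j + r / 16 <= 3 * r / 32 < r / 7\<close>. The second makes the failure
    probabilities of all directions add up to at most \<open>1 / j\<close>; \<open>c + 1\<close> in
    place of \<open>c\<close> keeps the denominator positive.\<close>
  define \<delta> where "\<delta> = (\<lambda>j. min (r / 64) (1 / (9 * (real j * (c + 1) * (1 + 128 * real j))\<^sup>2)))"
  have \<delta>: "0 < \<delta> j" "\<delta> j \<le> r / 64" "c * (sqrt (9 * \<delta> j) * (1 + 128 * real j)) \<le> 1 / real j"
    if "j > 0" for j
  proof -
    define q where "q = real j * (c + 1) * (1 + 128 * real j)"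
    have q: "q > 0" using that by (simp add: q_def c_def add_nonneg_pos)
    show "0 < \<delta> j" "\<delta> j \<le> r / 64" using r q unfolding \<delta>_def q_def[symmetric] by auto
    have "9 * \<delta> j \<le> (1 / q)\<^sup>2"
      unfolding \<delta>_def q_def[symmetric] by (simp add: power_divide min_le_iff_disj)
    then have "sqrt (9 * \<delta> j) \<le> 1 / q" using q by (intro real_le_lsqrt) auto
    then have "c * (sqrt (9 * \<delta> j) * (1 + 128 * real j)) \<le> (c + 1) * (1 / q * (1 + 128 * real j))"
      using \<open>0 < \<delta> j\<close> q by (intro mult_mono) (auto simp: c_def)
    also have "\<dots> = 1 / real j"
    proof -
      have "c + 1 > 0" "1 + 128 * real j > 0" by (auto simp: c_def add_nonneg_pos)
      then show ?thesis using that by (simp add: q_def)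
    qed
    finally show "c * (sqrt (9 * \<delta> j) * (1 + 128 * real j)) \<le> 1 / real j" .
  qed
  define F where "F = (\<lambda>j. {v. infdist (y + v) (- D) \<le> \<delta> j})"
  have F: "closed (F j)" for j
    unfolding F_def by (intro closed_Collect_le continuous_intros)
  define C where "C = 53760 * d ^ 4"
  have C: "C > 0" using d by (simp add: C_def)
  define incr where "incr = (\<lambda>m \<omega>. increments m (\<lambda>t. B t \<omega>))"
  have cw: "cone_walk n \<eta> (C / real m) (9 * \<delta> j) (F j)" if "n \<in> NS" "m > 0" "j > 0" for n m j
    by standard (use that \<eta> NS C \<delta> F in auto)
  have rcw: "random_cone_walk n \<eta> (C / real m) (9 * \<delta> j) (F j) M (\<lambda>k \<omega>. incr m \<omega> k) (1 / real m)"
    if "n \<in> NS" "m > 0" "j > 0" for n m j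
  proof -
    interpret cone_walk n \<eta> "C / real m" "9 * \<delta> j" "F j" by (rule cw[OF that])
    show ?thesis
      by standard (use indep_increments gaussian_increment[OF that(2)] in \<open>auto simp: incr_def C_def d_def\<close>)
  qed

  \<comment> \<open>Good events and lower bounds for their probabilities\<close>
  define calmE where "calmE = (\<lambda>T j m n. {\<omega> \<in> space M. cone_walk.calm n \<eta> (C / real m) (9 * \<delta> j) (F j)
      (m * T + (m div j + 1)) (m div j + 1) (incr m \<omega>)})"
  have calmE: "calmE T j m n \<in> events" if "n \<in> NS" "m > 0" "j > 0" for T j m n
    using random_cone_walk.calm_event[OF rcw[OF that]] unfolding calmE_def .
  have calm_prob: "prob (space M - calmE T j m n) \<le> sqrt (9 * \<delta> j) * (1 + 128 * real j)"
    if "n \<in> NS" "m > 0" "j > 0" for T j m n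
  proof -
    have "space M - calmE T j m n = {\<omega> \<in> space M. \<not> cone_walk.calm n \<eta> (C / real m) (9 * \<delta> j) (F j)
      (m * T + (m div j + 1)) (m div j + 1) (\<lambda>i. incr m \<omega> i)}" by (auto simp: calmE_def)
    then have "prob (space M - calmE T j m n) \<le>
        sqrt (9 * \<delta> j) * (1 + 128 / (1 / real m * real (m div j + 1)))"
      using random_cone_walk.prob_not_calm[OF rcw[OF that], of "m div j + 1" "m * T + (m div j + 1)"] by simp
    also have "\<dots> \<le> sqrt (9 * \<delta> j) * (1 + 128 * real j)"
    proof -
      \<comment> \<open>Because of the \<open>+ 1\<close> the allowed steps of length
        \<open>1 / m\<close> cover at least a time \<open>1 / j\<close>, which makes the bound
        uniform in \<open>m\<close>.\<close>
      have "m < j * (m div j + 1)" using dividend_less_times_div[OF that(3)] by simp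
      then have "real m \<le> real j * real (m div j + 1)" by (metis less_imp_le of_nat_le_iff of_nat_mult)
      then have "128 / (1 / real m * real (m div j + 1)) \<le> 128 * real j"
        using that by (simp add: divide_le_eq mult.commute)
      then show ?thesis using \<delta>(1)[OF that(3)] by (intro mult_left_mono) auto
    qed
    finally show ?thesis .
  qed
  obtain K where K: "\<And>t. t > 0 \<Longrightarrow> prob {\<omega> \<in> space M. y + (B t \<omega> - B 0 \<omega>) \<in> D} \<le> K / sqrt t"
    using prob_stays_bounded[OF assms(2,4)] by metis
  define exitE where "exitE = (\<lambda>T. {\<omega> \<in> space M. y + (B (real T) \<omega> - B 0 \<omega>) \<notin> D})"
  have B0: "(\<lambda>\<omega>. y + (B (real T) \<omega> - B 0 \<omega>)) \<in> borel_measurable M" for T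
    using measurable_increment[of 0 "real T"] by (intro borel_measurable_add) auto
  have stayE: "{\<omega> \<in> space M. y + (B (real T) \<omega> - B 0 \<omega>) \<in> D} \<in> events" for T
    using measurable_sets[OF B0, of D T] assms(4) by (simp add: vimage_def Int_def conj_commute)
  have exitE: "exitE T \<in> events" for T
  proof -
    have "exitE T = space M - {\<omega> \<in> space M. y + (B (real T) \<omega> - B 0 \<omega>) \<in> D}" by (auto simp: exitE_def)
    then show ?thesis using stayE by simp
  qed
  \<comment> \<open>The empty set for zero indices keeps every member of the family measurable, and
    lets membership imply \<open>m > 0\<close>.\<close>
  define good where "good = (\<lambda>T j m. if m > 0 \<and> j > 0 then exitE T \<inter> (\<Inter>n\<in>NS. calmE T j m n) \<inter> space M else {})"
  have good: "good T j m \<in> events" for T j m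
  proof (cases "m > 0 \<and> j > 0")
    case True
    then have "exitE T - (\<Union>n\<in>NS. space M - calmE T j m n) \<in> events"
      using NS(1) calmE exitE by (intro sets.Diff sets.finite_UN) auto
    moreover have "good T j m = exitE T - (\<Union>n\<in>NS. space M - calmE T j m n)"
      using True by (auto simp: good_def exitE_def)
    ultimately show ?thesis by simp
  qed (auto simp: good_def)
  have prob_good: "1 - K / sqrt (real T) - 1 / real j \<le> prob (good T j m)"
    if "T > 0" "m > 0" "j > 0" for T j m
  proof -
    have "space M - good T j m \<subseteq>
        {\<omega> \<in> space M. y + (B (real T) \<omega> - B 0 \<omega>) \<in> D} \<union> (\<Union>n\<in>NS. space M - calmE T j m n)"
      using that by (auto simp: good_def exitE_def)
    then have "prob (space M - good T j m) \<le>
        prob ({\<omega> \<in> space M. y + (B (real T) \<omega> - B 0 \<omega>) \<in> D} \<union> (\<Union>n\<in>NS. space M - calmE T j m n))"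
      using stayE calmE that NS(1) by (intro finite_measure_mono sets.Un sets.finite_UN) auto
    also have "\<dots> \<le> prob {\<omega> \<in> space M. y + (B (real T) \<omega> - B 0 \<omega>) \<in> D}
        + prob (\<Union>n\<in>NS. space M - calmE T j m n)"
      using stayE calmE that NS(1) by (intro measure_Un_le sets.finite_UN) auto
    also have "prob (\<Union>n\<in>NS. space M - calmE T j m n) \<le> (\<Sum>n\<in>NS. prob (space M - calmE T j m n))"
      using calmE that NS(1) by (intro measure_UNION_le) auto
    also have "\<dots> \<le> c * (sqrt (9 * \<delta> j) * (1 + 128 * real j))"
      using calm_prob that unfolding c_def by (intro sum_bounded_above) auto
    also have "\<dots> \<le> 1 / real j" using \<delta>(3)[OF that(3)] .
    also have "prob {\<omega> \<in> space M. y + (B (real T) \<omega> - B 0 \<omega>) \<in> D} \<le> K / sqrt (real T)"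
      using K[of "real T"] that(1) by simp
    finally have "prob (space M - good T j m) \<le> K / sqrt (real T) + 1 / real j" by simp
    then show ?thesis using prob_compl[OF good[of T j m]] by simp
  qed
  define good1 where "good1 = (\<lambda>T j. {\<omega> \<in> space M. \<exists>\<^sub>\<infinity>m. \<omega> \<in> good T j m})"
  have good1: "good1 T j \<in> events" for T j
    unfolding good1_def by (rule prob_frequently(1)[where c=0]) (use good in auto)
  have prob_good1: "1 - K / sqrt (real T) - 1 / real j \<le> prob (good1 T j)" if "T > 0" "j > 0" for T j
    unfolding good1_def using good prob_good that
    by (intro prob_frequently(2) eventually_mono[OF eventually_gt_at_top[of 0]]) auto
  \<comment> \<open>Infinitely many \<open>m\<close> at fixed \<open>j\<close> are used for
    compactness along refining grids; infinitely many \<open>j\<close> allow the duration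
    \<open>1 / j\<close> to be adapted to the path.\<close>
  define good2 where "good2 = (\<lambda>T. {\<omega> \<in> space M. \<exists>\<^sub>\<infinity>j. \<omega> \<in> good1 T j})"
  have good2: "good2 T \<in> events" for T
    unfolding good2_def by (rule prob_frequently(1)[where c=0]) (use good1 in auto)
  have prob_good2: "1 - K / sqrt (real T) \<le> prob (good2 T)" if "T > 0" for T
  proof (rule field_le_epsilon)
    fix e :: real assume "e > 0"
    have "\<forall>\<^sub>F j in sequentially. 1 / real j < e"
      using order_tendstoD(2)[OF lim_1_over_n \<open>e > 0\<close>] by simp
    then have "\<forall>\<^sub>F j in sequentially. 1 - K / sqrt (real T) - e \<le> prob (good1 T j)"
      using eventually_gt_at_top[of 0]
    proof eventually_elim
      case (elim j)
      then show ?case using prob_good1[OF that, of j] by linarith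
    qed
    then have "1 - K / sqrt (real T) - e \<le> prob (good2 T)"
      unfolding good2_def by (intro prob_frequently(2) good1)
    then show "1 - K / sqrt (real T) \<le> prob (good2 T) + e" by simp
  qed
  have "prob (\<Union>T. good2 T) = 1"
  proof (rule antisym[OF prob_le_1])
    have "(\<lambda>T. 1 - K / sqrt (real T)) \<longlonglongrightarrow> 1 - 0"
      by (intro tendsto_diff tendsto_const tendsto_divide_0[OF tendsto_const]
          filterlim_at_top_imp_at_infinity filterlim_compose[OF sqrt_at_top filterlim_real_sequentially])
    moreover have "1 - K / sqrt (real T) \<le> prob (\<Union>T. good2 T)" if "T \<ge> 1" for T
      using prob_good2[of T] that good2 finite_measure_mono[of "good2 T" "\<Union>T. good2 T"] by fastforce
    ultimately have "1 - 0 \<le> prob (\<Union>T. good2 T)" by (intro LIMSEQ_le_const2) blast+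
    then show "1 \<le> prob (\<Union>T. good2 T)" by simp
  qed
  then have "AE \<omega> in M. \<omega> \<in> (\<Union>T. good2 T)" by (rule AE_prob_1)
  with start continuous_paths skorokhod jointly_continuous
  show ?thesis
  proof eventually_elim

    \<comment> \<open>The conclusion for a single path\<close>
    case (elim \<omega>)
    define w where "w = (\<lambda>t. B t \<omega>)"
    have w: "continuous_on {0..} w" "w 0 = 0" using elim by (simp_all add: w_def)
    from elim obtain T where "\<omega> \<in> good2 T" by blast
    then have T: "\<exists>\<^sub>\<infinity>j. \<omega> \<in> good1 T j" by (simp add: good2_def)
    \<comment> \<open>The modulus of continuity depends on \<omega>, so \<open>j\<close> can be
      chosen only now; the extra unit of time contains \<open>\<sigma> + 1 / j\<close>.\<close>
    have "uniformly_continuous_on {0..real T + 1} w"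
      by (intro compact_uniformly_continuous continuous_on_subset[OF w(1)]) auto
    then obtain \<tau> where \<tau>: "\<tau> > 0"
      "\<And>s s'. s \<in> {0..real T + 1} \<Longrightarrow> s' \<in> {0..real T + 1} \<Longrightarrow> dist s' s < \<tau> \<Longrightarrow> dist (w s') (w s) < r / 16"
      using r unfolding uniformly_continuous_on_def by (metis divide_pos_pos zero_less_numeral)
    obtain J where J: "real J > 1 / \<tau>" using reals_Archimedean2 by blast
    obtain j where j: "j \<ge> Suc J" "\<omega> \<in> good1 T j" using T unfolding INFM_nat_le by blast
    have j0: "j > 0" using j by simp
    have j\<tau>: "1 / real j < \<tau>" "1 / real j \<le> 1"
    proof -
      have "1 / \<tau> < real j" using j J by linarith
      then show "1 / real j < \<tau>" using \<tau>(1) j0 by (simp add: field_simps)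
      show "1 / real j \<le> 1" using j0 by simp
    qed
    have inf: "\<exists>\<^sub>\<infinity>m. \<omega> \<in> good T j m" using j(2) by (simp add: good1_def)
    have inf': "\<exists>\<^sub>\<infinity>m. m > 0 \<and> (\<forall>n\<in>NS. cone_walk.calm n \<eta> (C / real m) (9 * \<delta> j) (F j)
      (m * T + (m div j + 1)) (m div j + 1) (increments m w))"
      using inf by (rule INFM_mono) (auto simp: good_def calmE_def incr_def w_def split: if_splits)
    \<comment> \<open>Any single \<open>m\<close> will do, since the exit event is contained in each
      good event.\<close>
    obtain m where "\<omega> \<in> good T j m" using inf by (meson INFM_EX)
    then have "y + (B (real T) \<omega> - B 0 \<omega>) \<notin> D" by (auto simp: good_def exitE_def split: if_splits)
    then have "infdist (y + w (real T)) (- D) = 0" using w(2) by (intro infdist_zero) (simp add: w_def)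
    then have hit: "w (real T) \<in> F j" using \<delta>(1)[OF j0] by (simp add: F_def)
    obtain \<sigma> where \<sigma>: "0 \<le> \<sigma>" "\<sigma> \<le> real T" "w \<sigma> \<in> F j"
      "\<And>s. 0 \<le> s \<Longrightarrow> s < \<sigma> \<Longrightarrow> w s \<in> closure (- F j)"
      "\<And>n. n \<in> NS \<Longrightarrow> \<exists>t. \<sigma> \<le> t \<and> t \<le> \<sigma> + 1 / real j \<and> (\<forall>s\<in>{\<sigma>..t}. w s - w t \<in> wide_cone n \<eta>) \<and>
        w \<sigma> - w t - (9 * \<delta> j) *\<^sub>R n \<in> wide_cone n \<eta>"
      using path_cone_time[OF w j0 \<eta>(1) _ cw[OF _ _ j0] hit F inf'] \<delta>(1)[OF j0] by auto
    show ?case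
    proof (rule simultaneous_boundary_time[where w=w and L="\<lambda>x t. L x t \<omega>" and NS=NS and \<eta>=\<eta> and r=r
          and \<delta>="\<delta> j" and \<sigma>=\<sigma> and ?T2.0="1 / real j" and \<rho>="r / 16"])
      show "\<And>x. x \<in> closure D \<Longrightarrow> skorokhod_solution D w x (\<lambda>t. X x t \<omega>) (\<lambda>t. L x t \<omega>)"
        using elim by (simp add: w_def)
      show "continuous_on (closure D \<times> {0..}) (\<lambda>(x, t). X x t \<omega>)" using elim by blast
      show "infdist (y + w \<sigma>) (- D) \<le> \<delta> j" using \<sigma>(3) by (simp add: F_def)
      show "y + w s \<in> D" if "0 \<le> s" "s < \<sigma>" for s
        using closure_far_from_complement[of "w s" y D "\<delta> j"] \<sigma>(4)[OF that] \<delta>(1)[OF j0] by (simp add: F_def)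
      show "norm (w s - w \<sigma>) \<le> r / 16" if "s \<in> {\<sigma>..\<sigma> + 1 / real j}" for s
        using \<tau>(2)[of \<sigma> s] that \<sigma>(1,2) j\<tau> by (simp add: dist_norm)
      show "2 * \<delta> j + r / 16 < r / 7" using \<delta>(2)[OF j0] r by linarith
    qed (use assms \<eta> w \<sigma> flat \<delta>(1)[OF j0] in auto)
  qed
qed

end
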